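(* Let $\alpha\in(0,2\pi]$, let $f:\mathbb{R}^2\to\mathbb{R}$ be a probability density function that is bounded and almost everywhere continuous, and let $(r_n)_{n\ge1}$ be a sequence of positive reals with $r_n\to0$. Let $k\ge2$ and let $T$ be a connected feasible digraph of order $k$. Let $\tilde H_{n,T}$ be the number of isolated $T$-subgraphs of the random sector digraph $G(\mathcal{X}_n,\mathcal{Y}_n,r_n)$. Suppose $nr_n^2\to0$ and $\ln n=o\big(n^{2k-1}r_n^{4(k-1)}\big)$ as $n\to\infty$. Then $$\lim_{n\to\infty}n^{-k}r_n^{-2(k-1)}\tilde H_{n,T}=\mu_T\quad\text{almost surely},$$ where $$\mu_T:=\frac1{k!(2\pi)^k}\int_{[0,2\pi]^k}\int_{(\mathbb{R}^2)^{k}}h_T(0,z_2,\dots,z_k,y_1,\dots,y_k)\,f^k(x)\,\mathrm{d}x\,\mathrm{d}z_2\cdots\mathrm{d}z_k\,\mathrm{d}y_1\cdots\mathrm{d}y_k.$$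
   Context: Sectors: for $x\in\mathbb{R}^2$, $y\in[0,2\pi]$, $r>0$, $S(x,y,r)$ is the sector of the Euclidean disk of radius $r$ centered at $x$, with central angle $\alpha$ and inclination $y$ measured anticlockwise from the horizontal direction, i.e. $S(x,y,r)=\{x+\rho(\cos\phi,\sin\phi):0\le\rho\le r,\ y\le\phi\le y+\alpha\}$. Sector digraph: for distinct points $x_1,\dots,x_m\in\mathbb{R}^2$ and angles $y_1,\dots,y_m$, the digraph $G(\{x_i\},\{y_i\},r)$ has vertex set $\{x_1,\dots,x_m\}$ and an arc $(x_i,x_j)$, $i\ne j$, if and only if $x_j\in S(x_i,y_i,r)$. Random model: $X_1,X_2,\dots$ are i.i.d. random vectors in $\mathbb{R}^2$ with density $f$; $Y_1,Y_2,\dots$ are i.i.d. uniform on $[0,2\pi)$, independent of the $X_i$; $\mathcal{X}_n=\{X_1,\dots,X_n\}$, $\mathcal{Y}_n=\{Y_1,\dots,Y_n\}$. The random sector digraph is $G(\mathcal{X}_n,\mathcal{Y}_n,r_n)$. Subgraphs: $T$ is a fixed digraph on $k$ vertices, connected in the sense that its underlying undirected graph is connected. $T$ is feasible if $P(G(\mathcal{X}_k,\mathcal{Y}_k,r)\cong T)>0$ for some $r>0$. A subgraph $H$ of a digraph $G$ is isolated if it is an induced subgraph and no arc of $G$ leaves $H$ (no arc goes from a vertex of $H$ to a vertex outside $H$). An isolated $T$-subgraph is an isolated subgraph isomorphic to $T$; the count is over vertex subsets of size $k$. Indicator: $h_T(x_1,\dots,x_k,y_1,\dots,y_k)=1$ if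 $G(\{x_1,\dots,x_k\},\{y_1,\dots,y_k\},1)\cong T$, and $0$ otherwise. $f^k(x)$ means $(f(x))^k$. *)

theory Defs
  imports
    "HOL-Probability.Probability"
    "HOL-Library.Landau_Symbols"
    "Graph_Theory.Digraph_Isomorphism"
begin

definition sector :: "real \<Rightarrow> real^2 \<Rightarrow> real \<Rightarrow> real \<Rightarrow> (real^2) set" where
  "sector \<alpha> x y r =
     {x + \<rho> *\<^sub>R vector [cos \<phi>, sin \<phi>] |\<rho> \<phi>. 0 \<le> \<rho> \<and> \<rho> \<le> r \<and> y \<le> \<phi> \<and> \<phi> \<le> y + \<alpha>}"

text \<open>
  The vertices are the points themselves, not their indices, and only the values of
  \<open>x\<close> and \<open>y\<close> on \<open>{1..m}\<close> matter. The construction is meant for distinct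
  points \<open>x 1, \<dots>, x m\<close>; for the random points and the integral below, coincidences
  form a null set.
\<close>

definition sector_digraph ::
  "real \<Rightarrow> nat \<Rightarrow> (nat \<Rightarrow> real^2) \<Rightarrow> (nat \<Rightarrow> real) \<Rightarrow> real \<Rightarrow> (real^2, (real^2) \<times> (real^2)) pre_digraph"
where
  "sector_digraph \<alpha> m x y r =
     \<lparr> verts = x ` {1..m},
       arcs = {(x i, x j) |i j. i \<in> {1..m} \<and> j \<in> {1..m} \<and> i \<noteq> j \<and> x j \<in> sector \<alpha> (x i) (y i) r},
       tail = fst, head = snd \<rparr>"

text \<open>Arcs entering the subgraph from outside are allowed.\<close>

definition isolated_subgraph :: "('a, 'b) pre_digraph \<Rightarrow> ('a, 'b) pre_digraph \<Rightarrow> bool" where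
  "isolated_subgraph H G \<longleftrightarrow>
     induced_subgraph H G \<and> (\<forall>a\<in>arcs G. tail G a \<in> verts H \<longrightarrow> head G a \<in> verts H)"

definition isolated_count :: "('a, 'b) pre_digraph \<Rightarrow> ('c, 'd) pre_digraph \<Rightarrow> nat" where
  "isolated_count G T =
     card {U. U \<subseteq> verts G \<and> card U = card (verts T) \<and>
              isolated_subgraph (G \<restriction> U) G \<and> digraph_iso (G \<restriction> U) T}"

definition feasible ::
  "real \<Rightarrow> 'w measure \<Rightarrow> (nat \<Rightarrow> 'w \<Rightarrow> real^2) \<Rightarrow> (nat \<Rightarrow> 'w \<Rightarrow> real) \<Rightarrow> ('c, 'd) pre_digraph \<Rightarrow> bool"
where
  "feasible \<alpha> M X Y T \<longleftrightarrow>
     (\<exists>r>0. measure M {\<omega> \<in> space M.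
        digraph_iso (sector_digraph \<alpha> (card (verts T)) (\<lambda>i. X i \<omega>) (\<lambda>i. Y i \<omega>) r) T} > 0)"

definition h_ind ::
  "real \<Rightarrow> ('c, 'd) pre_digraph \<Rightarrow> (nat \<Rightarrow> real^2) \<Rightarrow> (nat \<Rightarrow> real) \<Rightarrow> real"
where
  "h_ind \<alpha> T x y = (if digraph_iso (sector_digraph \<alpha> (card (verts T)) x y 1) T then 1 else 0)"

text \<open>
  The variables \<open>z\<^sub>2, \<dots>, z\<^sub>k\<close> form a function \<open>z\<close> on \<open>{2..k}\<close>; updating it at
  \<open>1\<close> puts the first point at the origin.
\<close>

definition mu ::
  "real \<Rightarrow> (real^2 \<Rightarrow> real) \<Rightarrow> ('c, 'd) pre_digraph \<Rightarrow> real"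
where
  "mu \<alpha> f T = (let k = card (verts T) in
     1 / (fact k * (2 * pi) ^ k) *
     (LINT y:({1..k} \<rightarrow>\<^sub>E {0..2 * pi})|(\<Pi>\<^sub>M i\<in>{1..k}. lborel).
        integral\<^sup>L (lborel \<Otimes>\<^sub>M (\<Pi>\<^sub>M i\<in>{2..k}. lborel))
          (\<lambda>(x, z). h_ind \<alpha> T (z(1 := 0)) y * f x ^ k)))"

end

theory Submission
  imports Defs
begin

text \<open>
  Expectation: the affine substitution \<open>x\<^sub>i = x\<^sub>1 + r z\<^sub>i\<close> and dominated convergence show that \<open>k\<close> given
  points form a copy of \<open>T\<close> with probability asymptotic to \<open>k! \<mu>\<^sub>T r ^ (2 (k - 1))\<close>, and the
  extra neighbour that destroys isolation costs a factor \<open>O (n r\<^sup>2)\<close>, which tends to \<open>0\<close>.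

  Concentration: the isolated count itself has no bounded differences, because moving one point can
  create or destroy arbitrarily many isolated copies: many points may have their only arc towards it.
  Divide the plane into square cells of side \<open>r\<close>, assign each isolated copy to a cell, and discard
  the copies in cells that receive more than \<open>m\<^sup>k\<close> of them. Moving one point affects boundedly many
  cells, so McDiarmid's inequality applies to the truncated count. The truncation changes nothing unless
  some ball of radius \<open>O (r)\<close> contains more than \<open>m\<close> points, which has probability at most
  \<open>n (C n r\<^sup>2) ^ m\<close>. A suitable \<open>m\<close>, depending on \<open>n\<close>, makes both error probabilities
  summable, and the Borel--Cantelli lemma applies.
\<close>

section \<open>Sectors and sector digraphs\<close>

text \<open>The truncation level m must meet two opposing demands. With the normaliser a = n^k
  r^(2(k-1)) and differences of order m^k, McDiarmid's exponent for a deviation s a is of order a^2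
  / (n m^(2k)). Here a^2 / n = n^(2k-1) r^(4(k-1)) is exactly the quantity that dominates ln n by
  hypothesis, so concentration asks that m^(2k) ln n stay small against it, and the hypothesis
  offers no explicit room for a growing m. The crowding probability asks for a large m: the count
  may reach n^k, so a bound of order n^-(k+2) is aimed at, which makes the truncated and the full
  mean agree and is summable as well. The conflict is resolved for each n separately, according to
  the size of n r^2. Vertices of the digraph are random points, whereas copies are recorded as index
  sets, which do not depend on the sample; almost surely the points are distinct and both counts
  agree. The joint law is used in two forms: as a vector of points next to a vector of angles, so
  that the points can be rescaled at fixed angles, and as i.i.d. pairs, which are the coordinates
  for McDiarmid's inequality.\<close>

lemma mem_sector_iff:
  "v \<in> sector \<alpha> u y r \<longleftrightarrow>
     (\<exists>\<rho> \<phi>. 0 \<le> \<rho> \<and> \<rho> \<le> r \<and> y \<le> \<phi> \<and> \<phi> \<le> y + \<alpha> \<and> v$1 = u$1 + \<rho> * cos \<phi> \<and> v$2 = u$2 + \<rho> * sin \<phi>)"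
  by (auto simp: sector_def vec_eq_iff forall_2)

lemma dist_le_of_mem_sector:
  assumes "v \<in> sector \<alpha> u y r"
  shows "dist u v \<le> r"
proof -
  from assms obtain \<rho> \<phi> where *: "0 \<le> \<rho>" "\<rho> \<le> r" "v$1 = u$1 + \<rho> * cos \<phi>" "v$2 = u$2 + \<rho> * sin \<phi>"
    unfolding mem_sector_iff by blast
  have "(u$1 - v$1)\<^sup>2 + (u$2 - v$2)\<^sup>2 = \<rho>\<^sup>2 * ((cos \<phi>)\<^sup>2 + (sin \<phi>)\<^sup>2)"
    unfolding * by (simp add: power_mult_distrib flip: distrib_left)
  then have "dist u v = \<rho>"
    using \<open>0 \<le> \<rho>\<close> by (simp add: dist_vec_def L2_set_def sum_2 dist_real_def)
  with * show ?thesis by simp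
qed

lemma sector_scale_mono:
  assumes "0 < c" "v \<in> sector \<alpha> u y r"
  shows "t + c *\<^sub>R v \<in> sector \<alpha> (t + c *\<^sub>R u) y (c * r)"
proof -
  from assms obtain \<rho> \<phi> where *: "0 \<le> \<rho>" "\<rho> \<le> r" "y \<le> \<phi>" "\<phi> \<le> y + \<alpha>"
    "v$1 = u$1 + \<rho> * cos \<phi>" "v$2 = u$2 + \<rho> * sin \<phi>"
    unfolding mem_sector_iff by blast
  show ?thesis
    unfolding mem_sector_iff
    by (rule exI[of _ "c * \<rho>"], rule exI[of _ \<phi>]) (use * assms in \<open>auto simp: algebra_simps\<close>)
qed

text \<open>Homotheties preserve inclination and opening angle. The reverse direction is the forward
  one for the inverse map, with factor 1 / c and translation - t / c.\<close>

lemma mem_sector_scale: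
  assumes c: "0 < c"
  shows "t + c *\<^sub>R v \<in> sector \<alpha> (t + c *\<^sub>R u) y (c * r) \<longleftrightarrow> v \<in> sector \<alpha> u y r"
proof
  assume "t + c *\<^sub>R v \<in> sector \<alpha> (t + c *\<^sub>R u) y (c * r)"
  from sector_scale_mono[OF _ this, of "1 / c" "- (1 / c) *\<^sub>R t"] c show "v \<in> sector \<alpha> u y r"
    by (simp add: algebra_simps)
qed (rule sector_scale_mono[OF c])

text \<open>Rotating by \<open>- y\<close> turns a sector with variable inclination into a fixed compact set.\<close>

lemma mem_sector_rotate:
  "v \<in> sector \<alpha> u y r \<longleftrightarrow>
     (cos y * (v$1 - u$1) + sin y * (v$2 - u$2), cos y * (v$2 - u$2) - sin y * (v$1 - u$1))
       \<in> (\<lambda>(\<rho>, \<phi>). (\<rho> * cos \<phi>, \<rho> * sin \<phi>)) ` ({0..r} \<times> {0..\<alpha>})"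
    (is "_ \<longleftrightarrow> ?p \<in> _")
proof
  assume "v \<in> sector \<alpha> u y r"
  then obtain \<rho> \<phi> where *: "0 \<le> \<rho>" "\<rho> \<le> r" "y \<le> \<phi>" "\<phi> \<le> y + \<alpha>"
    "v$1 = u$1 + \<rho> * cos \<phi>" "v$2 = u$2 + \<rho> * sin \<phi>"
    unfolding mem_sector_iff by blast
  have "?p = (\<rho> * cos (\<phi> - y), \<rho> * sin (\<phi> - y))"
    unfolding * by (simp add: cos_diff sin_diff algebra_simps)
  then show "?p \<in> (\<lambda>(\<rho>, \<phi>). (\<rho> * cos \<phi>, \<rho> * sin \<phi>)) ` ({0..r} \<times> {0..\<alpha>})"
    using * by (auto intro!: image_eqI[of _ _ "(\<rho>, \<phi> - y)"])
next
  assume "?p \<in> (\<lambda>(\<rho>, \<phi>). (\<rho> * cos \<phi>, \<rho> * sin \<phi>)) ` ({0..r} \<times> {0..\<alpha>})"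
  then obtain \<rho> \<phi> where *: "0 \<le> \<rho>" "\<rho> \<le> r" "0 \<le> \<phi>" "\<phi> \<le> \<alpha>"
    and 1: "cos y * (v$1 - u$1) + sin y * (v$2 - u$2) = \<rho> * cos \<phi>"
    and 2: "cos y * (v$2 - u$2) - sin y * (v$1 - u$1) = \<rho> * sin \<phi>" by auto
  \<comment> \<open>The rotation matrix is orthogonal: multiplying the two coordinate equations by
    its transpose recovers v - u.\<close>
  have one: "cos y * cos y + sin y * sin y = 1"
    using sin_cos_squared_add3[of y] by simp
  have "\<rho> * cos (y + \<phi>) = cos y * (\<rho> * cos \<phi>) - sin y * (\<rho> * sin \<phi>)"
    by (simp add: cos_add algebra_simps)
  also have "\<dots> = (cos y * cos y + sin y * sin y) * (v$1 - u$1)"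
    unfolding 1[symmetric] 2[symmetric] by algebra
  finally have a: "\<rho> * cos (y + \<phi>) = v$1 - u$1" by (simp only: one mult_1)
  have "\<rho> * sin (y + \<phi>) = sin y * (\<rho> * cos \<phi>) + cos y * (\<rho> * sin \<phi>)"
    by (simp add: sin_add algebra_simps)
  also have "\<dots> = (cos y * cos y + sin y * sin y) * (v$2 - u$2)"
    unfolding 1[symmetric] 2[symmetric] by algebra
  finally have b: "\<rho> * sin (y + \<phi>) = v$2 - u$2" by (simp only: one mult_1)
  show "v \<in> sector \<alpha> u y r"
    unfolding mem_sector_iff
    by (rule exI[of _ \<rho>], rule exI[of _ "y + \<phi>"]) (use * a b in auto)
qed

lemma measurable_vec_nth[measurable]: "(\<lambda>v::real^'n. v $ i) \<in> borel_measurable borel"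
  by (intro borel_measurable_continuous_onI continuous_intros)

text \<open>In rotated coordinates the sector no longer depends on u and y, so the event is the
  preimage of one fixed compact set under a measurable map. This gives measurability jointly in
  centre, target and angle.\<close>

lemma pred_mem_sector:
  assumes [measurable]: "u \<in> borel_measurable N" "v \<in> borel_measurable N" "y \<in> borel_measurable N"
  shows "Measurable.pred N (\<lambda>\<omega>. v \<omega> \<in> sector \<alpha> (u \<omega>) (y \<omega>) r)"
proof -
  let ?K = "(\<lambda>(\<rho>, \<phi>). (\<rho> * cos \<phi>, \<rho> * sin \<phi>)) ` ({0..r} \<times> {0..\<alpha>})"
  have "compact ?K"
    by (intro compact_continuous_image compact_Times compact_Icc)
       (auto simp: case_prod_unfold intro!: continuous_intros)
  then have [measurable]: "?K \<in> sets borel" by (intro borel_compact)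
  show ?thesis unfolding mem_sector_rotate by measurable
qed

section \<open>Copies of the pattern as sets of indices\<close>

definition sector_arcs ::
  "real \<Rightarrow> real \<Rightarrow> (nat \<Rightarrow> real^2) \<Rightarrow> (nat \<Rightarrow> real) \<Rightarrow> nat set \<Rightarrow> (nat \<times> nat) set" where
  "sector_arcs \<alpha> r x y I = {(i, j). i \<in> I \<and> j \<in> I \<and> i \<noteq> j \<and> x j \<in> sector \<alpha> (x i) (y i) r}"

definition index_digraph :: "'a set \<Rightarrow> ('a \<times> 'a) set \<Rightarrow> ('a, 'a \<times> 'a) pre_digraph" where
  "index_digraph I A = \<lparr> verts = I, arcs = A, tail = fst, head = snd \<rparr>"

text \<open>Injectivity of \<open>x\<close> on \<open>I\<close> is part of the notion because the
  vertices here are indices: coinciding points would otherwise still count as \<open>card I\<close>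
  vertices, although the digraph on the points has fewer.\<close>

definition sector_copy ::
  "real \<Rightarrow> ('c, 'd) pre_digraph \<Rightarrow> real \<Rightarrow> (nat \<Rightarrow> real^2) \<Rightarrow> (nat \<Rightarrow> real) \<Rightarrow> nat set \<Rightarrow> bool" where
  "sector_copy \<alpha> T r x y I \<longleftrightarrow>
     inj_on x I \<and> digraph_iso (index_digraph I (sector_arcs \<alpha> r x y I)) T"

lemma ball_image_sector_arcs:
  "(\<forall>a\<in>map_prod x x ` sector_arcs \<alpha> r x y I. P (fst a) \<longrightarrow> Q (snd a)) \<longleftrightarrow>
     (\<forall>i\<in>I. \<forall>j\<in>I. i \<noteq> j \<and> x j \<in> sector \<alpha> (x i) (y i) r \<and> P (x i) \<longrightarrow> Q (x j))"
  by (auto simp: sector_arcs_def)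

lemma wf_index_digraph: "A \<subseteq> I \<times> I \<Longrightarrow> wf_digraph (index_digraph I A)"
  by (auto simp: wf_digraph_def index_digraph_def)

lemma sector_arcs_subset: "sector_arcs \<alpha> r x y I \<subseteq> I \<times> I"
  by (auto simp: sector_arcs_def)

text \<open>Arcs are pairs of vertices, so an injective relabelling of the vertices is injective on
  arcs and yields an isomorphism. Composing with it or with its inverse gives the two
  directions.\<close>

lemma digraph_iso_relabel:
  assumes A: "A \<subseteq> I \<times> I" and inj: "inj_on g I"
  shows "digraph_iso (index_digraph (g ` I) (map_prod g g ` A)) T \<longleftrightarrow> digraph_iso (index_digraph I A) T"
proof -
  let ?h = "\<lparr> iso_verts = g, iso_arcs = map_prod g g, iso_head = snd, iso_tail = fst \<rparr>"
  have "inj_on (map_prod g g) A"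
    by (rule inj_on_subset[OF map_prod_inj_on[OF inj inj] A])
  then have "pre_digraph.digraph_isomorphism (index_digraph I A) ?h"
    using wf_index_digraph[OF A] inj A
    by (auto simp: pre_digraph.digraph_isomorphism_def index_digraph_def)
  moreover have "index_digraph (g ` I) (map_prod g g ` A) = app_iso ?h (index_digraph I A)"
    by (simp add: index_digraph_def app_iso_def)
  ultimately have 1: "digraph_iso (index_digraph I A) (index_digraph (g ` I) (map_prod g g ` A))"
    unfolding digraph_iso_def by blast
  show ?thesis
    using digraph_iso_trans[OF 1, of T]
      digraph_iso_trans[OF digraph_iso_swap[OF wf_index_digraph[OF A] 1], of T] by blast
qed

lemma card_verts_digraph_iso:
  assumes "digraph_iso G H" shows "card (verts H) = card (verts G)"
  using assms unfolding digraph_iso_def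
  by (auto simp: pre_digraph.digraph_isomorphism_def card_image)

lemma sector_digraph_eq_index_digraph:
  "sector_digraph \<alpha> n x y r = index_digraph (x ` {1..n}) (map_prod x x ` sector_arcs \<alpha> r x y {1..n})"
  by (auto simp: sector_digraph_def index_digraph_def sector_arcs_def)

text \<open>No distinctness of the points has to be assumed: an isomorphism with T forces the image
  of {1..k} to have k elements, hence \<open>x\<close> is injective there.\<close>

lemma digraph_iso_sector_digraph_iff:
  assumes "card (verts T) = k"
  shows "digraph_iso (sector_digraph \<alpha> k x y r) T \<longleftrightarrow> sector_copy \<alpha> T r x y {1..k}"
proof -
  have "inj_on x {1..k}" if "digraph_iso (sector_digraph \<alpha> k x y r) T"
  proof (rule eq_card_imp_inj_on)
    show "card (x ` {1..k}) = card {1..k}"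
      using card_verts_digraph_iso[OF that] assms by (simp add: sector_digraph_def)
  qed simp
  then show ?thesis
    unfolding sector_copy_def sector_digraph_eq_index_digraph
    using digraph_iso_relabel[OF sector_arcs_subset] by blast
qed

lemma sector_arcs_reindex:
  assumes "bij_betw \<sigma> J I"
  shows "sector_arcs \<alpha> r x y I = map_prod \<sigma> \<sigma> ` sector_arcs \<alpha> r (x \<circ> \<sigma>) (y \<circ> \<sigma>) J"
proof -
  have I: "I = \<sigma> ` J" and inj: "inj_on \<sigma> J" using assms by (auto simp: bij_betw_def)
  show ?thesis
    unfolding I sector_arcs_def using inj by (fastforce simp: inj_on_def map_prod_def)
qed

text \<open>Serves to reduce an arbitrary index set of size k to {1..k}, where exchangeability of
  the random points can be applied.\<close>

lemma sector_copy_reindex: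
  assumes "bij_betw \<sigma> J I"
  shows "sector_copy \<alpha> T r x y I \<longleftrightarrow> sector_copy \<alpha> T r (x \<circ> \<sigma>) (y \<circ> \<sigma>) J"
proof -
  have I: "I = \<sigma> ` J" and inj: "inj_on \<sigma> J" using assms by (auto simp: bij_betw_def)
  have "inj_on x I \<longleftrightarrow> inj_on (x \<circ> \<sigma>) J"
    unfolding I using inj comp_inj_on_iff by blast
  moreover have "digraph_iso (index_digraph I (sector_arcs \<alpha> r x y I)) T \<longleftrightarrow>
      digraph_iso (index_digraph J (sector_arcs \<alpha> r (x \<circ> \<sigma>) (y \<circ> \<sigma>) J)) T"
    using digraph_iso_relabel[OF sector_arcs_subset inj] sector_arcs_reindex[OF assms]
    by (metis I)
  ultimately show ?thesis unfolding sector_copy_def by simp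
qed

lemma sector_copy_cong:
  assumes "\<And>i. i \<in> I \<Longrightarrow> x i = x' i" "\<And>i. i \<in> I \<Longrightarrow> y i = y' i"
  shows "sector_copy \<alpha> T r x y I \<longleftrightarrow> sector_copy \<alpha> T r x' y' I"
proof -
  have "sector_arcs \<alpha> r x y I = sector_arcs \<alpha> r x' y' I"
    using assms by (auto simp: sector_arcs_def)
  moreover have "inj_on x I \<longleftrightarrow> inj_on x' I" using assms by (intro inj_on_cong) auto
  ultimately show ?thesis by (simp add: sector_copy_def)
qed

lemma sector_copy_scale:
  assumes c: "0 < c"
  shows "sector_copy \<alpha> T (c * r) (\<lambda>i. t + c *\<^sub>R x i) y I \<longleftrightarrow> sector_copy \<alpha> T r x y I"
proof -
  have "sector_arcs \<alpha> (c * r) (\<lambda>i. t + c *\<^sub>R x i) y I = sector_arcs \<alpha> r x y I"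
    using mem_sector_scale[OF c] by (auto simp: sector_arcs_def)
  moreover have "inj_on (\<lambda>i. t + c *\<^sub>R x i) I \<longleftrightarrow> inj_on x I"
    using c by (auto simp: inj_on_def)
  ultimately show ?thesis by (simp add: sector_copy_def)
qed

text \<open>The random arc set takes only finitely many values in \<open>Pow (I \<times> I)\<close>,
  and the isomorphism type enters only through the list of admissible values. Each event that the
  arc set equals a given A is a finite Boolean combination of sector memberships.\<close>

lemma pred_sector_copy:
  assumes I: "finite I"
    and x: "\<And>i. i \<in> I \<Longrightarrow> (\<lambda>\<omega>. x \<omega> i) \<in> borel_measurable N"
    and y: "\<And>i. i \<in> I \<Longrightarrow> (\<lambda>\<omega>. y \<omega> i) \<in> borel_measurable N"
  shows "Measurable.pred N (\<lambda>\<omega>. sector_copy \<alpha> T r (x \<omega>) (y \<omega>) I)"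
proof -
  have arcs: "Measurable.pred N (\<lambda>\<omega>. sector_arcs \<alpha> r (x \<omega>) (y \<omega>) I = A)" for A
  proof -
    have "(\<lambda>\<omega>. sector_arcs \<alpha> r (x \<omega>) (y \<omega>) I = A) =
      (\<lambda>\<omega>. A \<subseteq> {(i, j) \<in> I \<times> I. i \<noteq> j} \<and>
         (\<forall>p\<in>{(i, j) \<in> I \<times> I. i \<noteq> j}. (x \<omega> (snd p) \<in> sector \<alpha> (x \<omega> (fst p)) (y \<omega> (fst p)) r) \<longleftrightarrow> p \<in> A))"
      unfolding sector_arcs_def by (rule ext) (auto 4 4)
    also have "Measurable.pred N \<dots>"
    proof (intro pred_intros_logic pred_intros_finite)
      show "finite {(i, j) \<in> I \<times> I. i \<noteq> j}"
        by (rule finite_subset[of _ "I \<times> I"]) (use I in auto)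
      fix p assume "p \<in> {(i, j) \<in> I \<times> I. i \<noteq> j}"
      then show "Measurable.pred N (\<lambda>\<omega>. x \<omega> (snd p) \<in> sector \<alpha> (x \<omega> (fst p)) (y \<omega> (fst p)) r)"
        by (intro pred_mem_sector x y) auto
    qed auto
    finally show ?thesis .
  qed
  have "(\<lambda>\<omega>. sector_copy \<alpha> T r (x \<omega>) (y \<omega>) I) =
    (\<lambda>\<omega>. (\<forall>i\<in>I. \<forall>j\<in>I. x \<omega> i = x \<omega> j \<longrightarrow> i = j) \<and>
       (\<exists>A\<in>{A \<in> Pow (I \<times> I). digraph_iso (index_digraph I A) T}. sector_arcs \<alpha> r (x \<omega>) (y \<omega>) I = A))"
    unfolding sector_copy_def inj_on_def using sector_arcs_subset by (intro ext) fastforce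
  also have "Measurable.pred N \<dots>"
  proof (intro pred_intros_logic pred_intros_finite I arcs)
    show "finite {A \<in> Pow (I \<times> I). digraph_iso (index_digraph I A) T}" using I by auto
    fix i j assume "i \<in> I" "j \<in> I"
    then show "Measurable.pred N (\<lambda>\<omega>. x \<omega> i = x \<omega> j)"
      using x[of i] x[of j] by measurable
  qed auto
  finally show ?thesis .
qed

text \<open>Connectedness passes from T to the index digraph along the isomorphism. Any two indices
  are then joined by a walk in the underlying undirected graph, and each step has length at most
  r.\<close>

lemma sector_copy_diameter:
  assumes T: "wf_digraph T" "Digraph_Component.connected T" and "finite I"
    and copy: "sector_copy \<alpha> T r x y I" and ij: "i \<in> I" "j \<in> I" and r: "0 \<le> r"
  shows "dist (x i) (x j) \<le> real (2 * (card I)\<^sup>2) * r"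
proof -
  let ?A = "sector_arcs \<alpha> r x y I"
  let ?G = "index_digraph I ?A"
  have wf: "wf_digraph ?G" by (intro wf_index_digraph sector_arcs_subset)
  have "digraph_iso T ?G"
    using copy digraph_iso_swap[OF wf, of T] by (simp add: sector_copy_def)
  then obtain h where h: "pre_digraph.digraph_isomorphism T h" "?G = app_iso h T"
    unfolding digraph_iso_def by auto
  then have "Digraph_Component.connected ?G"
    using wf_digraph.connectedI_app_iso[OF T(1) T(2) h(1)] by simp
  then have "(i, j) \<in> rtrancl_on (verts ?G) ((arcs_ends ?G)\<^sup>s)"
    using ij unfolding connected_conv by (auto simp: index_digraph_def)
  moreover have ends: "arcs_ends ?G = ?A"
    by (simp add: arcs_ends_def arc_to_ends_def index_digraph_def)
  moreover have swap: "(\<lambda>(a, b). (b, a)) ` ?A = ?A\<inverse>" by auto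
  ultimately have "(i, j) \<in> (?A \<union> ?A\<inverse>)\<^sup>*"
    unfolding symcl_def by (auto simp: ends swap dest: rtrancl_on_sub_rtrancl[THEN subsetD])
  moreover have fin: "finite (?A \<union> ?A\<inverse>)"
    using finite_subset[OF sector_arcs_subset] \<open>finite I\<close> by simp
  \<comment> \<open>A finite relation reaches whatever it can reach in at most as many steps as it
    has pairs; the arcs and their converses number at most 2 (card I)^2, which is the source of the
    crude constant.\<close>
  ultimately obtain m where m: "m \<le> card (?A \<union> ?A\<inverse>)" "(i, j) \<in> (?A \<union> ?A\<inverse>) ^^ m"
    using rtrancl_finite_eq_relpow[OF fin] by auto
  have walk: "(i, j) \<in> (?A \<union> ?A\<inverse>) ^^ m \<Longrightarrow> dist (x i) (x j) \<le> real m * r" for m j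
  proof (induction m arbitrary: j)
    case (Suc m)
    then obtain l where l: "(i, l) \<in> (?A \<union> ?A\<inverse>) ^^ m" "(l, j) \<in> ?A \<union> ?A\<inverse>" by auto
    then have "dist (x l) (x j) \<le> r"
      by (auto simp: sector_arcs_def dest!: dist_le_of_mem_sector simp: dist_commute)
    with Suc.IH[OF l(1)] dist_triangle[of "x i" "x j" "x l"] show ?case
      by (simp add: algebra_simps)
  qed simp
  have "card (?A \<union> ?A\<inverse>) \<le> card (I \<times> I)"
    using sector_arcs_subset[of \<alpha> r x y I] \<open>finite I\<close> by (intro card_mono) auto
  then have "m \<le> 2 * (card I)\<^sup>2"
    using m(1) by (simp add: card_cartesian_product power2_eq_square)
  then have "real m \<le> real (2 * (card I)\<^sup>2)" by (rule of_nat_mono)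
  then have "real m * r \<le> real (2 * (card I)\<^sup>2) * r" by (rule mult_right_mono) (rule r)
  with walk[OF m(2)] show ?thesis by linarith
qed

section \<open>Isolated copies\<close>

definition isolated_copies ::
  "real \<Rightarrow> ('c, 'd) pre_digraph \<Rightarrow> real \<Rightarrow> nat \<Rightarrow> (nat \<Rightarrow> real^2) \<Rightarrow> (nat \<Rightarrow> real) \<Rightarrow> nat set set" where
  "isolated_copies \<alpha> T r n x y =
     {I. I \<subseteq> {1..n} \<and> card I = card (verts T) \<and> sector_copy \<alpha> T r x y I \<and>
         (\<forall>i\<in>I. \<forall>j\<in>{1..n} - I. x j \<notin> sector \<alpha> (x i) (y i) r)}"

text \<open>Taking images under the injective map \<open>x\<close> is a bijection from index sets to
  vertex sets. Injectivity also lets membership of x j in the image of I be read as membership of j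
  in I, so that the induced arcs and the absence of outgoing arcs translate literally.\<close>

lemma isolated_count_eq_card_isolated_copies:
  assumes inj: "inj_on x {1..n}"
  shows "isolated_count (sector_digraph \<alpha> n x y r) T = card (isolated_copies \<alpha> T r n x y)"
proof -
  let ?G = "sector_digraph \<alpha> n x y r"
  have wf: "wf_digraph ?G"
    unfolding sector_digraph_eq_index_digraph
    by (intro wf_index_digraph) (auto simp: sector_arcs_def)
  have key: "(x ` I \<subseteq> verts ?G \<and> card (x ` I) = card (verts T) \<and>
        isolated_subgraph (?G \<restriction> (x ` I)) ?G \<and> digraph_iso (?G \<restriction> (x ` I)) T) \<longleftrightarrow>
      I \<in> isolated_copies \<alpha> T r n x y" if I: "I \<subseteq> {1..n}" for I
  proof -
    have injI: "inj_on x I" by (rule inj_on_subset[OF inj I])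
    have sub: "x ` I \<subseteq> verts ?G" using I by (auto simp: sector_digraph_def)
    have mem: "x i \<in> x ` I \<longleftrightarrow> i \<in> I" if "i \<in> {1..n}" for i
      using inj_on_image_mem_iff[OF inj that I] .
    have ind: "?G \<restriction> (x ` I) = index_digraph (x ` I) (map_prod x x ` sector_arcs \<alpha> r x y I)"
    proof -
      have "{a \<in> arcs ?G. fst a \<in> x ` I \<and> snd a \<in> x ` I} = map_prod x x ` sector_arcs \<alpha> r x y I"
      proof (intro equalityI subsetI)
        fix a assume "a \<in> {a \<in> arcs ?G. fst a \<in> x ` I \<and> snd a \<in> x ` I}"
        then have "a \<in> arcs ?G" and a: "fst a \<in> x ` I" "snd a \<in> x ` I" by auto
        from this(1) obtain i j where "a = (x i, x j)" "i \<in> {1..n}" "j \<in> {1..n}" "i \<noteq> j"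
          "x j \<in> sector \<alpha> (x i) (y i) r"
          unfolding sector_digraph_def by auto
        with a show "a \<in> map_prod x x ` sector_arcs \<alpha> r x y I"
          using mem by (auto simp: sector_arcs_def intro!: image_eqI[of _ _ "(i, j)"])
      next
        fix a assume "a \<in> map_prod x x ` sector_arcs \<alpha> r x y I"
        then obtain e where e: "a = map_prod x x e" "e \<in> sector_arcs \<alpha> r x y I" by (rule imageE)
        obtain i j where "e = (i, j)" by fastforce
        with e have "a = (x i, x j)" "i \<in> I" "j \<in> I" "(i, j) \<in> sector_arcs \<alpha> r x y {1..n}"
          using I by (auto simp: sector_arcs_def)
        moreover from this(4) have "map_prod x x (i, j) \<in> arcs ?G"
          unfolding sector_digraph_eq_index_digraph index_digraph_def pre_digraph.simps by (rule imageI)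
        ultimately show "a \<in> {a \<in> arcs ?G. fst a \<in> x ` I \<and> snd a \<in> x ` I}" by simp
      qed
      then show ?thesis
        by (simp add: induce_subgraph_def index_digraph_def sector_digraph_def)
    qed
    have iso: "isolated_subgraph (?G \<restriction> (x ` I)) ?G \<longleftrightarrow>
        (\<forall>i\<in>I. \<forall>j\<in>{1..n} - I. x j \<notin> sector \<alpha> (x i) (y i) r)"
    proof -
      have "induced_subgraph (?G \<restriction> (x ` I)) ?G"
        using wf_digraph.induced_induce[OF wf sub] .
      then have "isolated_subgraph (?G \<restriction> (x ` I)) ?G \<longleftrightarrow>
          (\<forall>a\<in>arcs ?G. fst a \<in> x ` I \<longrightarrow> snd a \<in> x ` I)"
        unfolding isolated_subgraph_def by (simp add: sector_digraph_def)
      also have "arcs ?G = map_prod x x ` sector_arcs \<alpha> r x y {1..n}"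
        by (simp add: sector_digraph_eq_index_digraph index_digraph_def)
      also have "(\<forall>a\<in>\<dots>. fst a \<in> x ` I \<longrightarrow> snd a \<in> x ` I) \<longleftrightarrow>
          (\<forall>i\<in>{1..n}. \<forall>j\<in>{1..n}. i \<noteq> j \<and> x j \<in> sector \<alpha> (x i) (y i) r \<and> x i \<in> x ` I \<longrightarrow> x j \<in> x ` I)"
        by (rule ball_image_sector_arcs[where P = "\<lambda>u. u \<in> x ` I" and Q = "\<lambda>u. u \<in> x ` I"])
      also have "\<dots> \<longleftrightarrow> (\<forall>i\<in>I. \<forall>j\<in>{1..n} - I. x j \<notin> sector \<alpha> (x i) (y i) r)"
      proof (intro iffI ballI)
        fix i j assume H: "\<forall>i\<in>{1..n}. \<forall>j\<in>{1..n}. i \<noteq> j \<and> x j \<in> sector \<alpha> (x i) (y i) r \<and> x i \<in> x ` I \<longrightarrow> x j \<in> x ` I"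
          and ij: "i \<in> I" "j \<in> {1..n} - I"
        then have "i \<in> {1..n}" "j \<in> {1..n}" "i \<noteq> j" "x j \<notin> x ` I" "x i \<in> x ` I"
          using I mem[of j] by auto
        with H show "x j \<notin> sector \<alpha> (x i) (y i) r" by blast
      next
        fix i j assume H: "\<forall>i\<in>I. \<forall>j\<in>{1..n} - I. x j \<notin> sector \<alpha> (x i) (y i) r"
          and ij: "i \<in> {1..n}" "j \<in> {1..n}"
        show "i \<noteq> j \<and> x j \<in> sector \<alpha> (x i) (y i) r \<and> x i \<in> x ` I \<longrightarrow> x j \<in> x ` I"
          using H mem[OF ij(1)] ij(2) by blast
      qed
      finally show ?thesis .
    qed
    show ?thesis
      unfolding isolated_copies_def sector_copy_def iso
      unfolding mem_Collect_eq ind digraph_iso_relabel[OF sector_arcs_subset injI] card_image[OF injI]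
      by (simp only: I injI sub simp_thms conj_ac)
  qed
  have "{U. U \<subseteq> verts ?G \<and> card U = card (verts T) \<and>
      isolated_subgraph (?G \<restriction> U) ?G \<and> digraph_iso (?G \<restriction> U) T} = (`) x ` isolated_copies \<alpha> T r n x y"
    (is "?L = ?R")
  proof (intro equalityI subsetI)
    fix U assume U: "U \<in> ?L"
    then have "U \<subseteq> x ` {1..n}" by (simp add: sector_digraph_def)
    then obtain I where I: "I \<subseteq> {1..n}" "U = x ` I"
      unfolding subset_image_iff by blast
    with U key[OF I(1)] have "I \<in> isolated_copies \<alpha> T r n x y" by (simp only: mem_Collect_eq)
    then show "U \<in> ?R" unfolding I(2) by (rule imageI)
  next
    fix U assume "U \<in> ?R"
    then obtain I where I: "I \<in> isolated_copies \<alpha> T r n x y" "U = x ` I" by auto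
    then have "I \<subseteq> {1..n}" by (simp add: isolated_copies_def)
    from I(1) key[OF this] show "U \<in> ?L" unfolding I(2) mem_Collect_eq by (simp only:)
  qed
  moreover have "inj_on ((`) x) (isolated_copies \<alpha> T r n x y)"
    using inj by (intro inj_on_image_Pow[THEN inj_on_subset]) (auto simp: isolated_copies_def)
  ultimately show ?thesis
    unfolding isolated_count_def by (simp add: card_image)
qed

section \<open>McDiarmid's inequality\<close>

text \<open>Hoeffding's lemma on the interval [v - c, v + c] of length 2c, whence t^2 (2c)^2 / 8.
  Only the distance to one reference value v is required, which is what a bounded-difference
  condition supplies directly.\<close>

lemma (in prob_space) hoeffding_mgf_bound:
  fixes g :: "'a \<Rightarrow> real"
  assumes [measurable]: "g \<in> borel_measurable M"
    and bnd: "\<And>x. x \<in> space M \<Longrightarrow> \<bar>g x - v\<bar> \<le> c"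
    and t: "0 < t" 
  shows "(\<integral>\<^sup>+x. ennreal (exp (t * (g x - expectation g))) \<partial>M) \<le> ennreal (exp (t\<^sup>2 * c\<^sup>2 / 2))"
proof -
  interpret interval_bounded_random_variable M g "v - c" "v + c"
    by unfold_locales (use bnd in \<open>auto simp: abs_le_iff field_simps intro!: AE_I2\<close>)
  have "(\<integral>\<^sup>+x. ennreal (exp (t * (g x - expectation g))) \<partial>M) \<le> ennreal (exp (t\<^sup>2 * (v + c - (v - c))\<^sup>2 / 8))"
    by (rule Hoeffdings_lemma_nn_integral[OF t])
  also have "t\<^sup>2 * (v + c - (v - c))\<^sup>2 / 8 = t\<^sup>2 * c\<^sup>2 / 2"
    by (simp add: power2_eq_square algebra_simps)
  finally show ?thesis .
qed

lemma space_PiM_update: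
  assumes "q \<in> space (PiM I N)" "a \<in> space (N j)"
  shows "q(j := a) \<in> space (PiM (insert j I) N)"
  using assms by (auto simp: space_PiM PiE_iff extensional_def)

text \<open>Induction on the coordinates takes the place of a martingale argument: one coordinate is
  integrated out, Hoeffding's lemma bounds the fluctuation along it, and the resulting average again
  has bounded differences in the remaining coordinates.\<close>

lemma bounded_differences_mgf:
  fixes F :: "('i \<Rightarrow> 'a) \<Rightarrow> real"
  assumes P: "prob_space P" and "finite I" and t: "0 < t"
    and F: "F \<in> borel_measurable (PiM I (\<lambda>_. P))"
    and bF: "\<And>p. p \<in> space (PiM I (\<lambda>_. P)) \<Longrightarrow> \<bar>F p\<bar> \<le> B"
    and diff: "\<And>p j a. p \<in> space (PiM I (\<lambda>_. P)) \<Longrightarrow> j \<in> I \<Longrightarrow> a \<in> space P \<Longrightarrow> \<bar>F p - F (p(j := a))\<bar> \<le> c"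
  shows "(\<integral>\<^sup>+p. ennreal (exp (t * (F p - integral\<^sup>L (PiM I (\<lambda>_. P)) F))) \<partial>PiM I (\<lambda>_. P))
           \<le> ennreal (exp (t\<^sup>2 * c\<^sup>2 * real (card I) / 2))"
  using \<open>finite I\<close> F bF diff
proof (induction I arbitrary: F rule: finite_induct)
  case empty
  then show ?case
    by (simp add: PiM_empty nn_integral_count_space_finite lebesgue_integral_count_space_finite)
next
  case (insert j I)
  interpret N: prob_space P by fact
  interpret product_prob_space "\<lambda>_. P" by unfold_locales
  interpret Q: prob_space "PiM I (\<lambda>_. P)" by (intro prob_space_PiM N.prob_space_axioms)
  interpret R: prob_space "PiM (insert j I) (\<lambda>_. P)" by (intro prob_space_PiM N.prob_space_axioms)
  note [measurable] = insert.prems(1)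
  \<comment> \<open>The average over coordinate j has the same mean as F and inherits both the bound
    B and the difference constant c, so the induction hypothesis applies to it.\<close>
  define G where "G q = (\<integral>a. F (q(j := a)) \<partial>P)" for q
  have upd: "q(j := a) \<in> space (PiM (insert j I) (\<lambda>_. P))"
    if "q \<in> space (PiM I (\<lambda>_. P))" "a \<in> space P" for q a
    using space_PiM_update[of q I "\<lambda>_. P"] that by auto
  have G_meas[measurable]: "G \<in> borel_measurable (PiM I (\<lambda>_. P))"
    unfolding G_def by measurable
  have Fq_meas: "(\<lambda>a. F (q(j := a))) \<in> borel_measurable P" if "q \<in> space (PiM I (\<lambda>_. P))" for q
    using that by measurable
  have Fq_int: "integrable P (\<lambda>a. F (q(j := a)))" if q: "q \<in> space (PiM I (\<lambda>_. P))" for q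
    by (rule N.integrable_const_bound[where B = B])
      (use insert.prems(2)[OF upd[OF q]] Fq_meas[OF q] in \<open>auto intro!: AE_I2 simp del: fun_upd_apply\<close>)
  have F_int: "integrable (PiM (insert j I) (\<lambda>_. P)) F"
    by (rule R.integrable_const_bound[where B = B]) (use insert.prems(2) in \<open>auto intro!: AE_I2\<close>)
  have EF: "integral\<^sup>L (PiM (insert j I) (\<lambda>_. P)) F = integral\<^sup>L (PiM I (\<lambda>_. P)) G"
    unfolding G_def using insert.hyps F_int by (subst product_integral_insert) auto
  have bG: "\<bar>G q\<bar> \<le> B" if q: "q \<in> space (PiM I (\<lambda>_. P))" for q
  proof -
    have "\<bar>G q\<bar> \<le> (\<integral>a. \<bar>F (q(j := a))\<bar> \<partial>P)" unfolding G_def by (rule integral_abs_bound)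
    also have "\<dots> \<le> (\<integral>a. B \<partial>P)"
      by (intro integral_mono) (use Fq_int[OF q] insert.prems(2)[OF upd[OF q]] in \<open>auto simp del: fun_upd_apply\<close>)
    finally show ?thesis by (simp add: N.prob_space)
  qed
  have diffG: "\<bar>G q - G (q(i := a))\<bar> \<le> c"
    if q: "q \<in> space (PiM I (\<lambda>_. P))" and i: "i \<in> I" and a: "a \<in> space P" for q i a
  proof -
    have qi: "q(i := a) \<in> space (PiM I (\<lambda>_. P))"
      using space_PiM_update[OF q, of a i] i a by (simp add: insert_absorb)
    have "i \<noteq> j" using i insert.hyps by auto
    have "G q - G (q(i := a)) = (\<integral>b. F (q(j := b)) - F (q(i := a, j := b)) \<partial>P)"
      unfolding G_def using Fq_int[OF q] Fq_int[OF qi] by simp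
    also have "\<bar>\<dots>\<bar> \<le> (\<integral>b. \<bar>F (q(j := b)) - F (q(i := a, j := b))\<bar> \<partial>P)" by (rule integral_abs_bound)
    also have "\<dots> \<le> (\<integral>b. c \<partial>P)"
    proof (intro integral_mono)
      fix b assume b: "b \<in> space P"
      show "\<bar>F (q(j := b)) - F (q(i := a, j := b))\<bar> \<le> c"
        using insert.prems(3)[OF upd[OF q b], of i a] i a
        by (simp add: fun_upd_twist[OF \<open>i \<noteq> j\<close>] del: fun_upd_apply)
    qed (use Fq_int[OF q] Fq_int[OF qi] in auto)
    finally show ?thesis by (simp add: N.prob_space)
  qed
  let ?E = "integral\<^sup>L (PiM I (\<lambda>_. P)) G"
  have "(\<integral>\<^sup>+p. ennreal (exp (t * (F p - ?E))) \<partial>PiM (insert j I) (\<lambda>_. P))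
      = (\<integral>\<^sup>+q. (\<integral>\<^sup>+a. ennreal (exp (t * (F (q(j := a)) - ?E))) \<partial>P) \<partial>PiM I (\<lambda>_. P))"
    using insert.hyps by (subst product_nn_integral_insert) auto
  also have "\<dots> \<le> (\<integral>\<^sup>+q. ennreal (exp (t\<^sup>2 * c\<^sup>2 / 2)) * ennreal (exp (t * (G q - ?E))) \<partial>PiM I (\<lambda>_. P))"
  proof (intro nn_integral_mono)
    fix q assume q: "q \<in> space (PiM I (\<lambda>_. P))"
    obtain a0 where a0: "a0 \<in> space P" using N.not_empty by auto
    have [measurable]: "(\<lambda>a. F (q(j := a))) \<in> borel_measurable P" by (rule Fq_meas[OF q])
    have "(\<integral>\<^sup>+a. ennreal (exp (t * (F (q(j := a)) - ?E))) \<partial>P)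
        = (\<integral>\<^sup>+a. ennreal (exp (t * (F (q(j := a)) - G q))) * ennreal (exp (t * (G q - ?E))) \<partial>P)"
      by (intro nn_integral_cong) (simp add: ennreal_mult'[symmetric] exp_add[symmetric] algebra_simps)
    also have "\<dots> = (\<integral>\<^sup>+a. ennreal (exp (t * (F (q(j := a)) - G q))) \<partial>P) * ennreal (exp (t * (G q - ?E)))"
      by (rule nn_integral_multc) measurable
    also have "(\<integral>\<^sup>+a. ennreal (exp (t * (F (q(j := a)) - G q))) \<partial>P) \<le> ennreal (exp (t\<^sup>2 * c\<^sup>2 / 2))"
      unfolding G_def
    \<comment> \<open>The fibre over q is centred at its own mean \<open>G q\<close>. Its value at
      an arbitrary point a0 serves as the reference value, from which every other value on the fibre
      differs by at most c.\<close>
    proof (rule N.hoeffding_mgf_bound[where v = "F (q(j := a0))"])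
      fix a assume "a \<in> space P"
      then show "\<bar>F (q(j := a)) - F (q(j := a0))\<bar> \<le> c"
        using insert.prems(3)[OF upd[OF q], of a j a0] a0 by (simp del: fun_upd_apply)
    qed (use t in auto)
    finally show "(\<integral>\<^sup>+a. ennreal (exp (t * (F (q(j := a)) - ?E))) \<partial>P)
        \<le> ennreal (exp (t\<^sup>2 * c\<^sup>2 / 2)) * ennreal (exp (t * (G q - ?E)))"
      by (simp add: mult_right_mono)
  qed
  also have "\<dots> = ennreal (exp (t\<^sup>2 * c\<^sup>2 / 2)) * (\<integral>\<^sup>+q. ennreal (exp (t * (G q - ?E))) \<partial>PiM I (\<lambda>_. P))"
    by (rule nn_integral_cmult) measurable
  also have "\<dots> \<le> ennreal (exp (t\<^sup>2 * c\<^sup>2 / 2)) * ennreal (exp (t\<^sup>2 * c\<^sup>2 * real (card I) / 2))"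
    by (intro mult_left_mono insert.IH G_meas bG diffG) auto
  also have "\<dots> = ennreal (exp (t\<^sup>2 * c\<^sup>2 * real (card (insert j I)) / 2))"
    using insert.hyps by (simp add: ennreal_mult'[symmetric] exp_add[symmetric] field_simps)
  finally show ?case by (simp only: EF)
qed

text \<open>Chernoff's bound applied to the moment generating function. The exponent has s^2 / (2
  c^2 n) instead of the sharp 2 s^2 / (c^2 n), because each fibre is enclosed in an interval of
  length 2c; constants do not matter below.\<close>

lemma bounded_differences_tail:
  fixes F :: "('i \<Rightarrow> 'a) \<Rightarrow> real"
  assumes P: "prob_space P" and "finite I" "I \<noteq> {}" and s: "0 < s" and c: "0 < c"
    and F[measurable]: "F \<in> borel_measurable (PiM I (\<lambda>_. P))"
    and bF: "\<And>p. p \<in> space (PiM I (\<lambda>_. P)) \<Longrightarrow> \<bar>F p\<bar> \<le> B"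
    and diff: "\<And>p j a. p \<in> space (PiM I (\<lambda>_. P)) \<Longrightarrow> j \<in> I \<Longrightarrow> a \<in> space P \<Longrightarrow> \<bar>F p - F (p(j := a))\<bar> \<le> c"
  shows "measure (PiM I (\<lambda>_. P)) {p \<in> space (PiM I (\<lambda>_. P)). s \<le> F p - integral\<^sup>L (PiM I (\<lambda>_. P)) F}
           \<le> exp (- s\<^sup>2 / (2 * c\<^sup>2 * real (card I)))"
proof -
  interpret R: prob_space "PiM I (\<lambda>_. P)" by (intro prob_space_PiM P)
  let ?E = "integral\<^sup>L (PiM I (\<lambda>_. P)) F"
  have n: "0 < real (card I)" using assms by (simp add: card_gt_0_iff)
  \<comment> \<open>Minimiser of - t s + t^2 c^2 n / 2, where n is the number of
    coordinates.\<close>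
  define t where "t = s / (c\<^sup>2 * real (card I))"
  have t: "0 < t" unfolding t_def using s c n by simp
  have "emeasure (PiM I (\<lambda>_. P)) {p \<in> space (PiM I (\<lambda>_. P)). s \<le> F p - ?E}
     = (\<integral>\<^sup>+p. indicator {p \<in> space (PiM I (\<lambda>_. P)). s \<le> F p - ?E} p \<partial>PiM I (\<lambda>_. P))"
    by (intro nn_integral_indicator[symmetric]) measurable
  also have "\<dots> \<le> (\<integral>\<^sup>+p. ennreal (exp (- t * s)) * ennreal (exp (t * (F p - ?E))) \<partial>PiM I (\<lambda>_. P))"
  proof (intro nn_integral_mono)
    fix p
    have "1 \<le> exp (- t * s) * exp (t * (F p - ?E))" if "s \<le> F p - ?E"
      using that t by (simp add: exp_add[symmetric])
    then show "indicator {p \<in> space (PiM I (\<lambda>_. P)). s \<le> F p - ?E} p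
        \<le> ennreal (exp (- t * s)) * ennreal (exp (t * (F p - ?E)))"
      by (auto simp: indicator_def ennreal_mult'[symmetric] simp flip: ennreal_1 intro!: ennreal_leI)
  qed
  also have "\<dots> = ennreal (exp (- t * s)) * (\<integral>\<^sup>+p. ennreal (exp (t * (F p - ?E))) \<partial>PiM I (\<lambda>_. P))"
    by (rule nn_integral_cmult) measurable
  also have "\<dots> \<le> ennreal (exp (- t * s)) * ennreal (exp (t\<^sup>2 * c\<^sup>2 * real (card I) / 2))"
    by (intro mult_left_mono bounded_differences_mgf[OF P \<open>finite I\<close> t F bF diff]) auto
  also have "\<dots> = ennreal (exp (- s\<^sup>2 / (2 * c\<^sup>2 * real (card I))))"
  proof -
    have "- t * s + t\<^sup>2 * c\<^sup>2 * real (card I) / 2 = - s\<^sup>2 / (2 * c\<^sup>2 * real (card I))"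
      unfolding t_def using s c n by (simp add: field_simps power2_eq_square)
    then show ?thesis by (simp add: ennreal_mult'[symmetric] exp_add[symmetric])
  qed
  finally show ?thesis by (simp add: R.emeasure_eq_measure)
qed

lemma bounded_differences_inequality:
  fixes F :: "('i \<Rightarrow> 'a) \<Rightarrow> real"
  assumes P: "prob_space P" and "finite I" "I \<noteq> {}" and s: "0 < s" and c: "0 < c"
    and F[measurable]: "F \<in> borel_measurable (PiM I (\<lambda>_. P))"
    and bF: "\<And>p. p \<in> space (PiM I (\<lambda>_. P)) \<Longrightarrow> \<bar>F p\<bar> \<le> B"
    and diff: "\<And>p j a. p \<in> space (PiM I (\<lambda>_. P)) \<Longrightarrow> j \<in> I \<Longrightarrow> a \<in> space P \<Longrightarrow> \<bar>F p - F (p(j := a))\<bar> \<le> c"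
  shows "measure (PiM I (\<lambda>_. P)) {p \<in> space (PiM I (\<lambda>_. P)). s \<le> \<bar>F p - integral\<^sup>L (PiM I (\<lambda>_. P)) F\<bar>}
           \<le> 2 * exp (- s\<^sup>2 / (2 * c\<^sup>2 * real (card I)))"
proof -
  interpret R: prob_space "PiM I (\<lambda>_. P)" by (intro prob_space_PiM P)
  let ?\<Omega> = "space (PiM I (\<lambda>_. P))" and ?E = "integral\<^sup>L (PiM I (\<lambda>_. P)) F"
  have up: "R.prob {p \<in> ?\<Omega>. s \<le> F p - ?E} \<le> exp (- s\<^sup>2 / (2 * c\<^sup>2 * real (card I)))"
    by (rule bounded_differences_tail) (use assms in auto)
  have "R.prob {p \<in> ?\<Omega>. s \<le> - F p - (\<integral>p. - F p \<partial>PiM I (\<lambda>_. P))}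
      \<le> exp (- s\<^sup>2 / (2 * c\<^sup>2 * real (card I)))"
  proof (rule bounded_differences_tail[where B = B])
    fix p j a assume "p \<in> ?\<Omega>" "j \<in> I" "a \<in> space P"
    then show "\<bar>- F p - - F (p(j := a))\<bar> \<le> c" using diff[of p j a] by auto
  qed (use assms in auto)
  then have down: "R.prob {p \<in> ?\<Omega>. s \<le> - F p + ?E} \<le> exp (- s\<^sup>2 / (2 * c\<^sup>2 * real (card I)))" by simp
  have "R.prob {p \<in> ?\<Omega>. s \<le> \<bar>F p - ?E\<bar>}
      \<le> R.prob ({p \<in> ?\<Omega>. s \<le> F p - ?E} \<union> {p \<in> ?\<Omega>. s \<le> - F p + ?E})"
    by (intro R.finite_measure_mono) auto
  also have "\<dots> \<le> R.prob {p \<in> ?\<Omega>. s \<le> F p - ?E} + R.prob {p \<in> ?\<Omega>. s \<le> - F p + ?E}"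
    by (intro measure_Un_le) measurable
  finally show ?thesis using up down by simp
qed

section \<open>The truncated count\<close>

text \<open>Overfull fibres of \<open>key\<close> are dropped altogether, so each value of the key
  contributes a number between 0 and m. This is what limits the effect of changing one
  fibre.\<close>

definition truncated_card :: "nat \<Rightarrow> 'a set \<Rightarrow> ('a \<Rightarrow> 'b) \<Rightarrow> nat" where
  "truncated_card m C key = card {I \<in> C. card {J \<in> C. key J = key I} \<le> m}"

lemma truncated_card_le: "finite C \<Longrightarrow> truncated_card m C key \<le> card C"
  unfolding truncated_card_def by (intro card_mono) auto

lemma truncated_card_eq_sum:
  assumes "finite C" "finite S" "key ` C \<subseteq> S"
  shows "truncated_card m C key =
    (\<Sum>Q\<in>S. if card {J \<in> C. key J = Q} \<le> m then card {J \<in> C. key J = Q} else 0)"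
proof -
  let ?D = "{I \<in> C. card {J \<in> C. key J = key I} \<le> m}"
  have key: "key ` ?D \<subseteq> S" using assms(3) by auto
  have "card ?D = (\<Sum>Q\<in>S. card {I \<in> ?D. key I = Q})"
    using sum.group[of ?D S key "\<lambda>_. 1 :: nat"] assms(1,2) key by simp
  also have "\<dots> = (\<Sum>Q\<in>S. if card {J \<in> C. key J = Q} \<le> m then card {J \<in> C. key J = Q} else 0)"
    by (intro sum.cong refl) (auto intro!: arg_cong[where f = card] simp: card_eq_0_iff)
  finally show ?thesis unfolding truncated_card_def .
qed

text \<open>Only the fibres over B can differ, and each of them contributes between 0 and m to
  either count.\<close>

lemma truncated_card_diff_le:
  assumes fin: "finite C" "finite C'" "finite B"
    and eq: "\<And>Q. Q \<notin> B \<Longrightarrow> {J \<in> C. key J = Q} = {J \<in> C'. key' J = Q}"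
  shows "\<bar>real (truncated_card m C key) - real (truncated_card m C' key')\<bar> \<le> real (m * card B)"
proof -
  define S where "S = key ` C \<union> key' ` C' \<union> B"
  define g where "g Q = (if card {J \<in> C. key J = Q} \<le> m then card {J \<in> C. key J = Q} else 0)" for Q
  define g' where "g' Q = (if card {J \<in> C'. key' J = Q} \<le> m then card {J \<in> C'. key' J = Q} else 0)" for Q
  have S: "finite S" "key ` C \<subseteq> S" "key' ` C' \<subseteq> S" "B \<subseteq> S" unfolding S_def using fin by auto
  have "\<bar>real (truncated_card m C key) - real (truncated_card m C' key')\<bar>
      = \<bar>\<Sum>Q\<in>S. real (g Q) - real (g' Q)\<bar>"
    using truncated_card_eq_sum[OF fin(1) S(1,2)] truncated_card_eq_sum[OF fin(2) S(1,3)]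
    by (simp add: g_def g'_def sum_subtractf)
  also have "(\<Sum>Q\<in>S. real (g Q) - real (g' Q)) = (\<Sum>Q\<in>B. real (g Q) - real (g' Q))"
    using S eq by (intro sum.mono_neutral_right) (auto simp: g_def g'_def)
  also have "\<bar>\<dots>\<bar> \<le> (\<Sum>Q\<in>B. \<bar>real (g Q) - real (g' Q)\<bar>)" by (rule sum_abs)
  also have "\<dots> \<le> (\<Sum>Q\<in>B. real m)"
    by (intro sum_mono) (auto simp: g_def g'_def)
  finally show ?thesis by (simp add: mult.commute)
qed

section \<open>The square grid and locality of the count\<close>

definition cell :: "real \<Rightarrow> real^2 \<Rightarrow> int \<times> int" where
  "cell r u = (\<lfloor>u$1 / r\<rfloor>, \<lfloor>u$2 / r\<rfloor>)"

definition cell_block :: "nat \<Rightarrow> int \<times> int \<Rightarrow> (int \<times> int) set" where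
  "cell_block K c = {fst c - int K..fst c + int K} \<times> {snd c - int K..snd c + int K}"

lemma card_cell_block: "card (cell_block K c) = (2 * K + 1)\<^sup>2"
proof -
  have "nat (1 + int K * 2) = 2 * K + 1" by linarith
  then show ?thesis by (simp add: cell_block_def card_cartesian_product power2_eq_square algebra_simps)
qed

lemma abs_floor_diff_le:
  fixes a b :: real
  assumes "\<bar>a - b\<bar> \<le> real d"
  shows "\<bar>\<lfloor>a\<rfloor> - \<lfloor>b\<rfloor>\<bar> \<le> int (Suc d)"
proof -
  have "\<lfloor>a\<rfloor> < \<lfloor>b\<rfloor> + 2 + int d" "\<lfloor>b\<rfloor> < \<lfloor>a\<rfloor> + 2 + int d"
    using assms by linarith+
  then show ?thesis by linarith
qed

lemma abs_vec_nth_diff_le_dist: "\<bar>u $ i - v $ i\<bar> \<le> dist u v" for u v :: "real^'n"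
  using component_le_norm_cart[of "u - v" i] by (simp add: dist_norm)

lemma cell_in_block:
  assumes r: "0 < r" and "dist u v \<le> real d * r"
  shows "cell r u \<in> cell_block (Suc d) (cell r v)"
proof -
  have *: "\<bar>\<lfloor>u$i / r\<rfloor> - \<lfloor>v$i / r\<rfloor>\<bar> \<le> int (Suc d)" for i
  proof (rule abs_floor_diff_le)
    have "\<bar>u$i / r - v$i / r\<bar> = \<bar>u$i - v$i\<bar> / r"
      using r by (simp add: diff_divide_distrib[symmetric] abs_divide)
    also have "\<dots> \<le> (real d * r) / r"
      using abs_vec_nth_diff_le_dist[of u i v] assms by (intro divide_right_mono) auto
    finally show "\<bar>u$i / r - v$i / r\<bar> \<le> real d" using r by simp
  qed
  show ?thesis
    using *[of 1] *[of 2] by (auto simp: cell_def cell_block_def abs_le_iff)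
qed

text \<open>Each coordinate differs by at most r, and the Euclidean distance is bounded by the sum
  of the two. This 2 is the additive term in the crowding radius (2 k^2 + 2) r.\<close>

lemma dist_le_of_cell_eq:
  assumes r: "0 < r" and "cell r u = cell r v"
  shows "dist u v \<le> 2 * r"
proof -
  have *: "\<bar>u$i - v$i\<bar> \<le> r" if "\<lfloor>u$i / r\<rfloor> = \<lfloor>v$i / r\<rfloor>" for i
  proof -
    have "\<bar>u$i / r - v$i / r\<bar> \<le> 1" using that by linarith
    then show ?thesis
      using r by (simp add: diff_divide_distrib[symmetric] abs_divide field_simps)
  qed
  have "dist u v \<le> (\<Sum>i\<in>UNIV. \<bar>dist (u$i) (v$i)\<bar>)"
    unfolding dist_vec_def by (rule L2_set_le_sum_abs)
  also have "\<dots> = \<bar>u$1 - v$1\<bar> + \<bar>u$2 - v$2\<bar>" by (simp add: sum_2 dist_real_def)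
  also have "\<dots> \<le> 2 * r" using *[of 1] *[of 2] assms by (simp add: cell_def)
  finally show ?thesis .
qed

lemma finite_isolated_copies: "finite (isolated_copies \<alpha> T r n x y)"
  by (rule finite_subset[of _ "Pow {1..n}"]) (auto simp: isolated_copies_def)

lemma card_isolated_copies_le: "card (isolated_copies \<alpha> T r n x y) \<le> n ^ card (verts T)"
proof -
  have "card (isolated_copies \<alpha> T r n x y) \<le> card {I. I \<subseteq> {1..n} \<and> card I = card (verts T)}"
    by (intro card_mono) (auto simp: isolated_copies_def)
  also have "\<dots> = n choose card (verts T)" by (simp add: n_subsets)
  also have "\<dots> \<le> n ^ card (verts T)"
    using binomial_le_pow[of "card (verts T)" n] by (cases "card (verts T) \<le> n") (auto simp: binomial_eq_0)
  finally show ?thesis .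
qed

text \<open>The point of least index represents a copy. The choice is arbitrary, but it depends on
  the index set alone, so it does not jump when points move.\<close>

definition truncated_isolated_count ::
  "nat \<Rightarrow> real \<Rightarrow> ('c, 'd) pre_digraph \<Rightarrow> real \<Rightarrow> nat \<Rightarrow> (nat \<Rightarrow> real^2) \<Rightarrow> (nat \<Rightarrow> real) \<Rightarrow> nat" where
  "truncated_isolated_count m \<alpha> T r n x y =
     truncated_card m (isolated_copies \<alpha> T r n x y) (\<lambda>I. cell r (x (Min I)))"

text \<open>A copy can change status only if the moved point belongs to it or if the new position
  enters one of its sectors. Either way the representative lies within (2 k^2 + 1) r of the old or
  the new position, by the diameter bound plus one arc length. However many copies point at the
  moved vertex, all of them sit in two blocks of cells.\<close>

lemma isolated_copies_locality:
  assumes T: "wf_digraph T" "Digraph_Component.connected T" "card (verts T) = k" "0 < k" and r: "0 < r"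
    and agree: "\<And>i. i \<noteq> j \<Longrightarrow> x i = x' i" "\<And>i. i \<noteq> j \<Longrightarrow> y i = y' i"
    and I: "I \<in> isolated_copies \<alpha> T r n x y"
    and not: "\<not> (I \<in> isolated_copies \<alpha> T r n x' y' \<and> cell r (x' (Min I)) = cell r (x (Min I)))"
  shows "cell r (x (Min I)) \<in> cell_block (2 * k\<^sup>2 + 2) (cell r (x j)) \<union> cell_block (2 * k\<^sup>2 + 2) (cell r (x' j))"
proof -
  have I': "I \<subseteq> {1..n}" "card I = k" "sector_copy \<alpha> T r x y I"
    and out: "\<And>i l. i \<in> I \<Longrightarrow> l \<in> {1..n} - I \<Longrightarrow> x l \<notin> sector \<alpha> (x i) (y i) r"
    using I T by (auto simp: isolated_copies_def)
  have fin: "finite I" using I'(1) finite_subset by blast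
  have "I \<noteq> {}" using I'(2) T(4) by auto
  then have Min: "Min I \<in> I" using fin by simp
  have diam: "dist (x a) (x b) \<le> real (2 * k\<^sup>2) * r" if "a \<in> I" "b \<in> I" for a b
    using sector_copy_diameter[OF T(1,2) fin I'(3) that] r I'(2) by simp
  have near: "cell r (x (Min I)) \<in> cell_block (2 * k\<^sup>2 + 2) (cell r u)"
    if "dist (x (Min I)) u \<le> real (2 * k\<^sup>2 + 1) * r" for u
    using cell_in_block[OF r that] by simp
  show ?thesis
  proof (cases "j \<in> I")
    case True
    have "dist (x (Min I)) (x j) \<le> real (2 * k\<^sup>2 + 1) * r"
      using diam[OF Min True] r by (simp add: algebra_simps)
    then show ?thesis using near by blast
  next
    case False
    then have x': "x' i = x i \<and> y' i = y i" if "i \<in> I" for i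
      using that agree(1)[of i] agree(2)[of i] by (cases "i = j") auto
    have "sector_copy \<alpha> T r x' y' I"
      using sector_copy_cong[of I x' x y' y] x' I'(3) by blast
    with not x' Min I'(1,2) T(3) obtain i l where il: "i \<in> I" "l \<in> {1..n} - I"
      "x' l \<in> sector \<alpha> (x' i) (y' i) r"
      by (auto simp: isolated_copies_def)
    \<comment> \<open>The copy did not point at \<open>x l\<close> before, and of all points only
      the j-th has moved.\<close>
    have "l = j"
    proof (rule ccontr)
      assume "l \<noteq> j"
      then have "x' l = x l" using agree(1) by simp
      then show False using out[OF il(1,2)] il(3) x'[OF il(1)] by simp
    qed
    then have "dist (x i) (x' j) \<le> r"
      using dist_le_of_mem_sector[OF il(3)] x'[OF il(1)] by simp
    then have "dist (x (Min I)) (x' j) \<le> real (2 * k\<^sup>2 + 1) * r"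
      using diam[OF Min il(1)] dist_triangle[of "x (Min I)" "x' j" "x i"] by (simp add: algebra_simps)
    then show ?thesis using near by blast
  qed
qed

text \<open>Two blocks of cells, around the old and the new position, contain all affected cells,
  and each cell accounts for at most m. The bound is uniform in n and r.\<close>

lemma truncated_isolated_count_bounded_differences:
  assumes T: "wf_digraph T" "Digraph_Component.connected T" "card (verts T) = k" "0 < k" and r: "0 < r"
    and agree: "\<And>i. i \<noteq> j \<Longrightarrow> x i = x' i" "\<And>i. i \<noteq> j \<Longrightarrow> y i = y' i"
  shows "\<bar>real (truncated_isolated_count m \<alpha> T r n x y) - real (truncated_isolated_count m \<alpha> T r n x' y')\<bar>
    \<le> real (m * (2 * (2 * (2 * k\<^sup>2 + 2) + 1)\<^sup>2))"
proof -
  let ?K = "2 * k\<^sup>2 + 2"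
  define B where "B = cell_block ?K (cell r (x j)) \<union> cell_block ?K (cell r (x' j))"
  have "card B \<le> (2 * ?K + 1)\<^sup>2 + (2 * ?K + 1)\<^sup>2"
    unfolding B_def using card_Un_le card_cell_block by metis
  then have card: "card B \<le> 2 * (2 * ?K + 1)\<^sup>2" by (simp only: mult_2)
  have fin: "finite B" by (simp add: B_def cell_block_def)
  have agree': "x' i = x i" "y' i = y i" if "i \<noteq> j" for i using agree[OF that] by auto
  \<comment> \<open>Locality is applied in both directions: to copies that disappear and, with the
    two configurations exchanged, to copies that appear.\<close>
  have "{J \<in> isolated_copies \<alpha> T r n x y. cell r (x (Min J)) = Q} =
      {J \<in> isolated_copies \<alpha> T r n x' y'. cell r (x' (Min J)) = Q}" if "Q \<notin> B" for Q
    using isolated_copies_locality[where x = x and x' = x' and y = y and y' = y' and j = j, OF T r agree]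
      isolated_copies_locality[where x = x' and x' = x and y = y' and y' = y and j = j, OF T r agree'] that
    unfolding B_def by blast
  then have "\<bar>real (truncated_isolated_count m \<alpha> T r n x y) - real (truncated_isolated_count m \<alpha> T r n x' y')\<bar>
      \<le> real (m * card B)"
    unfolding truncated_isolated_count_def
    by (intro truncated_card_diff_le finite_isolated_copies fin)
  also have "\<dots> \<le> real (m * (2 * (2 * ?K + 1)\<^sup>2))"
    using card by (intro of_nat_mono mult_left_mono) auto
  finally show ?thesis .
qed

text \<open>All copies assigned to one cell lie in a single ball of radius (2 k^2 + 2) r: 2 r within
  the cell and 2 k^2 r for the diameter. If such a ball holds at most m points, at most
  \<open>m choose k\<close> copies fit, which is why the truncation level is m^k.\<close>

lemma truncated_isolated_count_eq:
  assumes T: "wf_digraph T" "Digraph_Component.connected T" "card (verts T) = k" "0 < k" and r: "0 < r"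
    and crowd: "\<And>i. i \<in> {1..n} \<Longrightarrow> card {j \<in> {1..n}. dist (x i) (x j) \<le> real (2 * k\<^sup>2 + 2) * r} \<le> m"
  shows "truncated_isolated_count (m ^ k) \<alpha> T r n x y = card (isolated_copies \<alpha> T r n x y)"
proof -
  let ?C = "isolated_copies \<alpha> T r n x y"
  have "card {J \<in> ?C. cell r (x (Min J)) = cell r (x (Min I))} \<le> m ^ k" if I: "I \<in> ?C" for I
  proof -
    have member: "finite J" "Min J \<in> J" "J \<subseteq> {1..n}" "card J = k" "sector_copy \<alpha> T r x y J" if "J \<in> ?C" for J
    proof -
      from that show J: "J \<subseteq> {1..n}" "card J = k" "sector_copy \<alpha> T r x y J"
        using T by (auto simp: isolated_copies_def)
      show "finite J" using J(1) finite_subset by blast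
      moreover have "J \<noteq> {}" using J(2) T(4) by auto
      ultimately show "Min J \<in> J" by simp
    qed
    define D where "D = {j \<in> {1..n}. dist (x (Min I)) (x j) \<le> real (2 * k\<^sup>2 + 2) * r}"
    have "finite D" by (simp add: D_def)
    have cD: "card D \<le> m" unfolding D_def using member[OF I] by (intro crowd) auto
    have "J \<in> {J. J \<subseteq> D \<and> card J = k}" if J: "J \<in> ?C" "cell r (x (Min J)) = cell r (x (Min I))" for J
    proof -
      have "dist (x (Min I)) (x j) \<le> real (2 * k\<^sup>2 + 2) * r" if "j \<in> J" for j
      proof -
        have "dist (x (Min J)) (x j) \<le> real (2 * k\<^sup>2) * r"
          using sector_copy_diameter[OF T(1,2) _ member(5)[OF J(1)] member(2)[OF J(1)] that] member[OF J(1)] r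
          by simp
        moreover have "dist (x (Min I)) (x (Min J)) \<le> 2 * r"
          using dist_le_of_cell_eq[OF r] J(2) by simp
        ultimately show ?thesis
          using dist_triangle[of "x (Min I)" "x j" "x (Min J)"] by (simp add: algebra_simps)
      qed
      then show ?thesis using member[OF J(1)] by (auto simp: D_def)
    qed
    then have "card {J \<in> ?C. cell r (x (Min J)) = cell r (x (Min I))} \<le> card {J. J \<subseteq> D \<and> card J = k}"
      using \<open>finite D\<close> by (intro card_mono) auto
    also have "\<dots> = card D choose k" by (rule n_subsets[OF \<open>finite D\<close>])
    also have "\<dots> \<le> card D ^ k"
      using binomial_le_pow[of k "card D"] by (cases "k \<le> card D") (auto simp: binomial_eq_0)
    also have "\<dots> \<le> m ^ k" by (rule power_mono[OF cD]) simp
    finally show ?thesis .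
  qed
  then have "{I \<in> ?C. card {J \<in> ?C. cell r (x (Min J)) = cell r (x (Min I))} \<le> m ^ k} = ?C" by auto
  then show ?thesis unfolding truncated_isolated_count_def truncated_card_def by simp
qed

section \<open>Measurability of the counts\<close>

lemma pred_isolated_copies:
  assumes x: "\<And>i. i \<in> {1..n} \<Longrightarrow> (\<lambda>\<omega>. x \<omega> i) \<in> borel_measurable N"
    and y: "\<And>i. i \<in> {1..n} \<Longrightarrow> (\<lambda>\<omega>. y \<omega> i) \<in> borel_measurable N"
  shows "Measurable.pred N (\<lambda>\<omega>. I \<in> isolated_copies \<alpha> T r n (x \<omega>) (y \<omega>))"
proof (cases "I \<subseteq> {1..n}")
  case True
  then have "finite I" using finite_subset by blast
  with True show ?thesis
    unfolding isolated_copies_def mem_Collect_eq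
    by (intro pred_intros_logic pred_intros_finite pred_sector_copy pred_mem_sector x y) auto
qed (simp add: isolated_copies_def)

lemma measurable_card_isolated_copies:
  assumes x: "\<And>i. i \<in> {1..n} \<Longrightarrow> (\<lambda>\<omega>. x \<omega> i) \<in> borel_measurable N"
    and y: "\<And>i. i \<in> {1..n} \<Longrightarrow> (\<lambda>\<omega>. y \<omega> i) \<in> borel_measurable N"
  shows "(\<lambda>\<omega>. card (isolated_copies \<alpha> T r n (x \<omega>) (y \<omega>))) \<in> measurable N (count_space UNIV)"
proof -
  have "card (isolated_copies \<alpha> T r n (x \<omega>) (y \<omega>)) =
      (\<Sum>I\<in>Pow {1..n}. if I \<in> isolated_copies \<alpha> T r n (x \<omega>) (y \<omega>) then 1 else 0)" for \<omega>
    by (subst sum.If_cases) (auto simp: isolated_copies_def intro!: arg_cong[where f = card])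
  moreover note pred_isolated_copies[OF x y, measurable]
  ultimately show ?thesis by simp
qed

text \<open>Both the outer count and the count inside each cell are finite sums of indicators over
  the fixed family of k-subsets of {1..n}. Positivity of k guarantees that \<open>Min I\<close> is
  an actual index.\<close>

lemma measurable_truncated_isolated_count:
  assumes k: "0 < card (verts T)" and x: "\<And>i. i \<in> {1..n} \<Longrightarrow> (\<lambda>\<omega>. x \<omega> i) \<in> borel_measurable N"
    and y: "\<And>i. i \<in> {1..n} \<Longrightarrow> (\<lambda>\<omega>. y \<omega> i) \<in> borel_measurable N"
  shows "(\<lambda>\<omega>. truncated_isolated_count m \<alpha> T r n (x \<omega>) (y \<omega>)) \<in> measurable N (count_space UNIV)"
proof -
  let ?C = "\<lambda>\<omega>. isolated_copies \<alpha> T r n (x \<omega>) (y \<omega>)"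
  define P where "P = {I. I \<subseteq> {1..n} \<and> card I = card (verts T)}"
  have P: "finite P" unfolding P_def by simp
  have CP: "I \<in> P" if "I \<in> ?C \<omega>" for \<omega> I using that by (auto simp: isolated_copies_def P_def)
  have Min: "Min I \<in> {1..n}" if "I \<in> P" for I
  proof -
    have "finite I" "I \<noteq> {}" using that k finite_subset by (auto simp: P_def)
    then show ?thesis using that Min_in[of I] unfolding P_def by blast
  qed
  note [measurable] = pred_isolated_copies[OF x y]
  have [measurable]: "(\<lambda>\<omega>. \<lfloor>x \<omega> (Min I) $ c / r\<rfloor>) \<in> measurable N (count_space UNIV)" if "I \<in> P" for I c
    using x[OF Min[OF that]] by measurable
  have [measurable]: "Measurable.pred N (\<lambda>\<omega>. cell r (x \<omega> (Min J)) = cell r (x \<omega> (Min I)))"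
    if "I \<in> P" "J \<in> P" for I J
    unfolding cell_def prod.inject using that by measurable
  have card_eq: "card {J \<in> ?C \<omega>. cell r (x \<omega> (Min J)) = cell r (x \<omega> (Min I))} =
      (\<Sum>J\<in>P. if J \<in> ?C \<omega> \<and> cell r (x \<omega> (Min J)) = cell r (x \<omega> (Min I)) then 1 else 0)" for \<omega> I
    using P CP by (subst sum.If_cases) (auto intro!: arg_cong[where f = card])
  have [measurable]: "(\<lambda>\<omega>. card {J \<in> ?C \<omega>. cell r (x \<omega> (Min J)) = cell r (x \<omega> (Min I))})
      \<in> measurable N (count_space UNIV)" if "I \<in> P" for I
    unfolding card_eq using that by measurable
  have "truncated_isolated_count m \<alpha> T r n (x \<omega>) (y \<omega>) =
      (\<Sum>I\<in>P. if I \<in> ?C \<omega> \<and> card {J \<in> ?C \<omega>. cell r (x \<omega> (Min J)) = cell r (x \<omega> (Min I))} \<le> m then 1 else 0)" for \<omega>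
    unfolding truncated_isolated_count_def truncated_card_def
    using P CP by (subst sum.If_cases) (auto intro!: arg_cong[where f = card])
  then show ?thesis by simp
qed

section \<open>Independent pairs\<close>

text \<open>An intersection over K becomes one over its image once the events are transported along
  the inverse of \<sigma>; injectivity keeps the factors of the product apart.\<close>

lemma (in prob_space) indep_vars_reindex:
  assumes ind: "indep_vars (\<lambda>_. N) Z I" and inj: "inj_on \<sigma> J" and sub: "\<sigma> ` J \<subseteq> I"
  shows "indep_vars (\<lambda>_. N) (\<lambda>j. Z (\<sigma> j)) J"
  unfolding indep_vars_def2
proof (intro conjI ballI)
  show "random_variable N (Z (\<sigma> j))" if "j \<in> J" for j
    using ind sub that by (auto simp: indep_vars_def2)
  then have meas: "{Z (\<sigma> j) -` A \<inter> space M |A. A \<in> sets N} \<subseteq> events" if "j \<in> J" for j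
    using that by (auto intro: measurable_sets)
  show "indep_sets (\<lambda>j. {Z (\<sigma> j) -` A \<inter> space M |A. A \<in> sets N}) J"
  proof (rule indep_setsI[OF meas])
    fix A K assume K: "K \<noteq> {}" "K \<subseteq> J" "finite K"
      and A: "\<forall>j\<in>K. A j \<in> {Z (\<sigma> j) -` A \<inter> space M |A. A \<in> sets N}"
    have injK: "inj_on \<sigma> K" using inj K(2) inj_on_subset by blast
    define A' where "A' i = A (the_inv_into K \<sigma> i)" for i
    have A': "A' (\<sigma> j) = A j" if "j \<in> K" for j
      unfolding A'_def using the_inv_into_f_f[OF injK that] by simp
    have "prob (\<Inter>i\<in>\<sigma> ` K. A' i) = (\<Prod>i\<in>\<sigma> ` K. prob (A' i))"
    proof (rule indep_setsD)
      show "indep_sets (\<lambda>i. {Z i -` A \<inter> space M |A. A \<in> sets N}) I"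
        using ind by (simp add: indep_vars_def2)
      show "\<sigma> ` K \<subseteq> I" using sub K by auto
      show "\<forall>i\<in>\<sigma> ` K. A' i \<in> {Z i -` A \<inter> space M |A. A \<in> sets N}"
        using A A' by auto
    qed (use K in auto)
    then show "prob (\<Inter>j\<in>K. A j) = (\<Prod>j\<in>K. prob (A j))"
      using A' prod.reindex[OF injK, of "\<lambda>i. prob (A' i)"] by simp
  qed auto
qed

text \<open>Independence is assumed for the two complete sequences. Restriction to J is measurable,
  so events about finitely many coordinates belong to the generated sigma-algebras.\<close>

lemma (in prob_space) indep_set_vectors_prob:
  assumes X: "\<And>i. i \<in> I \<Longrightarrow> random_variable S (X i)" and Y: "\<And>i. i \<in> I \<Longrightarrow> random_variable S' (Y i)"
    and ind: "indep_set
      (sets (vimage_algebra (space M) (\<lambda>\<omega>. \<lambda>i\<in>I. X i \<omega>) (PiM I (\<lambda>_. S))))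
      (sets (vimage_algebra (space M) (\<lambda>\<omega>. \<lambda>i\<in>I. Y i \<omega>) (PiM I (\<lambda>_. S'))))"
    and J: "J \<subseteq> I" and A: "A \<in> sets (PiM J (\<lambda>_. S))" and B: "B \<in> sets (PiM J (\<lambda>_. S'))"
  shows "prob {\<omega> \<in> space M. (\<lambda>i\<in>J. X i \<omega>) \<in> A \<and> (\<lambda>i\<in>J. Y i \<omega>) \<in> B} =
    prob {\<omega> \<in> space M. (\<lambda>i\<in>J. X i \<omega>) \<in> A} * prob {\<omega> \<in> space M. (\<lambda>i\<in>J. Y i \<omega>) \<in> B}"
proof -
  have *: "{\<omega> \<in> space M. (\<lambda>i\<in>J. W i \<omega>) \<in> A} \<in> sets (vimage_algebra (space M) (\<lambda>\<omega>. \<lambda>i\<in>I. W i \<omega>) (PiM I (\<lambda>_. N)))"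
    if W: "\<And>i. i \<in> I \<Longrightarrow> random_variable N (W i)" and A: "A \<in> sets (PiM J (\<lambda>_. N))" for W A and N :: "'x measure"
  proof -
    have r: "(\<lambda>\<omega>. \<lambda>i\<in>I. W i \<omega>) \<in> space M \<rightarrow> space (PiM I (\<lambda>_. N))"
      using measurable_space[OF W] by (auto simp: space_PiM)
    have "(\<lambda>p. restrict p J) -` A \<inter> space (PiM I (\<lambda>_. N)) \<in> sets (PiM I (\<lambda>_. N))"
      using measurable_restrict_subset[OF J] A by (rule measurable_sets)
    from in_vimage_algebra[OF this, of "\<lambda>\<omega>. \<lambda>i\<in>I. W i \<omega>" "space M"]
    have "(\<lambda>\<omega>. \<lambda>i\<in>I. W i \<omega>) -` ((\<lambda>p. restrict p J) -` A \<inter> space (PiM I (\<lambda>_. N))) \<inter> space M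
        \<in> sets (vimage_algebra (space M) (\<lambda>\<omega>. \<lambda>i\<in>I. W i \<omega>) (PiM I (\<lambda>_. N)))" .
    also have "(\<lambda>\<omega>. \<lambda>i\<in>I. W i \<omega>) -` ((\<lambda>p. restrict p J) -` A \<inter> space (PiM I (\<lambda>_. N))) \<inter> space M
        = {\<omega> \<in> space M. (\<lambda>i\<in>J. W i \<omega>) \<in> A}"
      using r Int_absorb1[OF J] by (auto simp: restrict_restrict)
    finally show ?thesis .
  qed
  have "{\<omega> \<in> space M. (\<lambda>i\<in>J. X i \<omega>) \<in> A \<and> (\<lambda>i\<in>J. Y i \<omega>) \<in> B} =
    {\<omega> \<in> space M. (\<lambda>i\<in>J. X i \<omega>) \<in> A} \<inter> {\<omega> \<in> space M. (\<lambda>i\<in>J. Y i \<omega>) \<in> B}" by auto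
  with *[OF X A] *[OF Y B] ind show ?thesis
    unfolding indep_sets2_eq by auto
qed

text \<open>Rectangles determine a product of sigma-finite measures. Keeping all points in one
  factor and all angles in the other is the form suited to Fubini's theorem at fixed angles.\<close>

lemma (in prob_space) distr_vector_pair:
  assumes X: "indep_vars (\<lambda>_. S) X I" and Y: "indep_vars (\<lambda>_. S') Y I"
    and ind: "indep_set
      (sets (vimage_algebra (space M) (\<lambda>\<omega>. \<lambda>i\<in>I. X i \<omega>) (PiM I (\<lambda>_. S))))
      (sets (vimage_algebra (space M) (\<lambda>\<omega>. \<lambda>i\<in>I. Y i \<omega>) (PiM I (\<lambda>_. S'))))"
    and J: "J \<subseteq> I" "J \<noteq> {}" 
  shows "distr M (PiM J (\<lambda>_. S) \<Otimes>\<^sub>M PiM J (\<lambda>_. S')) (\<lambda>\<omega>. (\<lambda>i\<in>J. X i \<omega>, \<lambda>i\<in>J. Y i \<omega>)) =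
    (\<Pi>\<^sub>M i\<in>J. distr M S (X i)) \<Otimes>\<^sub>M (\<Pi>\<^sub>M i\<in>J. distr M S' (Y i))"
proof -
  have rX: "random_variable S (X i)" and rY: "random_variable S' (Y i)" if "i \<in> I" for i
    using X Y that by (auto simp: indep_vars_def2)
  have vX[measurable]: "random_variable (PiM J (\<lambda>_. S)) (\<lambda>\<omega>. \<lambda>i\<in>J. X i \<omega>)"
    and vY[measurable]: "random_variable (PiM J (\<lambda>_. S')) (\<lambda>\<omega>. \<lambda>i\<in>J. Y i \<omega>)"
    using rX rY J by (auto intro!: measurable_restrict)
  have dX: "(\<Pi>\<^sub>M i\<in>J. distr M S (X i)) = distr M (PiM J (\<lambda>_. S)) (\<lambda>\<omega>. \<lambda>i\<in>J. X i \<omega>)"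
    using indep_vars_iff_distr_eq_PiM'[where I = J and M' = "\<lambda>_. S" and X = X, OF J(2)]
      rX[OF subsetD[OF J(1)]] indep_vars_subset[OF X J(1)] by simp
  have dY: "(\<Pi>\<^sub>M i\<in>J. distr M S' (Y i)) = distr M (PiM J (\<lambda>_. S')) (\<lambda>\<omega>. \<lambda>i\<in>J. Y i \<omega>)"
    using indep_vars_iff_distr_eq_PiM'[where I = J and M' = "\<lambda>_. S'" and X = Y, OF J(2)]
      rY[OF subsetD[OF J(1)]] indep_vars_subset[OF Y J(1)] by simp
  interpret A: prob_space "distr M (PiM J (\<lambda>_. S)) (\<lambda>\<omega>. \<lambda>i\<in>J. X i \<omega>)" by (rule prob_space_distr[OF vX])
  interpret B: prob_space "distr M (PiM J (\<lambda>_. S')) (\<lambda>\<omega>. \<lambda>i\<in>J. Y i \<omega>)" by (rule prob_space_distr[OF vY])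
  show ?thesis
    unfolding dX dY
  proof (rule pair_measure_eqI[symmetric])
    fix C D assume "C \<in> sets (distr M (PiM J (\<lambda>_. S)) (\<lambda>\<omega>. \<lambda>i\<in>J. X i \<omega>))"
      "D \<in> sets (distr M (PiM J (\<lambda>_. S')) (\<lambda>\<omega>. \<lambda>i\<in>J. Y i \<omega>))"
    then have CD[measurable]: "C \<in> sets (PiM J (\<lambda>_. S))" "D \<in> sets (PiM J (\<lambda>_. S'))" by auto
    show "emeasure (distr M (PiM J (\<lambda>_. S)) (\<lambda>\<omega>. \<lambda>i\<in>J. X i \<omega>)) C *
        emeasure (distr M (PiM J (\<lambda>_. S')) (\<lambda>\<omega>. \<lambda>i\<in>J. Y i \<omega>)) D =
      emeasure (distr M (PiM J (\<lambda>_. S) \<Otimes>\<^sub>M PiM J (\<lambda>_. S')) (\<lambda>\<omega>. (\<lambda>i\<in>J. X i \<omega>, \<lambda>i\<in>J. Y i \<omega>))) (C \<times> D)"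
      using indep_set_vectors_prob[OF rX rY ind J(1) CD]
      by (simp add: emeasure_distr emeasure_eq_measure vimage_def Int_def ennreal_mult'[symmetric] conj_commute)
  qed (auto simp: A.sigma_finite_measure_axioms B.sigma_finite_measure_axioms cong: sets_pair_measure_cong)
qed

text \<open>The pairs generate sigma-algebras with the rectangles as an intersection-stable
  generator, so it suffices to factor probabilities of rectangles.\<close>

lemma (in prob_space) indep_vars_Pair:
  assumes X: "indep_vars (\<lambda>_. S) X I" and Y: "indep_vars (\<lambda>_. S') Y I"
    and ind: "indep_set
      (sets (vimage_algebra (space M) (\<lambda>\<omega>. \<lambda>i\<in>I. X i \<omega>) (PiM I (\<lambda>_. S))))
      (sets (vimage_algebra (space M) (\<lambda>\<omega>. \<lambda>i\<in>I. Y i \<omega>) (PiM I (\<lambda>_. S'))))"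
  shows "indep_vars (\<lambda>_. S \<Otimes>\<^sub>M S') (\<lambda>i \<omega>. (X i \<omega>, Y i \<omega>)) I"
    and "i \<in> I \<Longrightarrow> distr M (S \<Otimes>\<^sub>M S') (\<lambda>\<omega>. (X i \<omega>, Y i \<omega>)) = distr M S (X i) \<Otimes>\<^sub>M distr M S' (Y i)"
proof -
  have rX[measurable]: "random_variable S (X i)" and rY[measurable]: "random_variable S' (Y i)" if "i \<in> I" for i
    using X Y that by (auto simp: indep_vars_def2)
  define E where "E i a b = X i -` a \<inter> Y i -` b \<inter> space M" for i a b
  \<comment> \<open>Independence of the two sequences separates the X-part from the Y-part;
    independence within each sequence then splits both over the indices. Regrouping by index gives
    the factorisation for pairs.\<close>
  have prob_rect: "prob (\<Inter>i\<in>J. E i (a i) (b i)) =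
      (\<Prod>i\<in>J. prob (X i -` a i \<inter> space M)) * (\<Prod>i\<in>J. prob (Y i -` b i \<inter> space M))"
    if J: "J \<subseteq> I" "J \<noteq> {}" "finite J" and a: "\<And>i. i \<in> J \<Longrightarrow> a i \<in> sets S" and b: "\<And>i. i \<in> J \<Longrightarrow> b i \<in> sets S'" for J a b
  proof -
    have "prob {\<omega> \<in> space M. (\<lambda>i\<in>J. X i \<omega>) \<in> Pi\<^sub>E J a \<and> (\<lambda>i\<in>J. Y i \<omega>) \<in> Pi\<^sub>E J b} =
      prob {\<omega> \<in> space M. (\<lambda>i\<in>J. X i \<omega>) \<in> Pi\<^sub>E J a} * prob {\<omega> \<in> space M. (\<lambda>i\<in>J. Y i \<omega>) \<in> Pi\<^sub>E J b}"
      by (rule indep_set_vectors_prob[OF rX rY ind J(1)]) (use J(3) a b in auto)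
    moreover have "{\<omega> \<in> space M. (\<lambda>i\<in>J. X i \<omega>) \<in> Pi\<^sub>E J a} = (\<Inter>i\<in>J. X i -` a i \<inter> space M)"
      "{\<omega> \<in> space M. (\<lambda>i\<in>J. Y i \<omega>) \<in> Pi\<^sub>E J b} = (\<Inter>i\<in>J. Y i -` b i \<inter> space M)"
      "{\<omega> \<in> space M. (\<lambda>i\<in>J. X i \<omega>) \<in> Pi\<^sub>E J a \<and> (\<lambda>i\<in>J. Y i \<omega>) \<in> Pi\<^sub>E J b} = (\<Inter>i\<in>J. E i (a i) (b i))"
      using J(2) by (auto simp: E_def PiE_iff)
    ultimately show ?thesis
      using indep_varsD[OF X J(2,3,1), of a] indep_varsD[OF Y J(2,3,1), of b] a b by simp
  qed
  have prob_rect1: "prob (E i a b) = prob (X i -` a \<inter> space M) * prob (Y i -` b \<inter> space M)"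
    if "i \<in> I" "a \<in> sets S" "b \<in> sets S'" for i a b
    using prob_rect[of "{i}" "\<lambda>_. a" "\<lambda>_. b"] that by simp
  define F where "F i = {E i a b |a b. a \<in> sets S \<and> b \<in> sets S'}" for i
  have F: "indep_sets F I"
  proof (rule indep_setsI)
    show "F i \<subseteq> events" if "i \<in> I" for i
    proof -
      have "(X i -` a \<inter> space M) \<inter> (Y i -` b \<inter> space M) \<in> events" if "a \<in> sets S" "b \<in> sets S'" for a b
        using measurable_sets[OF rX[OF \<open>i \<in> I\<close>] that(1)] measurable_sets[OF rY[OF \<open>i \<in> I\<close>] that(2)]
        by (rule sets.Int)
      moreover have "(X i -` a \<inter> space M) \<inter> (Y i -` b \<inter> space M) = E i a b" for a b
        by (auto simp: E_def)
      ultimately show ?thesis unfolding F_def by auto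
    qed
    fix A J assume J: "J \<noteq> {}" "J \<subseteq> I" "finite J" and A: "\<forall>j\<in>J. A j \<in> F j"
    then obtain a b where ab: "\<And>j. j \<in> J \<Longrightarrow> a j \<in> sets S" "\<And>j. j \<in> J \<Longrightarrow> b j \<in> sets S'"
      "\<And>j. j \<in> J \<Longrightarrow> A j = E j (a j) (b j)"
      unfolding F_def mem_Collect_eq by metis
    then have "prob (\<Inter>j\<in>J. A j) = prob (\<Inter>j\<in>J. E j (a j) (b j))" by simp
    also have "\<dots> = (\<Prod>j\<in>J. prob (E j (a j) (b j)))"
    proof -
      have "(\<Prod>j\<in>J. prob (E j (a j) (b j))) =
          (\<Prod>j\<in>J. prob (X j -` a j \<inter> space M) * prob (Y j -` b j \<inter> space M))"
        using ab(1,2) J(2) by (intro prod.cong refl prob_rect1) blast+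
      moreover have "prob (\<Inter>j\<in>J. E j (a j) (b j)) =
          (\<Prod>j\<in>J. prob (X j -` a j \<inter> space M)) * (\<Prod>j\<in>J. prob (Y j -` b j \<inter> space M))"
        using J(2,1,3) ab(1,2) by (rule prob_rect)
      ultimately show ?thesis by (simp only: prod.distrib)
    qed
    finally show "prob (\<Inter>j\<in>J. A j) = (\<Prod>j\<in>J. prob (A j))" using ab by simp
  qed
  have E_Int: "E i a b \<inter> E i a' b' = E i (a \<inter> a') (b \<inter> b')" for i a b a' b'
    by (auto simp: E_def)
  have "Int_stable (F i)" for i
  proof (rule Int_stableI)
    fix C D assume "C \<in> F i" "D \<in> F i"
    then obtain a b a' b' where "C = E i a b" "D = E i a' b'"
      "a \<in> sets S" "b \<in> sets S'" "a' \<in> sets S" "b' \<in> sets S'"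
      unfolding F_def by auto
    then show "C \<inter> D \<in> F i"
      unfolding F_def E_Int by (auto simp: E_Int)
  qed
  then have sig: "indep_sets (\<lambda>i. sigma_sets (space M) (F i)) I"
    by (intro indep_sets_sigma[OF F]) auto
  show "indep_vars (\<lambda>_. S \<Otimes>\<^sub>M S') (\<lambda>i \<omega>. (X i \<omega>, Y i \<omega>)) I"
    unfolding indep_vars_def2
  proof (intro conjI ballI indep_sets_mono_sets[OF sig])
    fix i assume i: "i \<in> I"
    have Z: "(\<lambda>\<omega>. (X i \<omega>, Y i \<omega>)) \<in> space M \<rightarrow> space S \<times> space S'"
      using rX[OF i] rY[OF i] by (auto dest: measurable_space)
    have "{(\<lambda>\<omega>. (X i \<omega>, Y i \<omega>)) -` A \<inter> space M |A. A \<in> sets (S \<Otimes>\<^sub>M S')}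
        = sigma_sets (space M) {(\<lambda>\<omega>. (X i \<omega>, Y i \<omega>)) -` A \<inter> space M |A. A \<in> {a \<times> b |a b. a \<in> sets S \<and> b \<in> sets S'}}"
      unfolding sets_pair_measure by (rule sigma_sets_vimage_commute[OF Z])
    also have "{(\<lambda>\<omega>. (X i \<omega>, Y i \<omega>)) -` A \<inter> space M |A. A \<in> {a \<times> b |a b. a \<in> sets S \<and> b \<in> sets S'}} = F i"
    proof -
      have "E i a b = (\<lambda>\<omega>. (X i \<omega>, Y i \<omega>)) -` (a \<times> b) \<inter> space M" for a b by (auto simp: E_def)
      then show ?thesis unfolding F_def by (simp only:) blast
    qed
    finally show "{(\<lambda>\<omega>. (X i \<omega>, Y i \<omega>)) -` A \<inter> space M |A. A \<in> sets (S \<Otimes>\<^sub>M S')}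
        \<subseteq> sigma_sets (space M) (F i)" by simp
  qed measurable
  show "distr M (S \<Otimes>\<^sub>M S') (\<lambda>\<omega>. (X i \<omega>, Y i \<omega>)) = distr M S (X i) \<Otimes>\<^sub>M distr M S' (Y i)" if i: "i \<in> I"
  proof (rule pair_measure_eqI[symmetric])
    interpret A: prob_space "distr M S (X i)" by (rule prob_space_distr[OF rX[OF i]])
    interpret B: prob_space "distr M S' (Y i)" by (rule prob_space_distr[OF rY[OF i]])
    show "sigma_finite_measure (distr M S (X i))" "sigma_finite_measure (distr M S' (Y i))"
      by unfold_locales
    fix a b assume "a \<in> sets (distr M S (X i))" "b \<in> sets (distr M S' (Y i))"
    then have ab: "a \<in> sets S" "b \<in> sets S'" by auto
    have "(\<lambda>\<omega>. (X i \<omega>, Y i \<omega>)) -` (a \<times> b) \<inter> space M = E i a b" by (auto simp: E_def)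
    with prob_rect1[OF i ab] ab show "emeasure (distr M S (X i)) a * emeasure (distr M S' (Y i)) b =
        emeasure (distr M (S \<Otimes>\<^sub>M S') (\<lambda>\<omega>. (X i \<omega>, Y i \<omega>))) (a \<times> b)"
      using rX[OF i] rY[OF i] by (simp add: emeasure_distr emeasure_eq_measure ennreal_mult'[symmetric])
  qed (auto cong: sets_pair_measure_cong)
qed

section \<open>The marked point process\<close>

lemma isolated_copies_cong:
  assumes "\<And>i. i \<in> {1..n} \<Longrightarrow> x i = x' i" "\<And>i. i \<in> {1..n} \<Longrightarrow> y i = y' i"
  shows "isolated_copies \<alpha> T r n x y = isolated_copies \<alpha> T r n x' y'"
proof -
  have "I \<in> isolated_copies \<alpha> T r n x y \<longleftrightarrow> I \<in> isolated_copies \<alpha> T r n x' y'" for I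
  proof (cases "I \<subseteq> {1..n}")
    case True
    then have "sector_copy \<alpha> T r x y I \<longleftrightarrow> sector_copy \<alpha> T r x' y' I"
      using assms by (intro sector_copy_cong) auto
    moreover have "(\<forall>i\<in>I. \<forall>j\<in>{1..n} - I. x j \<notin> sector \<alpha> (x i) (y i) r) \<longleftrightarrow>
        (\<forall>i\<in>I. \<forall>j\<in>{1..n} - I. x' j \<notin> sector \<alpha> (x' i) (y' i) r)"
    proof (intro ball_cong refl)
      fix i j assume "i \<in> I" "j \<in> {1..n} - I"
      then have "i \<in> {1..n}" "j \<in> {1..n}" using True by auto
      then show "x j \<notin> sector \<alpha> (x i) (y i) r \<longleftrightarrow> x' j \<notin> sector \<alpha> (x' i) (y' i) r"
        by (simp only: assms)
    qed
    ultimately show ?thesis unfolding isolated_copies_def mem_Collect_eq by (simp only:)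
  qed (simp add: isolated_copies_def)
  then show ?thesis by blast
qed

lemma truncated_card_cong:
  assumes "\<And>I. I \<in> C \<Longrightarrow> key I = key' I"
  shows "truncated_card m C key = truncated_card m C key'"
proof -
  have "{J \<in> C. key J = key I} = {J \<in> C. key' J = key' I}" if "I \<in> C" for I
    using assms that by auto
  then show ?thesis unfolding truncated_card_def by (intro arg_cong[where f = card]) auto
qed

lemma truncated_isolated_count_cong:
  assumes k: "0 < card (verts T)"
    and eq: "\<And>i. i \<in> {1..n} \<Longrightarrow> x i = x' i" "\<And>i. i \<in> {1..n} \<Longrightarrow> y i = y' i"
  shows "truncated_isolated_count m \<alpha> T r n x y = truncated_isolated_count m \<alpha> T r n x' y'"
proof -
  have "x (Min I) = x' (Min I)" if "I \<in> isolated_copies \<alpha> T r n x y" for I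
  proof -
    have I: "I \<subseteq> {1..n}" "card I = card (verts T)" using that by (auto simp: isolated_copies_def)
    then have "finite I" "I \<noteq> {}" using k finite_subset by auto
    then have "Min I \<in> {1..n}" using I(1) Min_in by blast
    then show ?thesis by (rule eq)
  qed
  moreover have "isolated_copies \<alpha> T r n x' y' = isolated_copies \<alpha> T r n x y"
    by (intro isolated_copies_cong[symmetric] eq)
  ultimately show ?thesis
    unfolding truncated_isolated_count_def by (auto intro: truncated_card_cong)
qed

locale sector_process = prob_space M for M :: "'w measure" +
  fixes f :: "real^2 \<Rightarrow> real" and B :: real
    and X :: "nat \<Rightarrow> 'w \<Rightarrow> real^2" and Y :: "nat \<Rightarrow> 'w \<Rightarrow> real"
  assumes f_meas[measurable]: "f \<in> borel_measurable borel" and f_nonneg: "\<And>x. 0 \<le> f x"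
    and f_int: "(\<integral>\<^sup>+x. ennreal (f x) \<partial>lborel) = 1"
    and f_le: "\<And>x. f x \<le> B"
    and X_indep: "indep_vars (\<lambda>_. borel) X {1..}"
    and X_distr: "\<And>i. 1 \<le> i \<Longrightarrow> distr M borel (X i) = density lborel f"
    and Y_indep: "indep_vars (\<lambda>_. borel) Y {1..}"
    and Y_distr: "\<And>i. 1 \<le> i \<Longrightarrow> distr M borel (Y i) = uniform_measure lborel {0..<2 * pi}"
    and XY_indep: "indep_set
      (sets (vimage_algebra (space M) (\<lambda>\<omega>. \<lambda>i\<in>{1..}. X i \<omega>) (PiM {1..} (\<lambda>_. borel))))
      (sets (vimage_algebra (space M) (\<lambda>\<omega>. \<lambda>i\<in>{1..}. Y i \<omega>) (PiM {1..} (\<lambda>_. borel))))"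
begin

definition "point_law = density lborel (\<lambda>x. ennreal (f x))"
definition "angle_law = uniform_measure lborel {0..<2 * pi}"
definition "mark_law = point_law \<Otimes>\<^sub>M angle_law"

lemma B_nonneg: "0 \<le> B"
  using f_nonneg[of 0] f_le[of 0] by linarith

lemma measurable_X[measurable]: "1 \<le> i \<Longrightarrow> X i \<in> borel_measurable M"
  and measurable_Y[measurable]: "1 \<le> i \<Longrightarrow> Y i \<in> borel_measurable M"
  using X_indep Y_indep by (auto simp: indep_vars_def2)

lemma sets_point_law[simp, measurable_cong]: "sets point_law = sets borel"
  and space_point_law[simp]: "space point_law = UNIV"
  by (simp_all add: point_law_def)

lemma sets_angle_law[simp, measurable_cong]: "sets angle_law = sets borel"
  and space_angle_law[simp]: "space angle_law = UNIV"
  by (simp_all add: angle_law_def uniform_measure_def)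

lemma sets_mark_law[simp, measurable_cong]: "sets mark_law = sets (borel \<Otimes>\<^sub>M borel)"
  unfolding mark_law_def by (intro sets_pair_measure_cong) simp_all

lemma prob_space_point_law: "prob_space point_law"
  using prob_space_distr[OF measurable_X[of 1]] X_distr[of 1] by (simp add: point_law_def)

lemma prob_space_angle_law: "prob_space angle_law"
  using prob_space_distr[OF measurable_Y[of 1]] Y_distr[of 1] by (simp add: angle_law_def)

lemma prob_space_mark_law: "prob_space mark_law"
proof -
  interpret a: prob_space point_law by (rule prob_space_point_law)
  interpret b: prob_space angle_law by (rule prob_space_angle_law)
  interpret pair_prob_space point_law angle_law ..
  show ?thesis unfolding mark_law_def by unfold_locales
qed

text \<open>The injection \<sigma> covers two uses: the identity on {1..n} for concentration, and an
  enumeration of an arbitrary k-set for exchangeability.\<close>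

lemma distr_marks:
  assumes inj: "inj_on \<sigma> J" and sub: "\<sigma> ` J \<subseteq> {1..}" and J: "J \<noteq> {}"
  shows "distr M (PiM J (\<lambda>_. borel \<Otimes>\<^sub>M borel)) (\<lambda>\<omega>. \<lambda>j\<in>J. (X (\<sigma> j) \<omega>, Y (\<sigma> j) \<omega>)) = PiM J (\<lambda>_. mark_law)"
proof -
  have ind: "indep_vars (\<lambda>_. borel \<Otimes>\<^sub>M borel) (\<lambda>j \<omega>. (X (\<sigma> j) \<omega>, Y (\<sigma> j) \<omega>)) J"
    by (rule indep_vars_reindex[OF indep_vars_Pair(1)[OF X_indep Y_indep XY_indep] inj sub])
  then have "random_variable (borel \<Otimes>\<^sub>M borel) (\<lambda>\<omega>. (X (\<sigma> j) \<omega>, Y (\<sigma> j) \<omega>))" if "j \<in> J" for j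
    using that unfolding indep_vars_def2 by blast
  then have "distr M (PiM J (\<lambda>_. borel \<Otimes>\<^sub>M borel)) (\<lambda>\<omega>. \<lambda>j\<in>J. (X (\<sigma> j) \<omega>, Y (\<sigma> j) \<omega>)) =
      (\<Pi>\<^sub>M j\<in>J. distr M (borel \<Otimes>\<^sub>M borel) (\<lambda>\<omega>. (X (\<sigma> j) \<omega>, Y (\<sigma> j) \<omega>)))"
    using ind by (subst indep_vars_iff_distr_eq_PiM'[OF J, symmetric]) auto
  also have "\<dots> = PiM J (\<lambda>_. mark_law)"
  proof (rule PiM_cong[OF refl])
    fix j assume "j \<in> J"
    then have "\<sigma> j \<in> {1..}" using sub by auto
    then show "distr M (borel \<Otimes>\<^sub>M borel) (\<lambda>\<omega>. (X (\<sigma> j) \<omega>, Y (\<sigma> j) \<omega>)) = mark_law"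
      using indep_vars_Pair(2)[OF X_indep Y_indep XY_indep] X_distr[of "\<sigma> j"] Y_distr[of "\<sigma> j"]
      by (simp add: mark_law_def point_law_def angle_law_def)
  qed
  finally show ?thesis .
qed

lemma distr_points:
  assumes sub: "J \<subseteq> {1..}" and J: "J \<noteq> {}"
  shows "distr M (PiM J (\<lambda>_. borel)) (\<lambda>\<omega>. \<lambda>j\<in>J. X j \<omega>) = PiM J (\<lambda>_. point_law)"
proof -
  have "distr M (PiM J (\<lambda>_. borel)) (\<lambda>\<omega>. \<lambda>j\<in>J. X j \<omega>) = (\<Pi>\<^sub>M j\<in>J. distr M borel (X j))"
    using indep_vars_subset[OF X_indep sub] sub
    by (subst indep_vars_iff_distr_eq_PiM'[OF J, symmetric]) auto
  also have "\<dots> = PiM J (\<lambda>_. point_law)"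
    using sub X_distr by (intro PiM_cong refl) (auto simp: point_law_def)
  finally show ?thesis .
qed

section \<open>Probability that many points are close together\<close>

lemma emeasure_point_law_cball_le:
  assumes "0 \<le> \<rho>"
  shows "emeasure point_law (cball y \<rho>) \<le> ennreal (B * pi * \<rho>\<^sup>2)"
proof -
  have "emeasure point_law (cball y \<rho>) = (\<integral>\<^sup>+x. ennreal (f x) * indicator (cball y \<rho>) x \<partial>lborel)"
    unfolding point_law_def by (subst emeasure_density) auto
  also have "\<dots> \<le> (\<integral>\<^sup>+x. ennreal B * indicator (cball y \<rho>) x \<partial>lborel)"
    using f_le by (intro nn_integral_mono mult_right_mono ennreal_leI) auto
  also have "\<dots> = ennreal B * emeasure lborel (cball y \<rho>)"
    by (rule nn_integral_cmult_indicator) simp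
  also have "emeasure lborel (cball y \<rho>) = ennreal (pi * \<rho>\<^sup>2)"
    using assms by (simp add: emeasure_cball unit_ball_vol_2)
  also have "ennreal B * \<dots> = ennreal (B * pi * \<rho>\<^sup>2)"
    using B_nonneg by (simp add: ennreal_mult'[symmetric] mult.assoc)
  finally show ?thesis .
qed

text \<open>Given X i = u, the other points are independent, and each falls into the ball around u
  with probability at most B times its area. Constraining only distances to the centre is what
  preserves the product structure.\<close>

lemma prob_star_le:
  assumes J: "finite J" "i \<notin> J" "insert i J \<subseteq> {1..}" and \<rho>: "0 \<le> \<rho>"
  shows "prob {\<omega> \<in> space M. \<forall>j\<in>J. dist (X i \<omega>) (X j \<omega>) \<le> \<rho>} \<le> (B * pi * \<rho>\<^sup>2) ^ card J"
proof -
  interpret a: prob_space point_law by (rule prob_space_point_law)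
  interpret pl: product_prob_space "\<lambda>_::nat. point_law" by unfold_locales
  let ?I = "insert i J"
  define S where "S = {p \<in> space (PiM ?I (\<lambda>_. borel :: (real^2) measure)). \<forall>j\<in>J. dist (p i) (p j) \<le> \<rho>}"
  have S[measurable]: "S \<in> sets (PiM ?I (\<lambda>_. borel))"
    unfolding S_def
    by (intro sets.sets_Collect_finite_All J) measurable
  have v[measurable]: "(\<lambda>\<omega>. \<lambda>j\<in>?I. X j \<omega>) \<in> measurable M (PiM ?I (\<lambda>_. borel))"
    using J(3) by (intro measurable_restrict measurable_X) auto
  have sets_eq: "sets (PiM ?I (\<lambda>_. point_law)) = sets (PiM ?I (\<lambda>_. borel))"
    by (intro sets_PiM_cong) auto
  have "emeasure M {\<omega> \<in> space M. \<forall>j\<in>J. dist (X i \<omega>) (X j \<omega>) \<le> \<rho>}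
      = emeasure (distr M (PiM ?I (\<lambda>_. borel)) (\<lambda>\<omega>. \<lambda>j\<in>?I. X j \<omega>)) S"
    by (subst emeasure_distr[OF v S]) (auto simp: S_def space_PiM intro!: arg_cong[where f = "emeasure M"])
  also have "\<dots> = emeasure (PiM ?I (\<lambda>_. point_law)) S"
    using distr_points[OF J(3)] by simp
  also have "\<dots> = (\<integral>\<^sup>+p. indicator S p \<partial>PiM ?I (\<lambda>_. point_law))"
    using S by (intro nn_integral_indicator[symmetric]) (simp add: sets_eq)
  \<comment> \<open>The centre becomes the outer variable, so the inner integral is the measure of a
    box of balls around a fixed point.\<close>
  also have "\<dots> = (\<integral>\<^sup>+u. (\<integral>\<^sup>+p. indicator S (p(i := u)) \<partial>PiM J (\<lambda>_. point_law)) \<partial>point_law)"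
    using J(1,2) S by (intro pl.product_nn_integral_insert_rev) (auto simp: sets_eq)
  also have "\<dots> \<le> (\<integral>\<^sup>+u. ennreal ((B * pi * \<rho>\<^sup>2) ^ card J) \<partial>point_law)"
  proof (intro nn_integral_mono)
    fix u :: "real^2"
    have "(\<integral>\<^sup>+p. indicator S (p(i := u)) \<partial>PiM J (\<lambda>_. point_law))
        = (\<integral>\<^sup>+p. indicator (Pi\<^sub>E J (\<lambda>_. cball u \<rho>)) p \<partial>PiM J (\<lambda>_. point_law))"
      using J(2)
      by (intro nn_integral_cong) (auto simp: S_def indicator_def space_PiM PiE_iff extensional_def)
    also have "\<dots> = emeasure (PiM J (\<lambda>_. point_law)) (Pi\<^sub>E J (\<lambda>_. cball u \<rho>))"
      using J(1) by (intro nn_integral_indicator sets_PiM_I_finite) auto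
    also have "\<dots> = (\<Prod>j\<in>J. emeasure point_law (cball u \<rho>))"
      using J(1) by (intro pl.emeasure_PiM) auto
    also have "\<dots> \<le> (\<Prod>j\<in>J. ennreal (B * pi * \<rho>\<^sup>2))"
      by (intro prod_mono_ennreal emeasure_point_law_cball_le \<rho>)
    also have "\<dots> = ennreal ((B * pi * \<rho>\<^sup>2) ^ card J)"
      using B_nonneg by (simp add: ennreal_power)
    finally show "(\<integral>\<^sup>+p. indicator S (p(i := u)) \<partial>PiM J (\<lambda>_. point_law)) \<le> ennreal ((B * pi * \<rho>\<^sup>2) ^ card J)" .
  qed
  also have "\<dots> = ennreal ((B * pi * \<rho>\<^sup>2) ^ card J)"
    using a.emeasure_space_1 by simp
  finally show ?thesis using B_nonneg by (simp add: emeasure_eq_measure)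
qed

text \<open>Coincidence of two points is a star with one leaf and radius 0, hence null; there are
  countably many pairs of indices.\<close>

lemma AE_distinct_points: "AE \<omega> in M. \<forall>n. inj_on (\<lambda>i. X i \<omega>) {1..n}"
proof -
  have "AE \<omega> in M. X i \<omega> \<noteq> X j \<omega>" if ij: "1 \<le> i" "1 \<le> j" "i \<noteq> j" for i j
  proof -
    have [measurable]: "X i \<in> borel_measurable M" "X j \<in> borel_measurable M" using ij by auto
    have "prob {\<omega> \<in> space M. \<forall>l\<in>{j}. dist (X i \<omega>) (X l \<omega>) \<le> 0} \<le> (B * pi * 0\<^sup>2) ^ card {j}"
      using ij by (intro prob_star_le) auto
    then have "prob {\<omega> \<in> space M. X i \<omega> = X j \<omega>} = 0" by (simp add: measure_le_0_iff)
    then show ?thesis by (subst (asm) prob_eq_0) (auto elim!: AE_mp)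
  qed
  then have "AE \<omega> in M. \<forall>i j. 1 \<le> i \<and> 1 \<le> j \<and> i \<noteq> j \<longrightarrow> X i \<omega> \<noteq> X j \<omega>"
    by (auto simp: AE_all_countable)
  then show ?thesis
  proof eventually_elim
    case (elim \<omega>)
    show ?case unfolding inj_on_def using elim by (metis atLeastAtMost_iff)
  qed
qed

text \<open>Union bound over the n possible centres and the at most n^m sets of m further points,
  each of which forms a star.\<close>

lemma prob_crowded_le:
  assumes \<rho>: "0 \<le> \<rho>"
  shows "prob {\<omega> \<in> space M. \<exists>i\<in>{1..n}. m < card {j \<in> {1..n}. dist (X i \<omega>) (X j \<omega>) \<le> \<rho>}}
    \<le> real n * (real n * (B * pi * \<rho>\<^sup>2)) ^ m"
proof -
  define J where "J i = {K. K \<subseteq> {1..n} - {i} \<and> card K = m}" for i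
  define S where "S i K = {\<omega> \<in> space M. \<forall>j\<in>K. dist (X i \<omega>) (X j \<omega>) \<le> \<rho>}" for i K
  have finK: "finite K" if "K \<in> J i" for i K using that finite_subset by (auto simp: J_def)
  have S_sets: "S i K \<in> events" if "i \<in> {1..n}" "K \<in> J i" for i K
  proof -
    have "K \<subseteq> {1..n}" using that(2) by (auto simp: J_def)
    then show ?thesis unfolding S_def using that finK[OF that(2)]
      by (intro sets.sets_Collect_finite_All) (auto simp: subset_iff intro!: measurable_X)
  qed
  have cardJ: "card (J i) \<le> n ^ m" if "i \<in> {1..n}" for i
  proof -
    have "card (J i) = (n - 1) choose m"
      unfolding J_def using that by (simp add: n_subsets)
    also have "\<dots> \<le> (n - 1) ^ m"
      using binomial_le_pow[of m "n - 1"] by (cases "m \<le> n - 1") (auto simp: binomial_eq_0)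
    also have "\<dots> \<le> n ^ m" by (rule power_mono) auto
    finally show ?thesis .
  qed
  have finJ: "finite (J i)" for i by (simp add: J_def)
  have sub: "{\<omega> \<in> space M. \<exists>i\<in>{1..n}. m < card {j \<in> {1..n}. dist (X i \<omega>) (X j \<omega>) \<le> \<rho>}}
      \<subseteq> (\<Union>i\<in>{1..n}. \<Union>K\<in>J i. S i K)"
  proof
    fix \<omega> assume "\<omega> \<in> {\<omega> \<in> space M. \<exists>i\<in>{1..n}. m < card {j \<in> {1..n}. dist (X i \<omega>) (X j \<omega>) \<le> \<rho>}}"
    then obtain i where i: "\<omega> \<in> space M" "i \<in> {1..n}"
      "m < card {j \<in> {1..n}. dist (X i \<omega>) (X j \<omega>) \<le> \<rho>}" (is "_ < card ?D") by blast
    \<comment> \<open>The centre is among the points counted, being at distance 0 from itself; the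
      strict inequality therefore leaves at least m others.\<close>
    have "m \<le> card (?D - {i})" using i(3) card_Diff_singleton_if[of ?D i] by (auto split: if_splits)
    then obtain K where K: "K \<subseteq> ?D - {i}" "card K = m"
      by (meson obtain_subset_with_card_n)
    then have "K \<in> J i" "\<omega> \<in> S i K" using i by (auto simp: J_def S_def)
    then show "\<omega> \<in> (\<Union>i\<in>{1..n}. \<Union>K\<in>J i. S i K)" using i(2) by blast
  qed
  have "prob {\<omega> \<in> space M. \<exists>i\<in>{1..n}. m < card {j \<in> {1..n}. dist (X i \<omega>) (X j \<omega>) \<le> \<rho>}}
      \<le> prob (\<Union>i\<in>{1..n}. \<Union>K\<in>J i. S i K)"
    using sub S_sets finJ by (intro finite_measure_mono sets.finite_UN) auto
  also have "\<dots> \<le> (\<Sum>i\<in>{1..n}. prob (\<Union>K\<in>J i. S i K))"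
    using S_sets finJ by (intro measure_UNION_le sets.finite_UN) auto
  also have "\<dots> \<le> (\<Sum>i\<in>{1..n}. \<Sum>K\<in>J i. prob (S i K))"
    using S_sets finJ by (intro sum_mono measure_UNION_le) auto
  also have "\<dots> \<le> (\<Sum>i\<in>{1..n}. \<Sum>K\<in>J i. (B * pi * \<rho>\<^sup>2) ^ m)"
  proof (intro sum_mono)
    fix i K assume iK: "i \<in> {1..n}" "K \<in> J i"
    then have "prob (S i K) \<le> (B * pi * \<rho>\<^sup>2) ^ card K"
      unfolding S_def using finK[OF iK(2)] \<rho> by (intro prob_star_le) (auto simp: J_def)
    then show "prob (S i K) \<le> (B * pi * \<rho>\<^sup>2) ^ m" using iK by (simp add: J_def)
  qed
  also have "\<dots> \<le> (\<Sum>i\<in>{1..n}. real (n ^ m) * (B * pi * \<rho>\<^sup>2) ^ m)"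
    using cardJ B_nonneg by (intro sum_mono) (auto intro!: mult_right_mono simp del: of_nat_power)
  also have "\<dots> = real n * (real n * (B * pi * \<rho>\<^sup>2)) ^ m"
    by (simp add: power_mult_distrib)
  finally show ?thesis .
qed

end

section \<open>Isolated copies in the random digraph\<close>

locale sector_pattern = sector_process M f B X Y
  for M :: "'w measure" and f B X Y +
  fixes \<alpha> :: real and T :: "('v, 'e) pre_digraph" and k :: nat
  assumes wf_T: "wf_digraph T" and connected_T: "Digraph_Component.connected T"
    and card_T: "card (verts T) = k" and k_pos: "0 < k"
begin

definition copy_prob :: "real \<Rightarrow> real" where
  "copy_prob r = prob {\<omega> \<in> space M. sector_copy \<alpha> T r (\<lambda>i. X i \<omega>) (\<lambda>i. Y i \<omega>) {1..k}}"

definition iso_sets :: "real \<Rightarrow> nat \<Rightarrow> 'w \<Rightarrow> nat set set" where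
  "iso_sets r n \<omega> = isolated_copies \<alpha> T r n (\<lambda>i. X i \<omega>) (\<lambda>i. Y i \<omega>)"

definition trunc_count :: "nat \<Rightarrow> real \<Rightarrow> nat \<Rightarrow> 'w \<Rightarrow> real" where
  "trunc_count m r n \<omega> = real (truncated_isolated_count m \<alpha> T r n (\<lambda>i. X i \<omega>) (\<lambda>i. Y i \<omega>))"

lemma sets_sector_copy:
  assumes "finite I" "I \<subseteq> {1..}"
  shows "{\<omega> \<in> space M. sector_copy \<alpha> T r (\<lambda>i. X i \<omega>) (\<lambda>i. Y i \<omega>) I} \<in> events"
  using assms
  by (intro predE pred_sector_copy measurable_X measurable_Y) auto

lemma pred_iso_sets: "Measurable.pred M (\<lambda>\<omega>. I \<in> iso_sets r n \<omega>)"
  unfolding iso_sets_def by (intro pred_isolated_copies measurable_X measurable_Y) auto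

lemma measurable_card_iso_sets[measurable]: "(\<lambda>\<omega>. real (card (iso_sets r n \<omega>))) \<in> borel_measurable M"
proof -
  have "(\<lambda>\<omega>. card (iso_sets r n \<omega>)) \<in> measurable M (count_space UNIV)"
    unfolding iso_sets_def by (intro measurable_card_isolated_copies measurable_X measurable_Y) auto
  then show ?thesis by measurable
qed

lemma measurable_trunc_count[measurable]: "trunc_count m r n \<in> borel_measurable M"
proof -
  have "(\<lambda>\<omega>. truncated_isolated_count m \<alpha> T r n (\<lambda>i. X i \<omega>) (\<lambda>i. Y i \<omega>)) \<in> measurable M (count_space UNIV)"
    using k_pos card_T by (intro measurable_truncated_isolated_count measurable_X measurable_Y) auto
  then show ?thesis unfolding trunc_count_def by measurable
qed

lemma prob_sector_copy_marks:
  assumes "inj_on \<sigma> {1..k}" "\<sigma> ` {1..k} \<subseteq> {1..}"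
  shows "prob {\<omega> \<in> space M. sector_copy \<alpha> T r (\<lambda>i. X (\<sigma> i) \<omega>) (\<lambda>i. Y (\<sigma> i) \<omega>) {1..k}} =
    measure (PiM {1..k} (\<lambda>_. mark_law))
      {p \<in> space (PiM {1..k} (\<lambda>_. mark_law)). sector_copy \<alpha> T r (\<lambda>i. fst (p i)) (\<lambda>i. snd (p i)) {1..k}}"
proof -
  let ?N = "PiM {1..k} (\<lambda>_. (borel :: (real^2) measure) \<Otimes>\<^sub>M (borel :: real measure))"
  have "1 \<le> \<sigma> j" if "j \<in> {1..k}" for j using assms(2) that unfolding image_subset_iff by simp
  then have v: "(\<lambda>\<omega>. \<lambda>j\<in>{1..k}. (X (\<sigma> j) \<omega>, Y (\<sigma> j) \<omega>)) \<in> measurable M ?N"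
    by (intro measurable_restrict measurable_Pair measurable_X measurable_Y)
  have S: "{p \<in> space ?N. sector_copy \<alpha> T r (\<lambda>i. fst (p i)) (\<lambda>i. snd (p i)) {1..k}} \<in> sets ?N"
    by (intro predE pred_sector_copy) auto
  have eq: "PiM {1..k} (\<lambda>_. mark_law) = distr M ?N (\<lambda>\<omega>. \<lambda>j\<in>{1..k}. (X (\<sigma> j) \<omega>, Y (\<sigma> j) \<omega>))"
    using assms k_pos by (intro distr_marks[symmetric]) auto
  have "sector_copy \<alpha> T r (\<lambda>i. fst ((\<lambda>j\<in>{1..k}. (X (\<sigma> j) \<omega>, Y (\<sigma> j) \<omega>)) i))
      (\<lambda>i. snd ((\<lambda>j\<in>{1..k}. (X (\<sigma> j) \<omega>, Y (\<sigma> j) \<omega>)) i)) {1..k} \<longleftrightarrow>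
      sector_copy \<alpha> T r (\<lambda>i. X (\<sigma> i) \<omega>) (\<lambda>i. Y (\<sigma> i) \<omega>) {1..k}" for \<omega>
    by (intro sector_copy_cong) auto
  then show ?thesis
    unfolding eq using measurable_space[OF v]
    by (subst measure_distr) (use v S in \<open>auto intro!: arg_cong[where f = prob]\<close>)
qed

text \<open>Exchangeability: after enumeration by any bijection from {1..k}, both probabilities are
  the same expression in the product of the mark laws.\<close>

lemma prob_sector_copy:
  assumes I: "finite I" "I \<subseteq> {1..}" "card I = k"
  shows "prob {\<omega> \<in> space M. sector_copy \<alpha> T r (\<lambda>i. X i \<omega>) (\<lambda>i. Y i \<omega>) I} = copy_prob r"
proof -
  obtain \<sigma> where \<sigma>: "bij_betw \<sigma> {1..k} I" using ex_bij_betw_nat_finite_1[OF I(1)] I(3) by auto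
  then have "inj_on \<sigma> {1..k}" "\<sigma> ` {1..k} \<subseteq> {1..}" using I(2) by (auto simp: bij_betw_def)
  from prob_sector_copy_marks[OF this, of r] prob_sector_copy_marks[of "\<lambda>i. i" r]
  show ?thesis
    unfolding copy_prob_def sector_copy_reindex[OF \<sigma>] comp_def by simp
qed

lemma copy_prob_nonneg: "0 \<le> copy_prob r"
  unfolding copy_prob_def by simp

text \<open>If a copy is present but not isolated, an arc leads to some outside point j, and then k
  points lie within (2 k^2 + 1) r of the representative. That star has order r^(2k), one factor r^2
  more than a copy, and j ranges over at most n values.\<close>

lemma prob_iso_sets_bounds:
  assumes I: "I \<subseteq> {1..n}" "card I = k" and r: "0 < r"
  shows "prob {\<omega> \<in> space M. I \<in> iso_sets r n \<omega>} \<le> copy_prob r"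
    and "copy_prob r - real n * (B * pi * (real (2 * k\<^sup>2 + 1) * r)\<^sup>2) ^ k
      \<le> prob {\<omega> \<in> space M. I \<in> iso_sets r n \<omega>}"
proof -
  have fin: "finite I" using I(1) finite_subset by blast
  have I1: "I \<subseteq> {1..}" using I(1) by auto
  have "I \<noteq> {}" using I(2) k_pos by auto
  define i0 where "i0 = Min I"
  have i0: "i0 \<in> I" unfolding i0_def using fin \<open>I \<noteq> {}\<close> by simp
  define C where "C = {\<omega> \<in> space M. sector_copy \<alpha> T r (\<lambda>i. X i \<omega>) (\<lambda>i. Y i \<omega>) I}"
  define E where "E = {\<omega> \<in> space M. I \<in> iso_sets r n \<omega>}"
  \<comment> \<open>The leaves are the k - 1 remaining points of the copy together with j, so there
    are k of them.\<close>
  define S where "S j = {\<omega> \<in> space M. \<forall>l\<in>insert j (I - {i0}). dist (X i0 \<omega>) (X l \<omega>) \<le> real (2 * k\<^sup>2 + 1) * r}" for j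
  have C: "C \<in> events" unfolding C_def by (rule sets_sector_copy[OF fin I1])
  have E: "E \<in> events" unfolding E_def by (rule predE[OF pred_iso_sets])
  have S: "S j \<in> events" if "j \<in> {1..n} - I" for j
  proof -
    have 1: "1 \<le> l" if "l \<in> insert i0 (insert j (I - {i0}))" for l
      using that \<open>j \<in> {1..n} - I\<close> I1 i0 by auto
    show ?thesis unfolding S_def
      by (intro sets.sets_Collect_finite_All borel_measurable_le borel_measurable_dist
          measurable_X 1) (use fin in auto)
  qed
  have pC: "prob C = copy_prob r" unfolding C_def by (rule prob_sector_copy[OF fin I1 I(2)])
  have "E \<subseteq> C" unfolding E_def C_def iso_sets_def isolated_copies_def by auto
  then show "prob {\<omega> \<in> space M. I \<in> iso_sets r n \<omega>} \<le> copy_prob r"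
    using C finite_measure_mono[of E C] pC unfolding E_def by simp
  have "C \<subseteq> E \<union> (\<Union>j\<in>{1..n} - I. S j)"
  proof
    fix \<omega> assume \<omega>: "\<omega> \<in> C"
    then have copy: "sector_copy \<alpha> T r (\<lambda>i. X i \<omega>) (\<lambda>i. Y i \<omega>) I" and "\<omega> \<in> space M"
      by (auto simp: C_def)
    show "\<omega> \<in> E \<union> (\<Union>j\<in>{1..n} - I. S j)"
    proof (cases "\<omega> \<in> E")
      case False
      then obtain i j where ij: "i \<in> I" "j \<in> {1..n} - I" "X j \<omega> \<in> sector \<alpha> (X i \<omega>) (Y i \<omega>) r"
        using \<open>\<omega> \<in> space M\<close> copy I card_T by (auto simp: E_def iso_sets_def isolated_copies_def)
      have diam: "dist (X i0 \<omega>) (X l \<omega>) \<le> real (2 * k\<^sup>2) * r" if "l \<in> I" for l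
        using sector_copy_diameter[OF wf_T connected_T fin copy i0 that] r I(2) by simp
      have "dist (X i0 \<omega>) (X j \<omega>) \<le> real (2 * k\<^sup>2 + 1) * r"
        using diam[OF ij(1)] dist_le_of_mem_sector[OF ij(3)]
          dist_triangle[of "X i0 \<omega>" "X j \<omega>" "X i \<omega>"] by (simp add: algebra_simps)
      moreover have "dist (X i0 \<omega>) (X l \<omega>) \<le> real (2 * k\<^sup>2 + 1) * r" if "l \<in> I" for l
        using diam[OF that] r by (simp add: algebra_simps)
      ultimately have "\<omega> \<in> S j" using \<open>\<omega> \<in> space M\<close> by (auto simp: S_def)
      then show ?thesis using ij(2) by blast
    qed simp
  qed
  then have "prob C \<le> prob (E \<union> (\<Union>j\<in>{1..n} - I. S j))"
    using E S by (intro finite_measure_mono sets.Un sets.finite_UN) auto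
  also have "\<dots> \<le> prob E + prob (\<Union>j\<in>{1..n} - I. S j)"
    using E S by (intro measure_Un_le sets.finite_UN) auto
  also have "prob (\<Union>j\<in>{1..n} - I. S j) \<le> (\<Sum>j\<in>{1..n} - I. prob (S j))"
    using S by (intro measure_UNION_le) auto
  also have "\<dots> \<le> (\<Sum>j\<in>{1..n} - I. (B * pi * (real (2 * k\<^sup>2 + 1) * r)\<^sup>2) ^ k)"
  proof (intro sum_mono)
    fix j assume j: "j \<in> {1..n} - I"
    have "prob (S j) \<le> (B * pi * (real (2 * k\<^sup>2 + 1) * r)\<^sup>2) ^ card (insert j (I - {i0}))"
      unfolding S_def using fin j i0 I1 r by (intro prob_star_le) auto
    moreover have "card (insert j (I - {i0})) = k"
      using fin j i0 I(2) k_pos by simp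
    ultimately show "prob (S j) \<le> (B * pi * (real (2 * k\<^sup>2 + 1) * r)\<^sup>2) ^ k" by simp
  qed
  also have "\<dots> \<le> real n * (B * pi * (real (2 * k\<^sup>2 + 1) * r)\<^sup>2) ^ k"
  proof -
    have "card ({1..n} - I) \<le> n" using card_mono[of "{1..n}" "{1..n} - I"] by auto
    then show ?thesis using B_nonneg by (simp add: mult_right_mono)
  qed
  finally show "copy_prob r - real n * (B * pi * (real (2 * k\<^sup>2 + 1) * r)\<^sup>2) ^ k
      \<le> prob {\<omega> \<in> space M. I \<in> iso_sets r n \<omega>}"
    using pC unfolding E_def by linarith
qed

lemma expectation_iso_count_bounds:
  assumes r: "0 < r"
  shows "expectation (\<lambda>\<omega>. real (card (iso_sets r n \<omega>))) \<le> real (n choose k) * copy_prob r"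
    and "real (n choose k) * (copy_prob r - real n * (B * pi * (real (2 * k\<^sup>2 + 1) * r)\<^sup>2) ^ k)
      \<le> expectation (\<lambda>\<omega>. real (card (iso_sets r n \<omega>)))"
proof -
  define P where "P = {I. I \<subseteq> {1..n} \<and> card I = k}"
  have P: "finite P" unfolding P_def by simp
  have cP: "card P = n choose k" unfolding P_def by (simp add: n_subsets)
  have ev: "{\<omega> \<in> space M. I \<in> iso_sets r n \<omega>} \<in> events" for I by (rule predE[OF pred_iso_sets])
  have "real (card (iso_sets r n \<omega>)) = (\<Sum>I\<in>P. indicator {\<omega> \<in> space M. I \<in> iso_sets r n \<omega>} \<omega>)"
    if "\<omega> \<in> space M" for \<omega>
  proof -
    have "iso_sets r n \<omega> = {I \<in> P. I \<in> iso_sets r n \<omega>}"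
      using card_T by (auto simp: P_def iso_sets_def isolated_copies_def)
    then have "real (card (iso_sets r n \<omega>)) = (\<Sum>I\<in>P. if I \<in> iso_sets r n \<omega> then 1 else 0)"
      using P by (subst sum.If_cases) (auto simp: Int_def)
    also have "\<dots> = (\<Sum>I\<in>P. indicator {\<omega> \<in> space M. I \<in> iso_sets r n \<omega>} \<omega>)"
      using that by (intro sum.cong) auto
    finally show ?thesis .
  qed
  then have "expectation (\<lambda>\<omega>. real (card (iso_sets r n \<omega>))) =
      expectation (\<lambda>\<omega>. \<Sum>I\<in>P. indicator {\<omega> \<in> space M. I \<in> iso_sets r n \<omega>} \<omega>)"
    by (intro Bochner_Integration.integral_cong) auto
  also have "\<dots> = (\<Sum>I\<in>P. prob {\<omega> \<in> space M. I \<in> iso_sets r n \<omega>})"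
    using ev by (subst Bochner_Integration.integral_sum) (auto simp: emeasure_eq_measure)
  finally have eq: "expectation (\<lambda>\<omega>. real (card (iso_sets r n \<omega>))) = (\<Sum>I\<in>P. prob {\<omega> \<in> space M. I \<in> iso_sets r n \<omega>})" .
  have "(\<Sum>I\<in>P. prob {\<omega> \<in> space M. I \<in> iso_sets r n \<omega>}) \<le> (\<Sum>I\<in>P. copy_prob r)"
    using prob_iso_sets_bounds(1)[OF _ _ r] by (intro sum_mono) (auto simp: P_def)
  then show "expectation (\<lambda>\<omega>. real (card (iso_sets r n \<omega>))) \<le> real (n choose k) * copy_prob r"
    using eq cP by simp
  have "(\<Sum>I\<in>P. copy_prob r - real n * (B * pi * (real (2 * k\<^sup>2 + 1) * r)\<^sup>2) ^ k)
      \<le> (\<Sum>I\<in>P. prob {\<omega> \<in> space M. I \<in> iso_sets r n \<omega>})"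
    using prob_iso_sets_bounds(2)[OF _ _ r] by (intro sum_mono) (auto simp: P_def)
  then show "real (n choose k) * (copy_prob r - real n * (B * pi * (real (2 * k\<^sup>2 + 1) * r)\<^sup>2) ^ k)
      \<le> expectation (\<lambda>\<omega>. real (card (iso_sets r n \<omega>)))"
    using eq cP by simp
qed

lemma trunc_count_le_iso_count: "trunc_count m r n \<omega> \<le> real (card (iso_sets r n \<omega>))"
  unfolding trunc_count_def iso_sets_def truncated_isolated_count_def
  by (intro of_nat_mono truncated_card_le finite_isolated_copies)

lemma trunc_count_nonneg: "0 \<le> trunc_count m r n \<omega>"
  by (simp add: trunc_count_def)

lemma card_iso_sets_le: "card (iso_sets r n \<omega>) \<le> n ^ k"
  unfolding iso_sets_def using card_isolated_copies_le[of \<alpha> T] card_T by simp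

lemma prob_trunc_count_neq:
  assumes r: "0 < r"
  shows "prob {\<omega> \<in> space M. trunc_count (m ^ k) r n \<omega> \<noteq> real (card (iso_sets r n \<omega>))}
    \<le> real n * (real n * (B * pi * (real (2 * k\<^sup>2 + 2) * r)\<^sup>2)) ^ m"
proof -
  let ?\<rho> = "real (2 * k\<^sup>2 + 2) * r"
  have meas: "{\<omega> \<in> space M. \<exists>i\<in>{1..n}. m < card {j \<in> {1..n}. dist (X i \<omega>) (X j \<omega>) \<le> ?\<rho>}} \<in> events"
  proof (intro sets.sets_Collect_finite_Ex finite_atLeastAtMost)
    fix i assume i: "i \<in> {1..n}"
    have "real (card {j \<in> {1..n}. dist (X i \<omega>) (X j \<omega>) \<le> ?\<rho>}) =
        (\<Sum>j\<in>{1..n}. if dist (X i \<omega>) (X j \<omega>) \<le> ?\<rho> then 1 else 0)" for \<omega>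
      by (subst sum.If_cases) (auto simp: Int_def)
    moreover have "(\<lambda>\<omega>. \<Sum>j\<in>{1..n}. if dist (X i \<omega>) (X j \<omega>) \<le> ?\<rho> then 1 else 0 :: real) \<in> borel_measurable M"
    proof (intro borel_measurable_sum)
      fix j assume "j \<in> {1..n}"
      then have [measurable]: "X i \<in> borel_measurable M" "X j \<in> borel_measurable M"
        using i by auto
      show "(\<lambda>\<omega>. if dist (X i \<omega>) (X j \<omega>) \<le> ?\<rho> then 1 else 0 :: real) \<in> borel_measurable M"
        by measurable
    qed
    ultimately have "(\<lambda>\<omega>. real (card {j \<in> {1..n}. dist (X i \<omega>) (X j \<omega>) \<le> ?\<rho>})) \<in> borel_measurable M"
      by simp
    from borel_measurable_less[OF borel_measurable_const this, of "real m"]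
    show "{\<omega> \<in> space M. m < card {j \<in> {1..n}. dist (X i \<omega>) (X j \<omega>) \<le> ?\<rho>}} \<in> events"
      unfolding of_nat_less_iff .
  qed
  have "{\<omega> \<in> space M. trunc_count (m ^ k) r n \<omega> \<noteq> real (card (iso_sets r n \<omega>))} \<subseteq>
      {\<omega> \<in> space M. \<exists>i\<in>{1..n}. m < card {j \<in> {1..n}. dist (X i \<omega>) (X j \<omega>) \<le> ?\<rho>}}"
  proof (intro subsetI CollectI conjI)
    fix \<omega> assume \<omega>: "\<omega> \<in> {\<omega> \<in> space M. trunc_count (m ^ k) r n \<omega> \<noteq> real (card (iso_sets r n \<omega>))}"
    then show "\<omega> \<in> space M" by simp
    show "\<exists>i\<in>{1..n}. m < card {j \<in> {1..n}. dist (X i \<omega>) (X j \<omega>) \<le> ?\<rho>}"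
    proof (rule ccontr)
      assume "\<not> (\<exists>i\<in>{1..n}. m < card {j \<in> {1..n}. dist (X i \<omega>) (X j \<omega>) \<le> ?\<rho>})"
      then have "card {j \<in> {1..n}. dist (X i \<omega>) (X j \<omega>) \<le> ?\<rho>} \<le> m" if "i \<in> {1..n}" for i
        using that unfolding not_less[symmetric] by blast
      from truncated_isolated_count_eq[OF wf_T connected_T card_T k_pos r this]
      show False using \<omega> by (simp add: trunc_count_def iso_sets_def)
    qed
  qed
  then have "prob {\<omega> \<in> space M. trunc_count (m ^ k) r n \<omega> \<noteq> real (card (iso_sets r n \<omega>))} \<le>
      prob {\<omega> \<in> space M. \<exists>i\<in>{1..n}. m < card {j \<in> {1..n}. dist (X i \<omega>) (X j \<omega>) \<le> ?\<rho>}}"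
    using meas by (rule finite_measure_mono)
  also have "\<dots> \<le> real n * (real n * (B * pi * ?\<rho>\<^sup>2)) ^ m"
    using r by (intro prob_crowded_le) simp
  finally show ?thesis .
qed

text \<open>The count is read as a function on the product of n mark laws. Replacing one mark moves
  a point and turns its sector at the same time, so a single difference constant serves for
  both.\<close>

lemma trunc_count_concentration:
  assumes r: "0 < r" and n: "1 \<le> n" and m: "0 < m" and s: "0 < s"
  shows "prob {\<omega> \<in> space M. s \<le> \<bar>trunc_count m r n \<omega> - expectation (trunc_count m r n)\<bar>}
    \<le> 2 * exp (- s\<^sup>2 / (2 * (real (m * (2 * (2 * (2 * k\<^sup>2 + 2) + 1)\<^sup>2)))\<^sup>2 * real n))"
proof -
  let ?N = "PiM {1..n} (\<lambda>_. (borel :: (real^2) measure) \<Otimes>\<^sub>M (borel :: real measure))"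
  let ?P = "PiM {1..n} (\<lambda>_. mark_law)"
  define F where "F p = real (truncated_isolated_count m \<alpha> T r n (\<lambda>i. fst (p i)) (\<lambda>i. snd (p i)))"
    for p :: "nat \<Rightarrow> (real^2) \<times> real"
  define Z where "Z \<omega> = (\<lambda>j\<in>{1..n}. (X j \<omega>, Y j \<omega>))" for \<omega>
  have Z: "Z \<in> measurable M ?N"
    unfolding Z_def by (intro measurable_restrict measurable_Pair measurable_X measurable_Y) auto
  have distr: "distr M ?N Z = ?P"
    unfolding Z_def using n by (intro distr_marks[where \<sigma> = "\<lambda>j. j"]) auto
  have sets_P: "sets ?P = sets ?N" by (intro sets_PiM_cong) auto
  have "(\<lambda>p. truncated_isolated_count m \<alpha> T r n (\<lambda>i. fst (p i)) (\<lambda>i. snd (p i))) \<in> measurable ?N (count_space UNIV)"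
    using k_pos card_T by (intro measurable_truncated_isolated_count) auto
  then have F: "F \<in> borel_measurable ?N" unfolding F_def by measurable
  \<comment> \<open>Outside {1..n} the restricted vector takes the value \<open>undefined\<close>;
    the count reads only the indices in {1..n}.\<close>
  have FZ: "F (Z \<omega>) = trunc_count m r n \<omega>" for \<omega>
    unfolding F_def Z_def trunc_count_def
    using k_pos card_T by (intro arg_cong[where f = real] truncated_isolated_count_cong) auto
  have EF: "integral\<^sup>L ?P F = expectation (trunc_count m r n)"
    unfolding distr[symmetric] by (subst integral_distr[OF Z F]) (simp add: FZ)
  have space_eq: "space ?P = space ?N" using sets_eq_imp_space_eq[OF sets_P] .
  have "prob {\<omega> \<in> space M. s \<le> \<bar>trunc_count m r n \<omega> - expectation (trunc_count m r n)\<bar>}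
      = measure (distr M ?N Z) {p \<in> space ?N. s \<le> \<bar>F p - integral\<^sup>L ?P F\<bar>}"
  proof (subst measure_distr[OF Z])
    show "{p \<in> space ?N. s \<le> \<bar>F p - integral\<^sup>L ?P F\<bar>} \<in> sets ?N" using F by measurable
    show "prob {\<omega> \<in> space M. s \<le> \<bar>trunc_count m r n \<omega> - expectation (trunc_count m r n)\<bar>} =
        prob (Z -` {p \<in> space ?N. s \<le> \<bar>F p - integral\<^sup>L ?P F\<bar>} \<inter> space M)"
      unfolding EF using measurable_space[OF Z] by (intro arg_cong[where f = prob]) (auto simp: FZ)
  qed
  also have "\<dots> = measure ?P {p \<in> space ?P. s \<le> \<bar>F p - integral\<^sup>L ?P F\<bar>}"
    unfolding distr space_eq ..
  also have "\<dots> \<le> 2 * exp (- s\<^sup>2 / (2 * (real (m * (2 * (2 * (2 * k\<^sup>2 + 2) + 1)\<^sup>2)))\<^sup>2 * real (card {1..n})))"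
  proof (rule bounded_differences_inequality[OF prob_space_mark_law, where B = "real (n ^ k)"])
    show "F \<in> borel_measurable ?P" using F by (simp cong: measurable_cong_sets add: sets_P)
    fix p
    have "F p \<le> real (card (isolated_copies \<alpha> T r n (\<lambda>i. fst (p i)) (\<lambda>i. snd (p i))))"
      unfolding F_def truncated_isolated_count_def
      by (intro of_nat_mono truncated_card_le finite_isolated_copies)
    also have "\<dots> \<le> real (n ^ k)"
      using card_isolated_copies_le[of \<alpha> T] card_T by (intro of_nat_mono) simp
    finally show "\<bar>F p\<bar> \<le> real (n ^ k)" by (simp add: F_def)
    fix j a
    show "\<bar>F p - F (p(j := a))\<bar> \<le> real (m * (2 * (2 * (2 * k\<^sup>2 + 2) + 1)\<^sup>2))"
      unfolding F_def
      by (rule truncated_isolated_count_bounded_differences[OF wf_T connected_T card_T k_pos r, where j = j]) auto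
    show "0 < real (m * (2 * (2 * (2 * k\<^sup>2 + 2) + 1)\<^sup>2))"
      unfolding of_nat_0_less_iff using m by simp
  qed (use n s in auto)
  finally show ?thesis by simp
qed

end

section \<open>Rescaling the copy probability\<close>

text \<open>On boxes the integral of the product factorises, and boxes determine the product
  measure. Sigma-finiteness of the density measure is a separate hypothesis because an arbitrary
  extended-valued h does not provide it.\<close>

lemma PiM_density:
  assumes "finite I" and N: "sigma_finite_measure N" and D: "sigma_finite_measure (density N h)"
    and h[measurable]: "h \<in> borel_measurable N"
  shows "PiM I (\<lambda>_. density N h) = density (PiM I (\<lambda>_. N)) (\<lambda>x. \<Prod>i\<in>I. h (x i))"
proof -
  interpret N: product_sigma_finite "\<lambda>_. N" using N by (simp add: product_sigma_finite_def)
  interpret D: product_sigma_finite "\<lambda>_. density N h" using D by (simp add: product_sigma_finite_def)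
  show ?thesis
  proof (rule D.PiM_eqI[symmetric, OF \<open>finite I\<close>])
    show "sets (density (PiM I (\<lambda>_. N)) (\<lambda>x. \<Prod>i\<in>I. h (x i))) = sets (PiM I (\<lambda>_. density N h))"
      by (simp cong: sets_PiM_cong)
    fix A assume "\<And>i. i \<in> I \<Longrightarrow> A i \<in> sets (density N h)"
    then have A: "\<And>i. i \<in> I \<Longrightarrow> A i \<in> sets N" by simp
    have "emeasure (density (PiM I (\<lambda>_. N)) (\<lambda>x. \<Prod>i\<in>I. h (x i))) (Pi\<^sub>E I A) =
        (\<integral>\<^sup>+x. (\<Prod>i\<in>I. h (x i)) * indicator (Pi\<^sub>E I A) x \<partial>PiM I (\<lambda>_. N))"
      using A \<open>finite I\<close> by (intro emeasure_density sets_PiM_I_finite) auto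
    also have "\<dots> = (\<integral>\<^sup>+x. (\<Prod>i\<in>I. h (x i) * indicator (A i) (x i)) \<partial>PiM I (\<lambda>_. N))"
    proof (intro nn_integral_cong)
      fix x assume "x \<in> space (PiM I (\<lambda>_. N))"
      then have "x \<in> Pi\<^sub>E I A \<longleftrightarrow> (\<forall>i\<in>I. x i \<in> A i)" by (auto simp: space_PiM PiE_iff)
      then show "(\<Prod>i\<in>I. h (x i)) * indicator (Pi\<^sub>E I A) x = (\<Prod>i\<in>I. h (x i) * indicator (A i) (x i))"
        using \<open>finite I\<close> by (auto simp: prod.distrib indicator_def prod_zero_iff)
    qed
    also have "\<dots> = (\<Prod>i\<in>I. \<integral>\<^sup>+x. h x * indicator (A i) x \<partial>N)"
      using A \<open>finite I\<close> by (intro N.product_nn_integral_prod) auto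
    also have "\<dots> = (\<Prod>i\<in>I. emeasure (density N h) (A i))"
      using A by (intro prod.cong refl) (simp add: emeasure_density)
    finally show "emeasure (density (PiM I (\<lambda>_. N)) (\<lambda>x. \<Prod>i\<in>I. h (x i))) (Pi\<^sub>E I A) =
        (\<Prod>i\<in>I. emeasure (density N h) (A i))" .
  qed
qed

text \<open>Each coordinate contributes the Jacobian c^d, with d the dimension, and equality is
  checked on boxes.\<close>

lemma PiM_lborel_affine:
  fixes u :: "'a::euclidean_space"
  assumes "finite J" and c: "0 < c"
  shows "PiM J (\<lambda>_. lborel) = density (distr (PiM J (\<lambda>_. lborel)) (PiM J (\<lambda>_. borel)) (\<lambda>z. \<lambda>i\<in>J. u + c *\<^sub>R z i))
    (\<lambda>_. ennreal (c ^ (DIM('a) * card J)))" (is "_ = density (distr _ _ ?g) _")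
proof -
  interpret N: product_sigma_finite "\<lambda>_. lborel :: 'a measure" by unfold_locales
  have g[measurable]: "?g \<in> measurable (PiM J (\<lambda>_. lborel)) (PiM J (\<lambda>_. borel))" by measurable
  have one: "ennreal (c ^ DIM('a)) * emeasure lborel ((\<lambda>x. u + c *\<^sub>R x) -` A) = emeasure lborel A"
    if "A \<in> sets borel" for A
    using c that
    by (subst (2) lborel_affine[of c u])
       (auto simp: emeasure_density nn_integral_distr emeasure_distr nn_integral_cmult_indicator)
  show ?thesis
  proof (rule N.PiM_eqI[symmetric, OF \<open>finite J\<close>])
    show "sets (density (distr (PiM J (\<lambda>_. lborel)) (PiM J (\<lambda>_. borel)) ?g) (\<lambda>_. ennreal (c ^ (DIM('a) * card J))))
        = sets (PiM J (\<lambda>_. lborel :: 'a measure))"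
      by (simp cong: sets_PiM_cong)
    fix A assume "\<And>i. i \<in> J \<Longrightarrow> A i \<in> sets (lborel :: 'a measure)"
    then have A: "\<And>i. i \<in> J \<Longrightarrow> A i \<in> sets (borel :: 'a measure)" by simp
    then have A': "Pi\<^sub>E J A \<in> sets (PiM J (\<lambda>_. borel))" using \<open>finite J\<close> by (intro sets_PiM_I_finite) auto
    have pre: "(\<lambda>x. u + c *\<^sub>R x) -` A i \<in> sets borel" if "i \<in> J" for i
      using measurable_sets[of "\<lambda>x. u + c *\<^sub>R x" borel borel "A i"] A[OF that] by simp
    have "emeasure (density (distr (PiM J (\<lambda>_. lborel)) (PiM J (\<lambda>_. borel)) ?g) (\<lambda>_. ennreal (c ^ (DIM('a) * card J)))) (Pi\<^sub>E J A)
        = ennreal (c ^ (DIM('a) * card J)) * emeasure (distr (PiM J (\<lambda>_. lborel)) (PiM J (\<lambda>_. borel)) ?g) (Pi\<^sub>E J A)"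
      using A' by (simp add: emeasure_density nn_integral_cmult_indicator)
    also have "emeasure (distr (PiM J (\<lambda>_. lborel)) (PiM J (\<lambda>_. borel)) ?g) (Pi\<^sub>E J A)
        = emeasure (PiM J (\<lambda>_. lborel)) (Pi\<^sub>E J (\<lambda>i. (\<lambda>x. u + c *\<^sub>R x) -` A i))"
      by (subst emeasure_distr[OF g A'])
        (auto simp: space_PiM PiE_iff extensional_def intro!: arg_cong[where f = "emeasure (PiM J (\<lambda>_. lborel))"])
    also have "\<dots> = (\<Prod>i\<in>J. emeasure lborel ((\<lambda>x. u + c *\<^sub>R x) -` A i))"
      using \<open>finite J\<close> pre by (intro N.emeasure_PiM) auto
    also have "ennreal (c ^ (DIM('a) * card J)) * \<dots> =
        (\<Prod>i\<in>J. ennreal (c ^ DIM('a)) * emeasure lborel ((\<lambda>x. u + c *\<^sub>R x) -` A i))"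
      using c by (simp add: prod.distrib power_mult ennreal_power)
    also have "\<dots> = (\<Prod>i\<in>J. emeasure lborel (A i))"
      using A one by (intro prod.cong) auto
    finally show "emeasure (density (distr (PiM J (\<lambda>_. lborel)) (PiM J (\<lambda>_. borel)) ?g) (\<lambda>_. ennreal (c ^ (DIM('a) * card J)))) (Pi\<^sub>E J A)
        = (\<Prod>i\<in>J. emeasure lborel (A i))" .
  qed
qed

lemma nn_integral_PiM_lborel_affine:
  fixes u :: "'a::euclidean_space"
  assumes J: "finite J" and c: "0 < c" and F[measurable]: "F \<in> borel_measurable (PiM J (\<lambda>_. borel))"
  shows "(\<integral>\<^sup>+z. F z \<partial>PiM J (\<lambda>_. lborel)) =
    ennreal (c ^ (DIM('a) * card J)) * (\<integral>\<^sup>+z. F (\<lambda>i\<in>J. u + c *\<^sub>R z i) \<partial>PiM J (\<lambda>_. lborel))"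
proof -
  have [measurable]: "(\<lambda>z. \<lambda>i\<in>J. u + c *\<^sub>R z i) \<in> measurable (PiM J (\<lambda>_. lborel)) (PiM J (\<lambda>_. borel))"
    by measurable
  show ?thesis
    by (subst PiM_lborel_affine[OF J c, of u])
      (simp add: nn_integral_density nn_integral_distr nn_integral_cmult)
qed

text \<open>Passes from the half-open interval of the model to the closed one in \<open>mu\<close>;
  the additional endpoint is a null set.\<close>

lemma uniform_angle_density:
  "uniform_measure lborel {0..<2 * pi} = density lborel (\<lambda>y. indicator {0..2 * pi} y * ennreal (1 / (2 * pi)))"
proof -
  have "uniform_measure lborel {0..<2 * pi} = density lborel (\<lambda>y. indicator {0..<2 * pi} y / ennreal (2 * pi))"
    by (simp add: uniform_measure_def)
  also have "\<dots> = density lborel (\<lambda>y. indicator {0..2 * pi} y * ennreal (1 / (2 * pi)))"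
  proof (rule density_cong)
    have "AE y in lborel. y \<noteq> 2 * pi" by (rule AE_lborel_singleton)
    then show "AE y in lborel. indicator {0..<2 * pi} y / ennreal (2 * pi) =
        indicator {0..2 * pi} y * ennreal (1 / (2 * pi))"
    proof eventually_elim
      case (elim y)
      have "1 / ennreal (2 * pi) = ennreal (1 / (2 * pi))"
        using divide_ennreal[of 1 "2 * pi"] by simp
      then show ?case using elim by (auto simp: indicator_def)
    qed
  qed auto
  finally show ?thesis .
qed

(* With this rule, {1..k} becomes {Suc 0..k}, and facts about {1..k} no longer apply. *)
declare One_nat_def [simp del]

context sector_pattern
begin

definition rescaled_copy :: "(nat \<Rightarrow> real) \<Rightarrow> (nat \<Rightarrow> real^2) \<Rightarrow> bool" where
  "rescaled_copy y z \<longleftrightarrow> sector_copy \<alpha> T 1 (z(1 := 0)) y {1..k}"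

definition "copy_integral y =
  (\<integral>\<^sup>+(u, z). indicator {z. rescaled_copy y z} z * ennreal (f u ^ k) \<partial>(lborel \<Otimes>\<^sub>M PiM {2..k} (\<lambda>_. lborel)))"

text \<open>Integral over the base point u and the shape z of a copy at scale r, at fixed angles.
  Putting r = 0 formally gives \<open>copy_integral\<close>, since the product of densities then
  collapses to f(u)^k.\<close>

definition "scaled_copy_integral r y =
  (\<integral>\<^sup>+(u, z). indicator {z. rescaled_copy y z} z * (ennreal (f u) * (\<Prod>i\<in>{2..k}. ennreal (f (u + r *\<^sub>R z i))))
     \<partial>(lborel \<Otimes>\<^sub>M PiM {2..k} (\<lambda>_. lborel)))"

lemma pred_rescaled_copy:
  assumes y: "\<And>i. i \<in> {1..k} \<Longrightarrow> (\<lambda>\<omega>. yy \<omega> i) \<in> borel_measurable N"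
    and z: "\<And>i. i \<in> {2..k} \<Longrightarrow> (\<lambda>\<omega>. zz \<omega> i) \<in> borel_measurable N"
  shows "Measurable.pred N (\<lambda>\<omega>. rescaled_copy (yy \<omega>) (zz \<omega>))"
  unfolding rescaled_copy_def
proof (intro pred_sector_copy finite_atLeastAtMost y)
  fix i assume "i \<in> {1..k}"
  then have "i = 1 \<or> i \<in> {2..k}" by auto
  then show "(\<lambda>\<omega>. ((zz \<omega>)(1 := 0)) i) \<in> borel_measurable N"
    using z[of i] by (cases "i = 1") simp_all
qed

text \<open>A normalised copy has its first point at the origin, so the diameter bound at scale 1
  confines the shape variables to a fixed ball. This makes dominated convergence possible.\<close>

lemma rescaled_copy_bounded:
  assumes "rescaled_copy y z" "i \<in> {2..k}"
  shows "z i \<in> cball 0 (real (2 * k\<^sup>2))"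
proof -
  have "dist ((z(1 := 0)) 1) ((z(1 := 0)) i) \<le> real (2 * (card {1..k})\<^sup>2) * 1"
    using assms(2) k_pos
    by (intro sector_copy_diameter[OF wf_T connected_T finite_atLeastAtMost assms(1)[unfolded rescaled_copy_def]]) auto
  then show ?thesis using assms(2) by simp
qed

lemma atLeastAtMost_1_insert: "{1..k} = insert 1 {2..k}"
  using k_pos by auto

lemma measurable_scaled_integrand[measurable]:
  "(\<lambda>(y, u, z). indicator {z. rescaled_copy y z} z * (ennreal (f u) * (\<Prod>i\<in>{2..k}. ennreal (f (u + r *\<^sub>R z i)))) :: ennreal)
    \<in> borel_measurable (PiM {1..k} (\<lambda>_. lborel) \<Otimes>\<^sub>M (lborel \<Otimes>\<^sub>M PiM {2..k} (\<lambda>_. lborel)))" (is "_ \<in> borel_measurable ?N")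
proof -
  have [measurable]: "Measurable.pred ?N (\<lambda>w. rescaled_copy (fst w) (snd (snd w)))"
    by (intro pred_rescaled_copy) auto
  have [measurable]: "(\<lambda>w. snd (snd w) i) \<in> borel_measurable ?N" if "i \<in> {2..k}" for i
    using that by measurable
  have "(\<lambda>w. (if rescaled_copy (fst w) (snd (snd w)) then 1 else 0) *
      (ennreal (f (fst (snd w))) * (\<Prod>i\<in>{2..k}. ennreal (f (fst (snd w) + r *\<^sub>R snd (snd w) i)))) :: ennreal)
    \<in> borel_measurable ?N"
    by measurable
  then show ?thesis
    by (rule measurable_cong[THEN iffD1, rotated]) (auto simp: indicator_def split: prod.splits)
qed

lemma measurable_limit_integrand[measurable]:
  "(\<lambda>(y, u, z). indicator {z. rescaled_copy y z} z * ennreal (f u ^ k) :: ennreal)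
    \<in> borel_measurable (PiM {1..k} (\<lambda>_. lborel) \<Otimes>\<^sub>M (lborel \<Otimes>\<^sub>M PiM {2..k} (\<lambda>_. lborel)))" (is "_ \<in> borel_measurable ?N")
proof -
  have [measurable]: "Measurable.pred ?N (\<lambda>w. rescaled_copy (fst w) (snd (snd w)))"
    by (intro pred_rescaled_copy) auto
  have "(\<lambda>w. (if rescaled_copy (fst w) (snd (snd w)) then 1 else 0) * ennreal (f (fst (snd w)) ^ k) :: ennreal)
    \<in> borel_measurable ?N"
    by measurable
  then show ?thesis
    by (rule measurable_cong[THEN iffD1, rotated]) (auto simp: indicator_def split: prod.splits)
qed

lemma sigma_finite_PiM_lborel: "finite J \<Longrightarrow> sigma_finite_measure (PiM J (\<lambda>_. lborel :: 'a::euclidean_space measure))"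
proof -
  interpret product_sigma_finite "\<lambda>_. lborel :: 'a measure" by unfold_locales
  show "finite J \<Longrightarrow> ?thesis" by (rule sigma_finite)
qed

lemma sigma_finite_shape: "sigma_finite_measure ((lborel :: (real^2) measure) \<Otimes>\<^sub>M PiM {2..k} (\<lambda>_. lborel :: (real^2) measure))"
proof -
  interpret J: sigma_finite_measure "PiM {2..k} (\<lambda>_. lborel :: (real^2) measure)"
    by (rule sigma_finite_PiM_lborel) simp
  interpret pr: pair_sigma_finite "lborel :: (real^2) measure" "PiM {2..k} (\<lambda>_. lborel :: (real^2) measure)" ..
  show ?thesis by (rule pr.P.sigma_finite_measure_axioms)
qed

lemma measurable_copy_integral[measurable]:
  "copy_integral \<in> borel_measurable (PiM {1..k} (\<lambda>_. lborel))"
  "scaled_copy_integral r \<in> borel_measurable (PiM {1..k} (\<lambda>_. lborel))"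
proof -
  interpret sigma_finite_measure "(lborel :: (real^2) measure) \<Otimes>\<^sub>M PiM {2..k} (\<lambda>_. lborel :: (real^2) measure)"
    by (rule sigma_finite_shape)
  show "copy_integral \<in> borel_measurable (PiM {1..k} (\<lambda>_. lborel))"
    unfolding copy_integral_def[abs_def] by (intro borel_measurable_nn_integral measurable_limit_integrand)
  show "scaled_copy_integral r \<in> borel_measurable (PiM {1..k} (\<lambda>_. lborel))"
    unfolding scaled_copy_integral_def[abs_def] by (intro borel_measurable_nn_integral measurable_scaled_integrand)
qed

text \<open>Joint Lebesgue density of the k angles; its value on the cube is the factor (2 pi)^(-k)
  of \<open>mu\<close>.\<close>

definition "angle_density y = (\<Prod>i\<in>{1..k}. indicator {0..2 * pi} (y i) * ennreal (1 / (2 * pi)))"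

lemma measurable_angle_density[measurable]: "angle_density \<in> borel_measurable (PiM {1..k} (\<lambda>_. lborel))"
  unfolding angle_density_def[abs_def] by measurable

lemma PiM_angle_law: "PiM {1..k} (\<lambda>_. angle_law) = density (PiM {1..k} (\<lambda>_. lborel)) angle_density"
proof -
  have "angle_law = density lborel (\<lambda>y. indicator {0..2 * pi} y * ennreal (1 / (2 * pi)))"
    unfolding angle_law_def by (rule uniform_angle_density)
  moreover from this prob_space_angle_law
  have "sigma_finite_measure (density lborel (\<lambda>y. indicator {0..2 * pi} y * ennreal (1 / (2 * pi))))"
    using prob_space_imp_sigma_finite by metis
  ultimately show ?thesis
    unfolding angle_density_def[abs_def]
    using PiM_density[of "{1..k}" lborel "\<lambda>y. indicator {0..2 * pi} y * ennreal (1 / (2 * pi))"]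
      lborel.sigma_finite_measure_axioms by simp
qed

lemma integral_angle_density: "(\<integral>\<^sup>+y. angle_density y \<partial>PiM {1..k} (\<lambda>_. lborel)) = 1"
proof -
  interpret a: prob_space "PiM {1..k} (\<lambda>_. angle_law)" by (intro prob_space_PiM prob_space_angle_law)
  have "(\<integral>\<^sup>+y. angle_density y \<partial>PiM {1..k} (\<lambda>_. lborel)) = (\<integral>\<^sup>+y. 1 \<partial>PiM {1..k} (\<lambda>_. angle_law))"
    unfolding PiM_angle_law by (subst nn_integral_density) auto
  then show ?thesis using a.emeasure_space_1 by simp
qed

lemma PiM_point_law: "PiM {1..k} (\<lambda>_. point_law) = density (PiM {1..k} (\<lambda>_. lborel)) (\<lambda>x. \<Prod>i\<in>{1..k}. ennreal (f (x i)))"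
  using PiM_density[of "{1..k}" lborel "\<lambda>x. ennreal (f x)"] prob_space_point_law
    prob_space_imp_sigma_finite lborel.sigma_finite_measure_axioms
  unfolding point_law_def by auto

text \<open>In contrast to the joint statements, y is now a fixed parameter, as Fubini's theorem and
  dominated convergence at given angles require.\<close>

lemma measurable_integrand_section:
  assumes g: "g \<in> borel_measurable ((lborel :: (real^2) measure) \<Otimes>\<^sub>M PiM {2..k} (\<lambda>_. lborel :: (real^2) measure))"
  shows "(\<lambda>(u, z). indicator {z. rescaled_copy y z} z * (g (u, z) :: ennreal))
    \<in> borel_measurable (lborel \<Otimes>\<^sub>M PiM {2..k} (\<lambda>_. lborel))"
proof -
  have "Measurable.pred (lborel \<Otimes>\<^sub>M PiM {2..k} (\<lambda>_. lborel)) (\<lambda>w :: (real^2) \<times> (nat \<Rightarrow> real^2). rescaled_copy y (snd w))"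
    by (intro pred_rescaled_copy) auto
  then have "(\<lambda>w. (if rescaled_copy y (snd w) then 1 else 0) * g w)
    \<in> borel_measurable (lborel \<Otimes>\<^sub>M PiM {2..k} (\<lambda>_. lborel))"
    by (intro borel_measurable_times_ennreal measurable_If borel_measurable_const predE g)
  then show ?thesis
    by (rule measurable_cong[THEN iffD1, rotated]) (auto simp: indicator_def split: prod.splits)
qed

lemma measurable_scaled_section:
  "(\<lambda>(u, z). indicator {z. rescaled_copy y z} z * (ennreal (f u) * (\<Prod>i\<in>{2..k}. ennreal (f (u + r *\<^sub>R z i)))) :: ennreal)
    \<in> borel_measurable (lborel \<Otimes>\<^sub>M PiM {2..k} (\<lambda>_. lborel))"
  using measurable_integrand_section[of "\<lambda>(u, z). ennreal (f u) * (\<Prod>i\<in>{2..k}. ennreal (f (u + r *\<^sub>R z i)))" y]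
  by simp

lemma measurable_limit_section:
  "(\<lambda>(u, z). indicator {z. rescaled_copy y z} z * ennreal (f u ^ k) :: ennreal)
    \<in> borel_measurable (lborel \<Otimes>\<^sub>M PiM {2..k} (\<lambda>_. lborel))"
  using measurable_integrand_section[of "\<lambda>(u, z). ennreal (f u ^ k)" y] by simp

text \<open>With x_1 = u fixed, the other k - 1 planar points are substituted affinely, which yields
  the Jacobian r^(2(k-1)). Scale and translation invariance then remove u and r from the copy
  condition, leaving them only in the densities.\<close>

lemma nn_integral_copy_rescale:
  assumes r: "0 < r"
  shows "(\<integral>\<^sup>+x. (\<Prod>i\<in>{1..k}. ennreal (f (x i))) * indicator {x. sector_copy \<alpha> T r x y {1..k}} x \<partial>PiM {1..k} (\<lambda>_. lborel))
    = ennreal (r ^ (2 * (k - 1))) * scaled_copy_integral r y"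
proof -
  interpret N: product_sigma_finite "\<lambda>_::nat. lborel :: (real^2) measure" by unfold_locales
  interpret J: sigma_finite_measure "PiM {2..k} (\<lambda>_. lborel :: (real^2) measure)"
    by (rule sigma_finite_PiM_lborel) simp
  let ?F = "\<lambda>x. (\<Prod>i\<in>{1..k}. ennreal (f (x i))) * indicator {x. sector_copy \<alpha> T r x y {1..k}} x :: ennreal"
  have "?F \<in> borel_measurable (PiM {1..k} (\<lambda>_. borel))"
  proof -
    have [measurable]: "Measurable.pred (PiM {1..k} (\<lambda>_. borel)) (\<lambda>x. sector_copy \<alpha> T r x y {1..k})"
      by (intro pred_sector_copy) auto
    show ?thesis by measurable
  qed
  then have F[measurable]: "?F \<in> borel_measurable (PiM (insert 1 {2..k}) (\<lambda>_. borel))"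
    unfolding atLeastAtMost_1_insert[symmetric] .
  have "(\<integral>\<^sup>+x. ?F x \<partial>PiM {1..k} (\<lambda>_. lborel)) = (\<integral>\<^sup>+u. \<integral>\<^sup>+z. ?F (z(1 := u)) \<partial>PiM {2..k} (\<lambda>_. lborel) \<partial>lborel)"
    unfolding atLeastAtMost_1_insert using F unfolding atLeastAtMost_1_insert
    by (intro N.product_nn_integral_insert_rev) (auto cong: measurable_cong_sets sets_PiM_cong)
  also have "\<dots> = (\<integral>\<^sup>+u. ennreal (r ^ (2 * (k - 1))) *
      (\<integral>\<^sup>+z. indicator {z. rescaled_copy y z} z * (ennreal (f u) * (\<Prod>i\<in>{2..k}. ennreal (f (u + r *\<^sub>R z i))))
        \<partial>PiM {2..k} (\<lambda>_. lborel)) \<partial>lborel)"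
  proof (intro nn_integral_cong)
    fix u :: "real^2"
    have m: "(\<lambda>z. z(1 := u)) \<in> measurable (PiM {2..k} (\<lambda>_. borel)) (PiM (insert 1 {2..k}) (\<lambda>_. borel))"
      by measurable
    have "(\<integral>\<^sup>+z. ?F (z(1 := u)) \<partial>PiM {2..k} (\<lambda>_. lborel)) =
        ennreal (r ^ (DIM(real^2) * card {2..k})) *
          (\<integral>\<^sup>+z. ?F ((\<lambda>i\<in>{2..k}. u + r *\<^sub>R z i)(1 := u)) \<partial>PiM {2..k} (\<lambda>_. lborel))"
      using measurable_compose[OF m F] by (intro nn_integral_PiM_lborel_affine r) auto
    also have "DIM(real^2) * card {2..k} = 2 * (k - 1)" by simp
    also have "(\<integral>\<^sup>+z. ?F ((\<lambda>i\<in>{2..k}. u + r *\<^sub>R z i)(1 := u)) \<partial>PiM {2..k} (\<lambda>_. lborel)) =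
      (\<integral>\<^sup>+z. indicator {z. rescaled_copy y z} z * (ennreal (f u) * (\<Prod>i\<in>{2..k}. ennreal (f (u + r *\<^sub>R z i))))
        \<partial>PiM {2..k} (\<lambda>_. lborel))"
    proof (intro nn_integral_cong)
      fix z :: "nat \<Rightarrow> real^2"
      let ?x = "(\<lambda>i\<in>{2..k}. u + r *\<^sub>R z i)(1 := u)"
      \<comment> \<open>With the first entry of z set to 0, the base point u also has the form u + r
        z_1, so one affine map describes all k points.\<close>
      have "sector_copy \<alpha> T r ?x y {1..k} \<longleftrightarrow> sector_copy \<alpha> T (r * 1) (\<lambda>i. u + r *\<^sub>R (z(1 := 0)) i) y {1..k}"
        unfolding mult_1_right by (intro sector_copy_cong) auto
      also have "\<dots> \<longleftrightarrow> rescaled_copy y z"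
        unfolding rescaled_copy_def by (rule sector_copy_scale[OF r])
      finally have copy: "sector_copy \<alpha> T r ?x y {1..k} \<longleftrightarrow> rescaled_copy y z" .
      have "(\<Prod>i\<in>{1..k}. ennreal (f (?x i))) = ennreal (f u) * (\<Prod>i\<in>{2..k}. ennreal (f (?x i)))"
        unfolding atLeastAtMost_1_insert by simp
      also have "(\<Prod>i\<in>{2..k}. ennreal (f (?x i))) = (\<Prod>i\<in>{2..k}. ennreal (f (u + r *\<^sub>R z i)))"
        by (intro prod.cong) auto
      finally have prod: "(\<Prod>i\<in>{1..k}. ennreal (f (?x i))) = ennreal (f u) * (\<Prod>i\<in>{2..k}. ennreal (f (u + r *\<^sub>R z i)))" .
      show "?F ?x = indicator {z. rescaled_copy y z} z * (ennreal (f u) * (\<Prod>i\<in>{2..k}. ennreal (f (u + r *\<^sub>R z i))))"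
        unfolding prod indicator_def mem_Collect_eq copy by (rule mult.commute)
    qed
    finally show "(\<integral>\<^sup>+z. ?F (z(1 := u)) \<partial>PiM {2..k} (\<lambda>_. lborel)) = ennreal (r ^ (2 * (k - 1))) *
      (\<integral>\<^sup>+z. indicator {z. rescaled_copy y z} z * (ennreal (f u) * (\<Prod>i\<in>{2..k}. ennreal (f (u + r *\<^sub>R z i))))
        \<partial>PiM {2..k} (\<lambda>_. lborel))" .
  qed
  also have "\<dots> = ennreal (r ^ (2 * (k - 1))) * scaled_copy_integral r y"
  proof -
    let ?G = "\<lambda>(u, z). indicator {z. rescaled_copy y z} z * (ennreal (f u) * (\<Prod>i\<in>{2..k}. ennreal (f (u + r *\<^sub>R z i)))) :: ennreal"
    have G: "?G \<in> borel_measurable (lborel \<Otimes>\<^sub>M PiM {2..k} (\<lambda>_. lborel))"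
      by (rule measurable_scaled_section)
    have "scaled_copy_integral r y = (\<integral>\<^sup>+u. (\<integral>\<^sup>+z. ?G (u, z) \<partial>PiM {2..k} (\<lambda>_. lborel)) \<partial>lborel)"
      unfolding scaled_copy_integral_def by (rule J.nn_integral_fst[OF G, symmetric])
    moreover have "(\<lambda>u. \<integral>\<^sup>+z. ?G (u, z) \<partial>PiM {2..k} (\<lambda>_. lborel)) \<in> borel_measurable lborel"
      by (rule J.borel_measurable_nn_integral_fst[OF G])
    ultimately show ?thesis by (simp add: nn_integral_cmult)
  qed
  finally show ?thesis .
qed

text \<open>Rescaling acts on the points alone, as inclinations are unaffected by it; therefore the
  angles are integrated outermost.\<close>

lemma copy_prob_eq:
  assumes r: "0 < r"
  shows "ennreal (copy_prob r) =
    ennreal (r ^ (2 * (k - 1))) * (\<integral>\<^sup>+y. angle_density y * scaled_copy_integral r y \<partial>PiM {1..k} (\<lambda>_. lborel))"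
proof -
  let ?I = "{1..k}"
  have d: "distr M (PiM ?I (\<lambda>_. borel) \<Otimes>\<^sub>M PiM ?I (\<lambda>_. borel)) (\<lambda>\<omega>. (\<lambda>i\<in>?I. X i \<omega>, \<lambda>i\<in>?I. Y i \<omega>)) =
      PiM ?I (\<lambda>_. point_law) \<Otimes>\<^sub>M PiM ?I (\<lambda>_. angle_law)"
  proof -
    have "(\<Pi>\<^sub>M i\<in>?I. distr M borel (X i)) = PiM ?I (\<lambda>_. point_law)"
      "(\<Pi>\<^sub>M i\<in>?I. distr M borel (Y i)) = PiM ?I (\<lambda>_. angle_law)"
      using X_distr Y_distr by (auto intro!: PiM_cong simp: point_law_def angle_law_def)
    moreover have "?I \<subseteq> {1..}" "?I \<noteq> {}" using k_pos by auto
    ultimately show ?thesis using distr_vector_pair[OF X_indep Y_indep XY_indep] by simp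
  qed
  let ?N = "PiM ?I (\<lambda>_. borel :: (real^2) measure) \<Otimes>\<^sub>M PiM ?I (\<lambda>_. borel :: real measure)"
  define S where "S = {w \<in> space ?N. sector_copy \<alpha> T r (fst w) (snd w) ?I}"
  have p: "Measurable.pred ?N (\<lambda>w. sector_copy \<alpha> T r (fst w) (snd w) ?I)"
    by (intro pred_sector_copy) auto
  then have S: "S \<in> sets ?N" unfolding S_def by (rule predE)
  have v: "(\<lambda>\<omega>. (\<lambda>i\<in>?I. X i \<omega>, \<lambda>i\<in>?I. Y i \<omega>)) \<in> measurable M ?N"
    by (intro measurable_Pair measurable_restrict measurable_X measurable_Y) auto
  interpret a: prob_space "PiM ?I (\<lambda>_. point_law)" by (intro prob_space_PiM prob_space_point_law)
  interpret b: prob_space "PiM ?I (\<lambda>_. angle_law)" by (intro prob_space_PiM prob_space_angle_law)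
  interpret pr: pair_sigma_finite "PiM ?I (\<lambda>_. point_law)" "PiM ?I (\<lambda>_. angle_law)" ..
  have sets_eq: "sets (PiM ?I (\<lambda>_. point_law) \<Otimes>\<^sub>M PiM ?I (\<lambda>_. angle_law)) = sets ?N"
    by (intro sets_pair_measure_cong sets_PiM_cong) auto
  have "ennreal (copy_prob r) = emeasure (distr M ?N (\<lambda>\<omega>. (\<lambda>i\<in>?I. X i \<omega>, \<lambda>i\<in>?I. Y i \<omega>))) S"
  proof -
    have "sector_copy \<alpha> T r (\<lambda>i\<in>?I. X i \<omega>) (\<lambda>i\<in>?I. Y i \<omega>) ?I \<longleftrightarrow>
        sector_copy \<alpha> T r (\<lambda>i. X i \<omega>) (\<lambda>i. Y i \<omega>) ?I" for \<omega>
      by (intro sector_copy_cong) auto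
    then show ?thesis
      unfolding copy_prob_def emeasure_eq_measure[symmetric]
      using measurable_space[OF v]
      by (subst emeasure_distr[OF v S]) (auto simp: S_def intro!: arg_cong[where f = "emeasure M"])
  qed
  also have "\<dots> = emeasure (PiM ?I (\<lambda>_. point_law) \<Otimes>\<^sub>M PiM ?I (\<lambda>_. angle_law)) S" unfolding d ..
  also have "\<dots> = (\<integral>\<^sup>+w. indicator S w \<partial>(PiM ?I (\<lambda>_. point_law) \<Otimes>\<^sub>M PiM ?I (\<lambda>_. angle_law)))"
    using S sets_eq by (intro nn_integral_indicator[symmetric]) simp
  also have "\<dots> = (\<integral>\<^sup>+y. \<integral>\<^sup>+x. indicator S (x, y) \<partial>PiM ?I (\<lambda>_. point_law) \<partial>PiM ?I (\<lambda>_. angle_law))"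
    using S sets_eq by (intro pr.nn_integral_snd[symmetric]) (auto intro: borel_measurable_indicator)
  also have "\<dots> = (\<integral>\<^sup>+y. ennreal (r ^ (2 * (k - 1))) * scaled_copy_integral r y \<partial>PiM ?I (\<lambda>_. angle_law))"
  proof (intro nn_integral_cong)
    fix y assume y: "y \<in> space (PiM ?I (\<lambda>_. angle_law))"
    have [measurable]: "Measurable.pred (PiM ?I (\<lambda>_. borel)) (\<lambda>x :: nat \<Rightarrow> real^2. sector_copy \<alpha> T r x y ?I)"
      by (intro pred_sector_copy) auto
    have "(\<integral>\<^sup>+x. indicator S (x, y) \<partial>PiM ?I (\<lambda>_. point_law)) =
        (\<integral>\<^sup>+x. indicator {x. sector_copy \<alpha> T r x y ?I} x \<partial>PiM ?I (\<lambda>_. point_law))"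
      using y by (intro nn_integral_cong) (auto simp: S_def indicator_def space_pair_measure space_PiM)
    also have "\<dots> = (\<integral>\<^sup>+x. (\<Prod>i\<in>?I. ennreal (f (x i))) * indicator {x. sector_copy \<alpha> T r x y ?I} x \<partial>PiM ?I (\<lambda>_. lborel))"
      unfolding PiM_point_law by (intro nn_integral_density) measurable
    also have "\<dots> = ennreal (r ^ (2 * (k - 1))) * scaled_copy_integral r y"
      by (rule nn_integral_copy_rescale[OF r])
    finally show "(\<integral>\<^sup>+x. indicator S (x, y) \<partial>PiM ?I (\<lambda>_. point_law)) =
      ennreal (r ^ (2 * (k - 1))) * scaled_copy_integral r y" .
  qed
  also have "\<dots> = (\<integral>\<^sup>+y. angle_density y * (ennreal (r ^ (2 * (k - 1))) * scaled_copy_integral r y) \<partial>PiM ?I (\<lambda>_. lborel))"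
    unfolding PiM_angle_law by (rule nn_integral_density) measurable
  also have "\<dots> = ennreal (r ^ (2 * (k - 1))) * (\<integral>\<^sup>+y. angle_density y * scaled_copy_integral r y \<partial>PiM ?I (\<lambda>_. lborel))"
    by (subst nn_integral_cmult[symmetric]) (auto simp: ac_simps)
  finally show ?thesis .
qed

section \<open>Domination and passage to the limit r -> 0\<close>

definition "shape_bound = (\<integral>\<^sup>+(u, z). ennreal (f u) * (ennreal (B ^ (k - 1)) *
    indicator (Pi\<^sub>E {2..k} (\<lambda>_. cball (0 :: real^2) (real (2 * k\<^sup>2)))) z) \<partial>(lborel \<Otimes>\<^sub>M PiM {2..k} (\<lambda>_. lborel)))"

lemma measurable_shape_bound:
  "(\<lambda>(u, z). ennreal (f u) * (ennreal (B ^ (k - 1)) *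
    indicator (Pi\<^sub>E {2..k} (\<lambda>_. cball (0::real^2) (real (2 * k\<^sup>2)))) z))
   \<in> borel_measurable (lborel \<Otimes>\<^sub>M PiM {2..k} (\<lambda>_. lborel))"
proof -
  have [measurable]: "Pi\<^sub>E {2..k} (\<lambda>_. cball (0::real^2) (real (2 * k\<^sup>2))) \<in> sets (PiM {2..k} (\<lambda>_. lborel))"
    by (intro sets_PiM_I_finite) auto
  show ?thesis by measurable
qed

lemma shape_bound_finite: "shape_bound < \<infinity>"
proof -
  interpret N: product_sigma_finite "\<lambda>_::nat. lborel :: (real^2) measure" by unfold_locales
  interpret J: sigma_finite_measure "PiM {2..k} (\<lambda>_. lborel :: (real^2) measure)"
    by (rule sigma_finite_PiM_lborel) simp
  let ?K = "Pi\<^sub>E {2..k} (\<lambda>_. cball (0::real^2) (real (2 * k\<^sup>2)))"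
  have K[measurable]: "?K \<in> sets (PiM {2..k} (\<lambda>_. lborel))"
    by (intro sets_PiM_I_finite) auto
  have "shape_bound = (\<integral>\<^sup>+u. (\<integral>\<^sup>+z. ennreal (f u) * (ennreal (B ^ (k - 1)) * indicator ?K z) \<partial>PiM {2..k} (\<lambda>_. lborel)) \<partial>lborel)"
    unfolding shape_bound_def using J.nn_integral_fst[OF measurable_shape_bound] by simp
  also have "\<dots> = (\<integral>\<^sup>+u. ennreal (f u) * (ennreal (B ^ (k - 1)) * emeasure (PiM {2..k} (\<lambda>_. lborel)) ?K) \<partial>lborel)"
    by (intro nn_integral_cong) (simp add: nn_integral_cmult nn_integral_cmult_indicator)
  also have "\<dots> = ennreal (B ^ (k - 1)) * emeasure (PiM {2..k} (\<lambda>_. lborel)) ?K"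
    by (subst nn_integral_multc) (auto simp: f_int)
  also have "emeasure (PiM {2..k} (\<lambda>_. lborel)) ?K = (\<Prod>i\<in>{2..k}. emeasure lborel (cball (0::real^2) (real (2 * k\<^sup>2))))"
    by (intro N.emeasure_PiM) auto
  also have "ennreal (B ^ (k - 1)) * \<dots> < \<infinity>"
    by (simp add: ennreal_mult_less_top emeasure_cball power_less_top_ennreal)
  finally show ?thesis .
qed

text \<open>The densities at the k - 1 displaced points are replaced by B, but f(u) is kept: it
  supplies integrability in u, while the bounded support supplies it in z.\<close>

lemma scaled_integrand_le:
  assumes "z \<in> space (PiM {2..k} (\<lambda>_. lborel :: (real^2) measure))"
  shows "indicator {z. rescaled_copy y z} z * (ennreal (f u) * (\<Prod>i\<in>{2..k}. ennreal (f (v i)))) \<le>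
    ennreal (f u) * (ennreal (B ^ (k - 1)) * indicator (Pi\<^sub>E {2..k} (\<lambda>_. cball 0 (real (2 * k\<^sup>2)))) z)"
proof (cases "rescaled_copy y z")
  case True
  then have "z \<in> Pi\<^sub>E {2..k} (\<lambda>_. cball 0 (real (2 * k\<^sup>2)))"
    using assms rescaled_copy_bounded by (auto simp: space_PiM PiE_iff)
  moreover have "(\<Prod>i\<in>{2..k}. ennreal (f (v i))) \<le> (\<Prod>i\<in>{2..k}. ennreal B)"
    using f_le by (intro prod_mono_ennreal ennreal_leI) auto
  then have "(\<Prod>i\<in>{2..k}. ennreal (f (v i))) \<le> ennreal (B ^ (k - 1))"
    using B_nonneg by (simp add: ennreal_power)
  ultimately show ?thesis by (simp add: indicator_def mult_left_mono)
qed simp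

lemma scaled_copy_integral_le: "scaled_copy_integral r y \<le> shape_bound"
  unfolding scaled_copy_integral_def shape_bound_def
proof (intro nn_integral_mono, goal_cases)
  case (1 w)
  then show ?case
    unfolding case_prod_beta by (intro scaled_integrand_le) (auto simp: space_pair_measure)
qed

lemma ennreal_density_power: "ennreal (f u ^ k) = ennreal (f u) * (\<Prod>i\<in>{2..k}. ennreal (f u))"
proof -
  have "f u ^ k = f u * f u ^ (k - 1)" using k_pos by (cases k) auto
  then show ?thesis using f_nonneg by (simp add: ennreal_mult' ennreal_power)
qed

text \<open>At a continuity point u of f, all displaced densities f(u + \<rho> z_i) tend to f(u) for
  every z, so almost everywhere continuity gives almost everywhere convergence of the
  integrand.\<close>

lemma scaled_copy_integral_tendsto:
  assumes cont: "AE x in lborel. isCont f x" and \<rho>: "\<rho> \<longlonglongrightarrow> 0"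
  shows "(\<lambda>n. scaled_copy_integral (\<rho> n) y) \<longlonglongrightarrow> copy_integral y"
  unfolding scaled_copy_integral_def copy_integral_def
proof (rule nn_integral_dominated_convergence)
  let ?L = "(lborel :: (real^2) measure) \<Otimes>\<^sub>M PiM {2..k} (\<lambda>_. lborel :: (real^2) measure)"
  interpret J: sigma_finite_measure "PiM {2..k} (\<lambda>_. lborel :: (real^2) measure)"
    by (rule sigma_finite_PiM_lborel) simp
  interpret pr: pair_sigma_finite "lborel :: (real^2) measure" "PiM {2..k} (\<lambda>_. lborel :: (real^2) measure)" ..
  show "AE w in ?L. (case w of (u, z) \<Rightarrow> indicator {z. rescaled_copy y z} z *
        (ennreal (f u) * (\<Prod>i\<in>{2..k}. ennreal (f (u + \<rho> j *\<^sub>R z i))))) \<le>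
      (case w of (u, z) \<Rightarrow> ennreal (f u) * (ennreal (B ^ (k - 1)) *
        indicator (Pi\<^sub>E {2..k} (\<lambda>_. cball 0 (real (2 * k\<^sup>2)))) z))" for j
    unfolding case_prod_beta by (intro AE_I2 scaled_integrand_le) (auto simp: space_pair_measure)
  show "(\<integral>\<^sup>+w. (case w of (u, z) \<Rightarrow> ennreal (f u) * (ennreal (B ^ (k - 1)) *
        indicator (Pi\<^sub>E {2..k} (\<lambda>_. cball 0 (real (2 * k\<^sup>2)))) z)) \<partial>?L) < \<infinity>"
    using shape_bound_finite unfolding shape_bound_def .
  have "AE w in ?L. isCont f (fst w)"
  proof -
    from cont obtain N where N: "{x \<in> space lborel. \<not> isCont f x} \<subseteq> N" "N \<in> null_sets lborel"
      by (auto elim!: AE_E intro: that simp: null_sets_def)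
    \<comment> \<open>The exceptional set concerns u only; as a cylinder over a null set it is null
      in the product, because the second factor is sigma-finite.\<close>
    have "N \<times> space (PiM {2..k} (\<lambda>_. lborel :: (real^2) measure)) \<in> null_sets ?L"
      using N(2) by (auto simp: null_sets_def J.emeasure_pair_measure_Times)
    then show ?thesis
      by (rule AE_I') (use N(1) in \<open>auto simp: space_pair_measure\<close>)
  qed
  then show "AE w in ?L. (\<lambda>n. case w of (u, z) \<Rightarrow> indicator {z. rescaled_copy y z} z *
        (ennreal (f u) * (\<Prod>i\<in>{2..k}. ennreal (f (u + \<rho> n *\<^sub>R z i))))) \<longlonglongrightarrow>
      (case w of (u, z) \<Rightarrow> indicator {z. rescaled_copy y z} z * ennreal (f u ^ k))"
  proof eventually_elim
    case (elim w)
    obtain u z where w: "w = (u, z)" by (cases w)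
    have "(\<lambda>n. indicator {z. rescaled_copy y z} z * (ennreal (f u) * (\<Prod>i\<in>{2..k}. ennreal (f (u + \<rho> n *\<^sub>R z i)))))
      \<longlonglongrightarrow> indicator {z. rescaled_copy y z} z * (ennreal (f u) * (\<Prod>i\<in>{2..k}. ennreal (f u)))"
    proof -
      have prod: "(\<lambda>n. \<Prod>i\<in>{2..k}. ennreal (f (u + \<rho> n *\<^sub>R z i))) \<longlonglongrightarrow> (\<Prod>i\<in>{2..k}. ennreal (f u))"
      proof -
        have "(\<lambda>n. ennreal (\<Prod>i\<in>{2..k}. f (u + \<rho> n *\<^sub>R z i))) \<longlonglongrightarrow> ennreal (\<Prod>i\<in>{2..k}. f u)"
        proof (intro tendsto_ennrealI tendsto_prod isCont_tendsto_compose[of u f])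
          fix i
          have "(\<lambda>n. u + \<rho> n *\<^sub>R z i) \<longlonglongrightarrow> u + 0 *\<^sub>R z i" by (intro tendsto_intros \<rho>)
          then show "(\<lambda>n. u + \<rho> n *\<^sub>R z i) \<longlonglongrightarrow> u" by simp
        qed (use elim w in simp)
        then show ?thesis using f_nonneg by (simp only: prod_ennreal)
      qed
      have 1: "(\<lambda>n. ennreal (f u) * (\<Prod>i\<in>{2..k}. ennreal (f (u + \<rho> n *\<^sub>R z i))))
          \<longlonglongrightarrow> ennreal (f u) * (\<Prod>i\<in>{2..k}. ennreal (f u))"
        by (intro ennreal_tendsto_cmult prod) simp
      show ?thesis by (cases "rescaled_copy y z") (use 1 in simp_all)
    qed
    then show ?case by (simp only: w prod.case ennreal_density_power)
  qed
qed (rule measurable_scaled_section measurable_limit_section measurable_shape_bound)+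

text \<open>The uniform bound survives the limit along any null sequence of radii; 1 / (n + 1) is
  used.\<close>

lemma copy_integral_le:
  assumes "AE x in lborel. isCont f x"
  shows "copy_integral y \<le> shape_bound"
  using scaled_copy_integral_tendsto[OF assms LIMSEQ_inverse_real_of_nat]
  by (rule LIMSEQ_le_const2) (auto intro!: scaled_copy_integral_le)

definition "mean_copy_integral = (\<integral>\<^sup>+y. angle_density y * copy_integral y \<partial>PiM {1..k} (\<lambda>_. lborel))"

lemma mean_copy_integral_finite:
  assumes "AE x in lborel. isCont f x"
  shows "mean_copy_integral < \<infinity>"
proof -
  have "mean_copy_integral \<le> (\<integral>\<^sup>+y. angle_density y * shape_bound \<partial>PiM {1..k} (\<lambda>_. lborel))"
    unfolding mean_copy_integral_def by (intro nn_integral_mono mult_left_mono copy_integral_le assms) simp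
  also have "\<dots> = shape_bound" by (simp add: nn_integral_multc integral_angle_density)
  finally show ?thesis using shape_bound_finite by simp
qed

text \<open>A second dominated convergence, now over the angles. The majorant is a constant times a
  probability density, hence integrable.\<close>

lemma copy_prob_tendsto:
  assumes cont: "AE x in lborel. isCont f x" and \<rho>: "\<rho> \<longlonglongrightarrow> 0" and pos: "\<And>n. 0 < \<rho> n"
  shows "(\<lambda>n. copy_prob (\<rho> n) / \<rho> n ^ (2 * (k - 1))) \<longlonglongrightarrow> enn2real mean_copy_integral"
proof -
  let ?E = "\<lambda>n. \<integral>\<^sup>+y. angle_density y * scaled_copy_integral (\<rho> n) y \<partial>PiM {1..k} (\<lambda>_. lborel)"
  have E: "copy_prob (\<rho> n) / \<rho> n ^ (2 * (k - 1)) = enn2real (?E n)" for n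
  proof -
    have "copy_prob (\<rho> n) = enn2real (ennreal (copy_prob (\<rho> n)))" using copy_prob_nonneg by simp
    also have "\<dots> = \<rho> n ^ (2 * (k - 1)) * enn2real (?E n)"
      unfolding copy_prob_eq[OF pos] using pos[of n] by (simp add: enn2real_mult)
    finally show ?thesis using pos[of n] by simp
  qed
  have "?E \<longlonglongrightarrow> mean_copy_integral"
    unfolding mean_copy_integral_def
  proof (rule nn_integral_dominated_convergence[where w = "\<lambda>y. angle_density y * shape_bound"])
    \<comment> \<open>Multiplication by a constant is continuous on the extended reals only for a
      finite constant, hence the check that \<open>angle_density y\<close> is finite.\<close>
    show "AE y in PiM {1..k} (\<lambda>_. lborel). (\<lambda>n. angle_density y * scaled_copy_integral (\<rho> n) y) \<longlonglongrightarrow> angle_density y * copy_integral y"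
      using scaled_copy_integral_tendsto[OF cont \<rho>]
      by (intro AE_I2 ennreal_tendsto_cmult)
        (auto simp: angle_density_def less_top[symmetric] ennreal_prod_eq_top ennreal_mult_eq_top_iff indicator_def)
    show "(\<integral>\<^sup>+y. angle_density y * shape_bound \<partial>PiM {1..k} (\<lambda>_. lborel)) < \<infinity>"
      using shape_bound_finite by (simp add: nn_integral_multc integral_angle_density)
  qed (auto intro!: AE_I2 mult_left_mono scaled_copy_integral_le)
  then have "(\<lambda>n. enn2real (?E n)) \<longlonglongrightarrow> enn2real mean_copy_integral"
    using mean_copy_integral_finite[OF cont] by (intro tendsto_enn2real) auto
  then show ?thesis unfolding E .
qed

text \<open>Identifies the iterated Bochner integrals with nonnegative integrals; the factor (2
  pi)^k that turns the angle density into the indicator of the cube cancels against the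
  prefactor.\<close>

lemma mu_eq:
  assumes cont: "AE x in lborel. isCont f x"
  shows "mu \<alpha> f T = enn2real mean_copy_integral / fact k"
proof -
  let ?L = "(lborel :: (real^2) measure) \<Otimes>\<^sub>M PiM {2..k} (\<lambda>_. lborel :: (real^2) measure)"
  let ?A = "{1..k} \<rightarrow>\<^sub>E {0..2 * pi}" and ?N = "PiM {1..k} (\<lambda>_. lborel :: real measure)"
  have A[measurable]: "?A \<in> sets ?N" by (intro sets_PiM_I_finite) auto
  have inner: "integral\<^sup>L ?L (\<lambda>(x, z). h_ind \<alpha> T (z(1 := 0)) y * f x ^ k) = enn2real (copy_integral y)" for y
  proof -
    have eq: "ennreal (case w of (x, z) \<Rightarrow> h_ind \<alpha> T (z(1 := 0)) y * f x ^ k) =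
        (case w of (u, z) \<Rightarrow> indicator {z. rescaled_copy y z} z * ennreal (f u ^ k))" for w
      using digraph_iso_sector_digraph_iff[OF card_T] card_T
      by (auto simp: h_ind_def rescaled_copy_def indicator_def split: prod.splits)
    have "(\<lambda>w. enn2real (case w of (u, z) \<Rightarrow> indicator {z. rescaled_copy y z} z * ennreal (f u ^ k))) \<in> borel_measurable ?L"
      using measurable_limit_section[of y] by measurable
    moreover have "0 \<le> (case w of (x, z) \<Rightarrow> h_ind \<alpha> T (z(1 := 0)) y * f x ^ k)" for w
      using f_nonneg by (auto simp: h_ind_def split: prod.splits)
    ultimately show ?thesis
      unfolding copy_integral_def eq[symmetric] by (subst integral_eq_nn_integral) auto
  qed
  have "(LINT y:?A|?N. integral\<^sup>L ?L (\<lambda>(x, z). h_ind \<alpha> T (z(1 := 0)) y * f x ^ k)) =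
      (\<integral>y. indicator ?A y * enn2real (copy_integral y) \<partial>?N)"
    unfolding set_lebesgue_integral_def inner by simp
  also have "\<dots> = enn2real (\<integral>\<^sup>+y. ennreal (indicator ?A y * enn2real (copy_integral y)) \<partial>?N)"
    by (rule integral_eq_nn_integral) auto
  also have "(\<integral>\<^sup>+y. ennreal (indicator ?A y * enn2real (copy_integral y)) \<partial>?N) =
      (\<integral>\<^sup>+y. ennreal ((2 * pi) ^ k) * (angle_density y * copy_integral y) \<partial>?N)"
  proof (intro nn_integral_cong)
    fix y assume y: "y \<in> space ?N"
    have fin: "copy_integral y < \<infinity>" using copy_integral_le[OF cont] shape_bound_finite by (rule le_less_trans)
    have "ennreal ((2 * pi) ^ k) * angle_density y = indicator ?A y"
    proof (cases "y \<in> ?A")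
      case True
      then have "angle_density y = (\<Prod>i\<in>{1..k}. ennreal (1 / (2 * pi)))"
        unfolding angle_density_def by (intro prod.cong) (auto simp: PiE_iff indicator_def)
      also have "\<dots> = ennreal ((1 / (2 * pi)) ^ k)" by (simp add: ennreal_power)
      finally show ?thesis using True by (simp add: ennreal_mult'[symmetric] power_divide)
    next
      case False
      then obtain i where "i \<in> {1..k}" "y i \<notin> {0..2 * pi}" using y by (auto simp: space_PiM PiE_iff)
      then have "angle_density y = 0"
        unfolding angle_density_def by (intro prod_zero bexI[of _ i]) auto
      then show ?thesis using False by simp
    qed
    then show "ennreal (indicator ?A y * enn2real (copy_integral y)) = ennreal ((2 * pi) ^ k) * (angle_density y * copy_integral y)"
      using fin by (simp add: mult.assoc[symmetric] indicator_def)
  qed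
  also have "\<dots> = ennreal ((2 * pi) ^ k) * mean_copy_integral"
    unfolding mean_copy_integral_def by (rule nn_integral_cmult) measurable
  finally have "(LINT y:?A|?N. integral\<^sup>L ?L (\<lambda>(x, z). h_ind \<alpha> T (z(1 := 0)) y * f x ^ k)) =
      enn2real (ennreal ((2 * pi) ^ k) * mean_copy_integral)" .
  then show ?thesis
    unfolding mu_def Let_def card_T by (simp only: enn2real_mult) simp
qed

end

declare One_nat_def [simp]

section \<open>The strong law\<close>

lemma tendsto_binomial_div_power:
  "(\<lambda>n. real (n choose k) / real n ^ k) \<longlonglongrightarrow> 1 / fact k"
proof -
  have "(\<lambda>n. (\<Prod>i = 0..<k. 1 - real i / real n) / fact k) \<longlonglongrightarrow> (\<Prod>i = 0..<k. 1 - 0) / fact k"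
    by (intro tendsto_intros real_tendsto_divide_at_top[OF tendsto_const filterlim_real_sequentially]) auto
  moreover have "\<forall>\<^sub>F n in sequentially. (\<Prod>i = 0..<k. 1 - real i / real n) / fact k = real (n choose k) / real n ^ k"
  proof (rule eventually_sequentiallyI[of 1])
    fix n :: nat assume n: "1 \<le> n"
    have "real (n choose k) = (\<Prod>i = 0..<k. real n - real i) / fact k"
      unfolding binomial_gbinomial gbinomial_prod_rev by simp
    also have "(\<Prod>i = 0..<k. real n - real i) = (\<Prod>i = 0..<k. real n * (1 - real i / real n))"
      using n by (intro prod.cong) (auto simp: field_simps)
    also have "\<dots> = real n ^ k * (\<Prod>i = 0..<k. 1 - real i / real n)"
      by (simp add: prod.distrib)
    finally show "(\<Prod>i = 0..<k. 1 - real i / real n) / fact k = real (n choose k) / real n ^ k"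
      using n by simp
  qed
  ultimately show ?thesis by (auto elim: Lim_transform_eventually)
qed

text \<open>In the variable t = ln n / 2 the right side is c exp t and the left side is a polynomial
  in t.\<close>

lemma eventually_ln_power_le_sqrt:
  fixes a c :: real
  assumes "0 < c" "0 \<le> a"
  shows "\<forall>\<^sub>F n in sequentially. ln (real n) * (a * ln (real n) + 1) ^ p \<le> c * sqrt (real n)"
proof -
  have "filterlim (\<lambda>n. 1 / 2 * ln (real n)) at_top sequentially"
    by (intro filterlim_tendsto_pos_mult_at_top[OF tendsto_const]
        filterlim_compose[OF ln_at_top filterlim_real_sequentially]) simp
  then have "filterlim (\<lambda>n. ln (real n) / 2) at_top sequentially" by simp
  from filterlim_compose[OF tendsto_power_div_exp_0[of "Suc p"] this]
  have "(\<lambda>n. (2 ^ Suc p * (a + 1) ^ p) * ((ln (real n) / 2) ^ Suc p / exp (ln (real n) / 2))) \<longlonglongrightarrow>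
      (2 ^ Suc p * (a + 1) ^ p) * 0"
    by (intro tendsto_mult_left)
  then have "\<forall>\<^sub>F n in sequentially. (2 ^ Suc p * (a + 1) ^ p) * ((ln (real n) / 2) ^ Suc p / exp (ln (real n) / 2)) < c"
    using assms by (intro order_tendstoD(2)) auto
  then show ?thesis
    using eventually_ge_at_top[of 3]
  proof eventually_elim
    case (elim n)
    \<comment> \<open>From e <= 3 <= n; it allows a ln n + 1 to be replaced by (a + 1) ln n.\<close>
    have "1 \<le> ln (real n)"
      using elim(2) exp_le by (subst ln_ge_iff) auto
    then have "(a * ln (real n) + 1) ^ p \<le> ((a + 1) * ln (real n)) ^ p"
      using assms by (intro power_mono) (auto simp: algebra_simps)
    then have "ln (real n) * (a * ln (real n) + 1) ^ p \<le> ln (real n) * ((a + 1) * ln (real n)) ^ p"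
      using \<open>1 \<le> ln (real n)\<close> by (intro mult_left_mono) auto
    also have "\<dots> = (2 ^ Suc p * (a + 1) ^ p) * (ln (real n) / 2) ^ Suc p"
      by (simp add: power_mult_distrib power_divide)
    also have "\<dots> \<le> c * exp (ln (real n) / 2)"
      using elim(1) by (simp add: divide_less_eq del: power_Suc)
    also have "exp (ln (real n) / 2) = sqrt (real n)"
      using elim(2) by (simp add: powr_half_sqrt[symmetric] powr_def)
    finally show ?case .
  qed
qed

text \<open>If \<open>n r\<^sub>n\<^sup>2\<close> is at most a suitable negative power of \<open>n\<close>, a constant \<open>m\<close> works. Otherwise \<open>m\<close>
  of order \<open>ln n\<close> works, since the quantity that dominates \<open>ln n\<close> is then at least \<open>sqrt n\<close>, which
  absorbs any power of \<open>m\<close>.\<close>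

lemma truncation_level:
  fixes r :: "nat \<Rightarrow> real" and C :: real
  assumes k: "2 \<le> k" and C: "0 < C" and pos: "\<And>n. 1 \<le> n \<Longrightarrow> 0 < r n"
    and nr2: "(\<lambda>n. real n * (r n)\<^sup>2) \<longlonglongrightarrow> 0"
    and ln_small: "(\<lambda>n. ln (real n)) \<in> o(\<lambda>n. real n ^ (2 * k - 1) * r n ^ (4 * (k - 1)))"
  obtains m :: "nat \<Rightarrow> nat" and D :: real where "\<forall>\<^sub>F n in sequentially. 0 < m n" "0 \<le> D"
    "\<forall>\<^sub>F n in sequentially. real n * (real n * (C * (r n)\<^sup>2)) ^ m n \<le> D / real n ^ (k + 2)"
    "\<And>c. 0 < c \<Longrightarrow> \<forall>\<^sub>F n in sequentially. ln (real n) * real (m n) ^ (2 * k) \<le> c * (real n ^ (2 * k - 1) * r n ^ (4 * (k - 1)))"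
proof -
  define \<epsilon> where "\<epsilon> n = real n * (r n)\<^sup>2" for n
  define b where "b n = real n ^ (2 * k - 1) * r n ^ (4 * (k - 1))" for n
  \<comment> \<open>Chosen such that (n^-\<delta>)^(2(k-1)) = n^(-1/2): above the threshold
    n^-\<delta> for \<epsilon>, the quantity \<open>b\<close> is at least sqrt n. Then M = (k + 3) /
    \<delta>, so that below the threshold \<epsilon>^M is at most n^-(k+3).\<close>
  define \<delta> where "\<delta> = 1 / (4 * real (k - 1))"
  define M where "M = 4 * (k - 1) * (k + 3)"
  define m where "m n = (if \<epsilon> n \<le> real n powr - \<delta> then M else nat \<lceil>real (k + 3) * ln (real n)\<rceil>)" for n
  have M: "0 < M" and \<delta>: "0 < \<delta>" and \<delta>M: "\<delta> * real M = real (k + 3)" and \<delta>k: "\<delta> * real (2 * (k - 1)) = 1 / 2"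
    using k by (auto simp: M_def \<delta>_def field_simps of_nat_diff)
  have \<epsilon>_pos: "0 < \<epsilon> n" if "1 \<le> n" for n using that pos[OF that] by (simp add: \<epsilon>_def)
  \<comment> \<open>Expresses the dominating quantity through \<epsilon> = n r^2, the variable that
    decides between the two cases.\<close>
  have b_eq: "b n = real n * \<epsilon> n ^ (2 * (k - 1))" for n
  proof -
    have "2 * k - 1 = Suc (2 * (k - 1))" using k by simp
    moreover have "r n ^ (4 * (k - 1)) = ((r n)\<^sup>2) ^ (2 * (k - 1))" by (simp flip: power_mult)
    ultimately show ?thesis unfolding b_def \<epsilon>_def by (simp add: power_mult_distrib)
  qed
  have powr_nat: "real n powr - real p = 1 / real n ^ p" if "1 \<le> n" for n p
    using that by (simp add: powr_minus powr_realpow divide_inverse)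
  have m_pos: "\<forall>\<^sub>F n in sequentially. 0 < m n"
    using eventually_ge_at_top[of 2]
  proof eventually_elim
    case (elim n)
    then have "0 < real (k + 3) * ln (real n)" by simp
    then have "0 < \<lceil>real (k + 3) * ln (real n)\<rceil>" by linarith
    then show ?case using M by (simp add: m_def)
  qed
  \<comment> \<open>Below 1 / e, the power with exponent m at least (k + 3) ln n is at most
    n^-(k+3).\<close>
  have C\<epsilon>: "\<forall>\<^sub>F n in sequentially. C * \<epsilon> n < exp (- 1)"
  proof -
    have "(\<lambda>n. C * \<epsilon> n) \<longlonglongrightarrow> C * 0" unfolding \<epsilon>_def by (intro tendsto_mult tendsto_const nr2)
    then show ?thesis by (intro order_tendstoD(2)[of _ "C * 0"]) auto
  qed
  have crowd: "\<forall>\<^sub>F n in sequentially. real n * (real n * (C * (r n)\<^sup>2)) ^ m n \<le> max 1 (C ^ M) / real n ^ (k + 2)"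
    using C\<epsilon> eventually_ge_at_top[of 2]
  proof eventually_elim
    case (elim n)
    then have n: "1 \<le> n" by simp
    have eq: "real n * (C * (r n)\<^sup>2) = C * \<epsilon> n" by (simp add: \<epsilon>_def)
    have "(C * \<epsilon> n) ^ m n \<le> max 1 (C ^ M) / real n ^ (k + 3)"
    proof (cases "\<epsilon> n \<le> real n powr - \<delta>")
      case True
      have "(C * \<epsilon> n) ^ M \<le> (C * real n powr - \<delta>) ^ M"
        using C \<epsilon>_pos[OF n] True by (intro power_mono mult_left_mono) auto
      also have "\<dots> = C ^ M * (real n powr - \<delta>) ^ M" by (rule power_mult_distrib)
      also have "(real n powr - \<delta>) ^ M = real n powr - real (k + 3)"
        using n \<delta>M by (simp add: powr_power mult.commute)
      also have "C ^ M * \<dots> \<le> max 1 (C ^ M) * real n powr - real (k + 3)"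
        by (intro mult_right_mono) auto
      finally show ?thesis using True powr_nat[OF n, of "k + 3"] by (simp add: m_def)
    next
      case False
      have "(C * \<epsilon> n) ^ m n \<le> exp (- 1) ^ m n"
        using elim C \<epsilon>_pos[OF n] by (intro power_mono) auto
      also have "\<dots> = exp (- real (m n))" by (simp flip: exp_of_nat_mult)
      also have "\<dots> \<le> exp (- (real (k + 3) * ln (real n)))"
        using real_nat_ceiling_ge[of "real (k + 3) * ln (real n)"] False by (simp only: m_def if_False) simp
      also have "\<dots> = real n powr - real (k + 3)" using n by (simp add: powr_def algebra_simps)
      also have "\<dots> \<le> max 1 (C ^ M) * real n powr - real (k + 3)"
        using mult_right_mono[of 1 "max 1 (C ^ M)" "real n powr - real (k + 3)"] by simp
      finally show ?thesis using powr_nat[OF n, of "k + 3"] by simp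
    qed
    then have "real n * (C * \<epsilon> n) ^ m n \<le> real n * (max 1 (C ^ M) / real n ^ (k + 3))"
      by (intro mult_left_mono) auto
    also have "\<dots> = max 1 (C ^ M) / real n ^ (k + 2)"
      using n by (simp add: field_simps power_add eval_nat_numeral)
    finally show ?case unfolding eq .
  qed
  have small: "\<forall>\<^sub>F n in sequentially. ln (real n) * real (m n) ^ (2 * k) \<le> c * b n" if c: "0 < c" for c
  proof -
    \<comment> \<open>With constant m = M, the factor M^(2k) is absorbed into the constant of the
      little-o hypothesis.\<close>
    have c': "0 < c / real M ^ (2 * k)" using c M by simp
    have "\<forall>\<^sub>F n in sequentially. norm (ln (real n)) \<le> c / real M ^ (2 * k) * norm (b n)"
      using landau_o.smallD[OF ln_small c'] unfolding b_def .
    then show ?thesis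
      using eventually_ln_power_le_sqrt[OF c of_nat_0_le_iff[of "k + 3"], of "2 * k"] eventually_ge_at_top[of 2]
    proof eventually_elim
      case (elim n)
      then have n: "1 \<le> n" by simp
      have b: "0 < b n" using \<epsilon>_pos[OF n] n by (simp add: b_eq)
      have ln: "0 \<le> ln (real n)" using n by simp
      show ?case
      proof (cases "\<epsilon> n \<le> real n powr - \<delta>")
        case True
        have "ln (real n) \<le> c / real M ^ (2 * k) * b n" using elim(1) b ln by simp
        then have "ln (real n) * real M ^ (2 * k) \<le> c * b n"
          using M by (simp add: field_simps)
        then show ?thesis using True by (simp add: m_def)
      next
        case False
        have "real (m n) \<le> real (k + 3) * ln (real n) + 1"
        proof -
          have "0 \<le> real (k + 3) * ln (real n)" using ln by simp
          then show ?thesis unfolding m_def using False by simp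
        qed
        then have "ln (real n) * real (m n) ^ (2 * k) \<le> ln (real n) * (real (k + 3) * ln (real n) + 1) ^ (2 * k)"
          using ln by (intro mult_left_mono power_mono) auto
        also have "\<dots> \<le> c * sqrt (real n)" by (rule elim(2))
        also have "sqrt (real n) \<le> b n"
        proof -
          have "(real n powr - \<delta>) ^ (2 * (k - 1)) = real n powr (real (2 * (k - 1)) * - \<delta>)"
            using n by (intro powr_power) simp
          also have "real (2 * (k - 1)) * - \<delta> = - (\<delta> * real (2 * (k - 1)))"
            by (simp only: mult_minus_right mult.commute)
          also have "real n powr \<dots> = real n powr - (1 / 2)" by (simp only: \<delta>k)
          finally have "(real n powr - \<delta>) ^ (2 * (k - 1)) = real n powr - (1 / 2)" .
          then have "sqrt (real n) = real n * (real n powr - \<delta>) ^ (2 * (k - 1))"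
            using n by (simp add: powr_minus powr_half_sqrt real_div_sqrt flip: divide_inverse)
          also have "\<dots> \<le> b n"
            unfolding b_eq using False by (intro mult_left_mono power_mono) auto
          finally show ?thesis .
        qed
        finally show ?thesis using c by simp
      qed
    qed
  qed
  show thesis
    by (rule that[OF m_pos _ crowd small[unfolded b_def]]) auto
qed


section \<open>Convergence of the mean and almost sure convergence\<close>

context sector_pattern
begin

text \<open>Sandwich argument: after normalisation the upper bound is \<open>t n * q n\<close>, and
  the lower bound differs from it by the bounded factor \<open>t n\<close> times C^k n r^2, which
  vanishes.\<close>

lemma expectation_iso_count_tendsto:
  assumes cont: "AE x in lborel. isCont f x"
    and r_pos: "\<And>n. 1 \<le> n \<Longrightarrow> 0 < r n" and r_lim: "r \<longlonglongrightarrow> 0"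
    and nr2: "(\<lambda>n. real n * (r n)\<^sup>2) \<longlonglongrightarrow> 0"
  shows "(\<lambda>n. expectation (\<lambda>\<omega>. real (card (iso_sets (r n) n \<omega>))) / (real n ^ k * r n ^ (2 * (k - 1)))) \<longlonglongrightarrow> mu \<alpha> f T"
proof -
  define C where "C = B * pi * (real (2 * k\<^sup>2 + 1))\<^sup>2"
  define q where "q n = copy_prob (r n) / r n ^ (2 * (k - 1))" for n
  define t where "t n = real (n choose k) / real n ^ k" for n
  \<comment> \<open>Positivity of r is available only from n = 1 on, hence the shift of the
    sequence.\<close>
  have "(\<lambda>n. q (Suc n)) \<longlonglongrightarrow> enn2real mean_copy_integral"
    unfolding q_def using r_pos LIMSEQ_Suc[OF r_lim] by (intro copy_prob_tendsto cont) auto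
  then have q: "q \<longlonglongrightarrow> enn2real mean_copy_integral" by (rule LIMSEQ_imp_Suc)
  have t: "t \<longlonglongrightarrow> 1 / fact k" unfolding t_def by (rule tendsto_binomial_div_power)
  have upper: "(\<lambda>n. t n * q n) \<longlonglongrightarrow> mu \<alpha> f T"
    using tendsto_mult[OF t q] mu_eq[OF cont] by simp
  have "(\<lambda>n. t n * (q n - C ^ k * (real n * (r n)\<^sup>2))) \<longlonglongrightarrow> 1 / fact k * (enn2real mean_copy_integral - C ^ k * 0)"
    by (intro tendsto_intros t q nr2)
  then have lower: "(\<lambda>n. t n * (q n - C ^ k * (real n * (r n)\<^sup>2))) \<longlonglongrightarrow> mu \<alpha> f T"
    using mu_eq[OF cont] by simp
  show ?thesis
  proof (rule tendsto_sandwich[OF _ _ lower upper])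
    show "\<forall>\<^sub>F n in sequentially. t n * (q n - C ^ k * (real n * (r n)\<^sup>2))
        \<le> expectation (\<lambda>\<omega>. real (card (iso_sets (r n) n \<omega>))) / (real n ^ k * r n ^ (2 * (k - 1)))"
    proof (rule eventually_sequentiallyI[of 1])
      fix n :: nat assume n: "1 \<le> n"
      have r: "0 < r n" by (rule r_pos[OF n])
      \<comment> \<open>The error has k factors r^2, the normaliser only k - 1; the surplus one
        combines with n to form n r^2.\<close>
      have "(r n)\<^sup>2 ^ k = (r n)\<^sup>2 * r n ^ (2 * (k - 1))"
      proof -
        have "k = Suc (k - 1)" using k_pos by simp
        then have "(r n)\<^sup>2 ^ k = (r n)\<^sup>2 * (r n)\<^sup>2 ^ (k - 1)" by (metis power_Suc)
        then show ?thesis by (simp only: power_mult)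
      qed
      then have "(B * pi * (real (2 * k\<^sup>2 + 1) * r n)\<^sup>2) ^ k = C ^ k * (r n)\<^sup>2 * r n ^ (2 * (k - 1))"
        unfolding C_def by (simp only: power_mult_distrib mult.assoc)
      then have "t n * (q n - C ^ k * (real n * (r n)\<^sup>2)) =
          real (n choose k) * (copy_prob (r n) - real n * (B * pi * (real (2 * k\<^sup>2 + 1) * r n)\<^sup>2) ^ k)
            / (real n ^ k * r n ^ (2 * (k - 1)))"
        using n r unfolding t_def q_def by (simp add: field_simps)
      also have "\<dots> \<le> expectation (\<lambda>\<omega>. real (card (iso_sets (r n) n \<omega>))) / (real n ^ k * r n ^ (2 * (k - 1)))"
        using r by (intro divide_right_mono expectation_iso_count_bounds(2)) auto
      finally show "t n * (q n - C ^ k * (real n * (r n)\<^sup>2))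
        \<le> expectation (\<lambda>\<omega>. real (card (iso_sets (r n) n \<omega>))) / (real n ^ k * r n ^ (2 * (k - 1)))" .
    qed
    show "\<forall>\<^sub>F n in sequentially. expectation (\<lambda>\<omega>. real (card (iso_sets (r n) n \<omega>))) / (real n ^ k * r n ^ (2 * (k - 1))) \<le> t n * q n"
    proof (rule eventually_sequentiallyI[of 1])
      fix n :: nat assume n: "1 \<le> n"
      have r: "0 < r n" by (rule r_pos[OF n])
      have "expectation (\<lambda>\<omega>. real (card (iso_sets (r n) n \<omega>))) / (real n ^ k * r n ^ (2 * (k - 1))) \<le>
          real (n choose k) * copy_prob (r n) / (real n ^ k * r n ^ (2 * (k - 1)))"
        using r by (intro divide_right_mono expectation_iso_count_bounds(1)) auto
      then show "expectation (\<lambda>\<omega>. real (card (iso_sets (r n) n \<omega>))) / (real n ^ k * r n ^ (2 * (k - 1))) \<le> t n * q n"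
        by (simp add: t_def q_def)
    qed
  qed
qed

text \<open>Both counts lie between 0 and n^k and agree off the exceptional event.\<close>

lemma expectation_trunc_count_diff:
  shows "\<bar>expectation (\<lambda>\<omega>. real (card (iso_sets r n \<omega>))) - expectation (trunc_count m r n)\<bar>
    \<le> real n ^ k * prob {\<omega> \<in> space M. trunc_count m r n \<omega> \<noteq> real (card (iso_sets r n \<omega>))}"
proof -
  let ?D = "{\<omega> \<in> space M. trunc_count m r n \<omega> \<noteq> real (card (iso_sets r n \<omega>))}"
  have iso_le: "real (card (iso_sets r n \<omega>)) \<le> real n ^ k" for \<omega>
    using card_iso_sets_le[of r n \<omega>] by (simp flip: of_nat_power)
  have i1: "integrable M (\<lambda>\<omega>. real (card (iso_sets r n \<omega>)))"
    by (rule integrable_const_bound[where B = "real n ^ k"]) (auto simp: card_iso_sets_le)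
  have i2: "integrable M (trunc_count m r n)"
    by (rule integrable_const_bound[where B = "real n ^ k"])
      (auto simp: trunc_count_nonneg intro: order_trans[OF trunc_count_le_iso_count iso_le])
  have "\<bar>expectation (\<lambda>\<omega>. real (card (iso_sets r n \<omega>))) - expectation (trunc_count m r n)\<bar>
      = \<bar>expectation (\<lambda>\<omega>. real (card (iso_sets r n \<omega>)) - trunc_count m r n \<omega>)\<bar>"
    using i1 i2 by simp
  also have "\<dots> \<le> expectation (\<lambda>\<omega>. \<bar>real (card (iso_sets r n \<omega>)) - trunc_count m r n \<omega>\<bar>)"
    by (rule integral_abs_bound)
  also have "\<dots> \<le> expectation (\<lambda>\<omega>. real n ^ k * indicator ?D \<omega>)"
  proof (intro integral_mono)
    show "integrable M (\<lambda>\<omega>. real n ^ k * indicator ?D \<omega>)"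
      by (intro integrable_mult_right integrable_real_indicator) (auto simp: emeasure_eq_measure)
    fix \<omega> assume "\<omega> \<in> space M"
    show "\<bar>real (card (iso_sets r n \<omega>)) - trunc_count m r n \<omega>\<bar> \<le> real n ^ k * indicator ?D \<omega>"
    proof (cases "\<omega> \<in> ?D")
      case True
      have "\<bar>real (card (iso_sets r n \<omega>)) - trunc_count m r n \<omega>\<bar> \<le> real n ^ k"
        using trunc_count_nonneg[of m r n \<omega>] trunc_count_le_iso_count[of m r n \<omega>] iso_le[of \<omega>]
        by linarith
      then show ?thesis using True by simp
    qed (use \<open>\<omega> \<in> space M\<close> in simp)
  qed (use i1 i2 in auto)
  also have "\<dots> = real n ^ k * prob ?D" by simp
  finally show ?thesis .
qed

theorem iso_count_strong_law:
  assumes k: "2 \<le> k" and cont: "AE x in lborel. isCont f x"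
    and r_pos: "\<And>n. 1 \<le> n \<Longrightarrow> 0 < r n" and r_lim: "r \<longlonglongrightarrow> 0"
    and nr2: "(\<lambda>n. real n * (r n)\<^sup>2) \<longlonglongrightarrow> 0"
    and ln_small: "(\<lambda>n. ln (real n)) \<in> o(\<lambda>n. real n ^ (2 * k - 1) * r n ^ (4 * (k - 1)))"
  shows "AE \<omega> in M. (\<lambda>n. real (card (iso_sets (r n) n \<omega>)) / (real n ^ k * r n ^ (2 * (k - 1)))) \<longlonglongrightarrow> mu \<alpha> f T"
proof -
  define a where "a n = real n ^ k * r n ^ (2 * (k - 1))" for n
  define b where "b n = real n ^ (2 * k - 1) * r n ^ (4 * (k - 1))" for n
  \<comment> \<open>The maximum with 1 secures positivity of C.\<close>
  define C where "C = max 1 (B * pi * (real (2 * k\<^sup>2 + 2))\<^sup>2)"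
  define K where "K = real (2 * (2 * (2 * k\<^sup>2 + 2) + 1)\<^sup>2)"
  have K: "0 < K" unfolding K_def of_nat_0_less_iff by simp
  have C: "0 < C" by (simp add: C_def)
  obtain m :: "nat \<Rightarrow> nat" and D :: real
    where m_pos: "\<forall>\<^sub>F n in sequentially. 0 < m n" and D: "0 \<le> D"
      and crowd: "\<forall>\<^sub>F n in sequentially. real n * (real n * (C * (r n)\<^sup>2)) ^ m n \<le> D / real n ^ (k + 2)"
      and small: "\<And>c. 0 < c \<Longrightarrow> \<forall>\<^sub>F n in sequentially. ln (real n) * real (m n) ^ (2 * k) \<le> c * b n"
    by (rule truncation_level[OF k C r_pos nr2 ln_small], assumption) (rule that[unfolded b_def]; assumption)
  define H where "H n \<omega> = real (card (iso_sets (r n) n \<omega>))" for n \<omega>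
  define H' where "H' n = trunc_count (m n ^ k) (r n) n" for n
  have [measurable]: "H n \<in> borel_measurable M" "H' n \<in> borel_measurable M" for n
    unfolding H_def[abs_def] H'_def by measurable
  have a_pos: "0 < a n" if "1 \<le> n" for n using that r_pos[OF that] by (simp add: a_def)
  \<comment> \<open>McDiarmid's exponent contains a^2 / n, and this is precisely
    \<open>b\<close>.\<close>
  have a_b: "(a n)\<^sup>2 = real n * b n" if "1 \<le> n" for n
  proof -
    have "real n * b n = real n ^ Suc (2 * k - 1) * r n ^ (4 * (k - 1))" by (simp add: b_def)
    also have "Suc (2 * k - 1) = k * 2" using k by simp
    also have "4 * (k - 1) = (2 * (k - 1)) * 2" by simp
    finally show ?thesis by (simp only: a_def power_mult power_mult_distrib)
  qed
  have neq: "\<forall>\<^sub>F n in sequentially. prob {\<omega> \<in> space M. H' n \<omega> \<noteq> H n \<omega>} \<le> D / real n ^ (k + 2)"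
    using crowd eventually_ge_at_top[of 1]
  proof eventually_elim
    case (elim n)
    have "prob {\<omega> \<in> space M. H' n \<omega> \<noteq> H n \<omega>}
        \<le> real n * (real n * (B * pi * (real (2 * k\<^sup>2 + 2) * r n)\<^sup>2)) ^ m n"
      unfolding H_def H'_def by (rule prob_trunc_count_neq[OF r_pos[OF elim(2)]])
    also have "\<dots> \<le> real n * (real n * (C * (r n)\<^sup>2)) ^ m n"
    proof -
      have "B * pi * (real (2 * k\<^sup>2 + 2) * r n)\<^sup>2 = (B * pi * (real (2 * k\<^sup>2 + 2))\<^sup>2) * (r n)\<^sup>2"
        by (simp only: power_mult_distrib mult.assoc)
      also have "\<dots> \<le> C * (r n)\<^sup>2" unfolding C_def by (intro mult_right_mono) auto
      finally show ?thesis
        using B_nonneg by (intro mult_left_mono power_mono) auto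
    qed
    finally show ?case using elim(1) by linarith
  qed
  \<comment> \<open>From 1 <= ln n and 1 <= m it follows that b >= 1, hence a^2 = n b >= 1. Absolute
    errors in the mean may thus be divided by \<open>a n\<close> without growing.\<close>
  have a_ge: "\<forall>\<^sub>F n in sequentially. 1 \<le> a n"
    using small[OF zero_less_one] m_pos eventually_ge_at_top[of 3]
  proof eventually_elim
    case (elim n)
    have ln: "1 \<le> ln (real n)" using elim(3) exp_le by (subst ln_ge_iff) auto
    have "1 * 1 \<le> ln (real n) * real (m n) ^ (2 * k)"
      using ln elim(2) by (intro mult_mono one_le_power) auto
    then have "1 \<le> b n" using elim(1) by simp
    then have "1 * 1 \<le> real n * b n" using elim(3) by (intro mult_mono) auto
    then have "1\<^sup>2 \<le> (a n)\<^sup>2" using a_b[of n] elim(3) by simp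
    then show "1 \<le> a n" using a_pos[of n] elim(3) by (subst (asm) power2_le_iff_abs_le) auto
  qed
  \<comment> \<open>The trivial bound n^k on the counts against the probability D / n^(k+2) leaves D
    / n^2.\<close>
  have E_diff: "(\<lambda>n. expectation (H n) / a n - expectation (H' n) / a n) \<longlonglongrightarrow> 0"
  proof (rule Lim_null_comparison)
    show "(\<lambda>n. D / real n) \<longlonglongrightarrow> 0"
      by (intro real_tendsto_divide_at_top[OF tendsto_const filterlim_real_sequentially])
    show "\<forall>\<^sub>F n in sequentially. norm (expectation (H n) / a n - expectation (H' n) / a n) \<le> D / real n"
      using neq a_ge eventually_ge_at_top[of 1]
    proof eventually_elim
      case (elim n)
      have "norm (expectation (H n) / a n - expectation (H' n) / a n) = \<bar>expectation (H n) - expectation (H' n)\<bar> / a n"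
        using elim by (simp add: diff_divide_distrib[symmetric])
      also have "\<dots> \<le> \<bar>expectation (H n) - expectation (H' n)\<bar> / 1"
        using elim by (intro divide_left_mono) auto
      also have "\<dots> \<le> real n ^ k * prob {\<omega> \<in> space M. H' n \<omega> \<noteq> H n \<omega>}"
        using expectation_trunc_count_diff[of "r n" n "m n ^ k"] unfolding H_def[abs_def] H'_def by simp
      also have "\<dots> \<le> real n ^ k * (D / real n ^ (k + 2))"
        using elim by (intro mult_left_mono) auto
      also have "\<dots> = D / real n ^ 2" using elim by (simp add: power_add power2_eq_square)
      also have "\<dots> \<le> D / real n" using elim D by (intro divide_left_mono) (auto simp: power2_eq_square)
      finally show ?case .
    qed
  qed
  have "(\<lambda>n. expectation (H n) / a n) \<longlonglongrightarrow> mu \<alpha> f T"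
    unfolding H_def[abs_def] a_def by (rule expectation_iso_count_tendsto[OF cont r_pos r_lim nr2])
  from tendsto_diff[OF this E_diff]
  have E': "(\<lambda>n. expectation (H' n) / a n) \<longlonglongrightarrow> mu \<alpha> f T" by simp
  \<comment> \<open>The true count is compared with the mean of the truncated count, whose
    normalised limit is already known.\<close>
  have AE_dev: "AE \<omega> in M. \<forall>\<^sub>F n in sequentially. \<bar>H n \<omega> - expectation (H' n)\<bar> < s * a n" if s: "0 < s" for s
  proof -
    define A where "A n = {\<omega> \<in> space M. s * a n \<le> \<bar>H n \<omega> - expectation (H' n)\<bar>}" for n
    have A[measurable]: "A n \<in> events" for n unfolding A_def by measurable
    have conc: "\<forall>\<^sub>F n in sequentially. prob {\<omega> \<in> space M. s * a n \<le> \<bar>H' n \<omega> - expectation (H' n)\<bar>} \<le> 2 / real n ^ 2"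
    proof -
      \<comment> \<open>With this constant the exponent s^2 b / (2 m^(2k) K^2) is at least 2 ln n,
        so the tail is at most 2 / n^2.\<close>
      have "0 < s\<^sup>2 / (4 * K\<^sup>2)" using s K by simp
      from small[OF this] m_pos eventually_ge_at_top[of 1] show ?thesis
      proof eventually_elim
        case (elim n)
        have "prob {\<omega> \<in> space M. s * a n \<le> \<bar>H' n \<omega> - expectation (H' n)\<bar>}
            \<le> 2 * exp (- (s * a n)\<^sup>2 / (2 * (real (m n ^ k * (2 * (2 * (2 * k\<^sup>2 + 2) + 1)\<^sup>2)))\<^sup>2 * real n))"
          unfolding H'_def using elim s a_pos by (intro trunc_count_concentration r_pos) auto
        also have "(real (m n ^ k * (2 * (2 * (2 * k\<^sup>2 + 2) + 1)\<^sup>2)))\<^sup>2 = real (m n) ^ (2 * k) * K\<^sup>2"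
          unfolding K_def of_nat_mult[of "m n ^ k"] of_nat_power[of "m n"] power_mult_distrib
          by (simp only: power_mult[symmetric] mult.commute[of k])
        also have "exp (- (s * a n)\<^sup>2 / (2 * (real (m n) ^ (2 * k) * K\<^sup>2) * real n)) \<le> exp (- (2 * ln (real n)))"
        proof -
          have "(s * a n)\<^sup>2 / (2 * (real (m n) ^ (2 * k) * K\<^sup>2) * real n) = s\<^sup>2 * b n / (2 * (real (m n) ^ (2 * k) * K\<^sup>2))"
            using elim(3) a_b[OF elim(3)] by (simp add: power_mult_distrib)
          moreover have "2 * ln (real n) \<le> s\<^sup>2 * b n / (2 * (real (m n) ^ (2 * k) * K\<^sup>2))"
            using elim(1,2) K by (simp add: field_simps)
          ultimately show ?thesis by simp
        qed
        also have "exp (- (2 * ln (real n))) = 1 / real n ^ 2"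
        proof -
          have "exp (2 * ln (real n)) = exp (ln (real n)) ^ 2" by (simp add: exp_double)
          then show ?thesis using elim(3) by (simp add: exp_minus inverse_eq_divide)
        qed
        finally show ?case by simp
      qed
    qed
    have "\<forall>\<^sub>F n in sequentially. norm (prob (A n)) \<le> (D + 2) * (1 / real n ^ 2)"
      using conc neq eventually_ge_at_top[of 1]
    proof eventually_elim
      case (elim n)
      have "prob (A n) \<le> prob ({\<omega> \<in> space M. s * a n \<le> \<bar>H' n \<omega> - expectation (H' n)\<bar>} \<union> {\<omega> \<in> space M. H' n \<omega> \<noteq> H n \<omega>})"
        unfolding A_def by (intro finite_measure_mono) auto
      also have "\<dots> \<le> prob {\<omega> \<in> space M. s * a n \<le> \<bar>H' n \<omega> - expectation (H' n)\<bar>} + prob {\<omega> \<in> space M. H' n \<omega> \<noteq> H n \<omega>}"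
        by (intro measure_Un_le) measurable
      also have "\<dots> \<le> 2 / real n ^ 2 + D / real n ^ (k + 2)" using elim by linarith
      also have "D / real n ^ (k + 2) \<le> D / real n ^ 2"
        using elim(3) D by (intro divide_left_mono power_increasing) auto
      finally show ?case by (simp add: add_divide_distrib)
    qed
    moreover have "summable (\<lambda>n. (D + 2) * (1 / real n ^ 2))"
      using inverse_power_summable[of 2, where 'a = real] by (intro summable_mult) (simp add: inverse_eq_divide)
    ultimately have "summable (\<lambda>n. prob (A n))" by (rule summable_comparison_test_ev)
    then have "AE \<omega> in M. \<forall>\<^sub>F n in sequentially. \<omega> \<in> space M - A n"
      by (intro borel_cantelli_AE1 A) (auto simp: emeasure_eq_measure)
    then show ?thesis
    proof eventually_elim
      case (elim \<omega>)
      then show ?case by eventually_elim (auto simp: A_def)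
    qed
  qed
  \<comment> \<open>Countably many tolerances 1 / (l + 1) give one null set that serves for all of
    them.\<close>
  have "AE \<omega> in M. \<forall>l. \<forall>\<^sub>F n in sequentially. \<bar>H n \<omega> - expectation (H' n)\<bar> < inverse (real (Suc l)) * a n"
    unfolding AE_all_countable by (intro allI AE_dev) simp
  then show ?thesis
  proof eventually_elim
    case (elim \<omega>)
    have "(\<lambda>n. H n \<omega> / a n - expectation (H' n) / a n) \<longlonglongrightarrow> 0"
    proof (rule tendstoI)
      fix e :: real assume "0 < e"
      then obtain l where l: "inverse (real (Suc l)) < e" using reals_Archimedean by blast
      from elim[rule_format, of l] eventually_ge_at_top[of 1]
      show "\<forall>\<^sub>F n in sequentially. dist (H n \<omega> / a n - expectation (H' n) / a n) 0 < e"
      proof eventually_elim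
        case (elim n)
        have "dist (H n \<omega> / a n - expectation (H' n) / a n) 0 = \<bar>H n \<omega> - expectation (H' n)\<bar> / a n"
          using a_pos[OF elim(2)] by (simp add: dist_real_def diff_divide_distrib[symmetric])
        also have "\<dots> < inverse (real (Suc l))"
          using elim(1) a_pos[OF elim(2)] by (simp add: pos_divide_less_eq)
        finally show ?case using l by linarith
      qed
    qed
    from tendsto_add[OF this E'] show ?case unfolding H_def a_def by simp
  qed
qed

end

theorem theorem3:
  fixes \<alpha> :: real
    and f :: "real^2 \<Rightarrow> real"
    and r :: "nat \<Rightarrow> real"
    and k :: nat
    and T :: "('v, 'e) pre_digraph"
    and M :: "'w measure"
    and X :: "nat \<Rightarrow> 'w \<Rightarrow> real^2"
    and Y :: "nat \<Rightarrow> 'w \<Rightarrow> real"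
  assumes alpha: "0 < \<alpha>" "\<alpha> \<le> 2 * pi"
    and f_pdf: "f \<in> borel_measurable borel" "\<And>x. 0 \<le> f x" "(\<integral>\<^sup>+x. ennreal (f x) \<partial>lborel) = 1"
    and f_bounded: "bounded (range f)"
    and f_cont: "AE x in lborel. isCont f x"
    and M: "prob_space M"
    and X_indep: "prob_space.indep_vars M (\<lambda>_. borel) X {1..}"
    and X_density: "\<And>i. 1 \<le> i \<Longrightarrow> distributed M lborel (X i) (\<lambda>x. ennreal (f x))"
    and Y_indep: "prob_space.indep_vars M (\<lambda>_. borel) Y {1..}"
    and Y_uniform: "\<And>i. 1 \<le> i \<Longrightarrow> distr M borel (Y i) = uniform_measure lborel {0..<2 * pi}"
    and XY_indep: "prob_space.indep_set M
          (sets (vimage_algebra (space M) (\<lambda>\<omega>. \<lambda>i\<in>{1..}. X i \<omega>) (\<Pi>\<^sub>M i\<in>{1..}. borel)))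
          (sets (vimage_algebra (space M) (\<lambda>\<omega>. \<lambda>i\<in>{1..}. Y i \<omega>) (\<Pi>\<^sub>M i\<in>{1..}. borel)))"
    and r_pos: "\<And>n. 1 \<le> n \<Longrightarrow> 0 < r n"
    and r_lim: "r \<longlonglongrightarrow> 0"
    and k: "2 \<le> k"
    and T: "digraph T" "card (verts T) = k" "Digraph_Component.connected T" "feasible \<alpha> M X Y T"
    and nr2: "(\<lambda>n. real n * (r n)\<^sup>2) \<longlonglongrightarrow> 0"
    and ln_small: "(\<lambda>n. ln (real n)) \<in> o(\<lambda>n. real n ^ (2 * k - 1) * r n ^ (4 * (k - 1)))"
  shows "AE \<omega> in M.
    (\<lambda>n. real (isolated_count (sector_digraph \<alpha> n (\<lambda>i. X i \<omega>) (\<lambda>i. Y i \<omega>) (r n)) T)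
           / (real n ^ k * r n ^ (2 * (k - 1))))
      \<longlonglongrightarrow> mu \<alpha> f T"
proof -
  interpret prob_space M by (rule M)
  obtain B where B: "\<And>x. norm (f x) \<le> B"
    using f_bounded unfolding bounded_iff by auto
  interpret S: sector_pattern M f B X Y \<alpha> T k
  proof (intro sector_pattern.intro sector_process.intro sector_process_axioms.intro
      sector_pattern_axioms.intro M)
    show "f x \<le> B" for x using B[of x] by simp
    show "distr M borel (X i) = density lborel (\<lambda>x. ennreal (f x))" if "1 \<le> i" for i
      using distributed_distr_eq_density[OF X_density[OF that]] by (simp cong: distr_cong)
    show "wf_digraph T"
    proof -
      interpret T: digraph T by (rule T(1))
      show ?thesis by unfold_locales
    qed
  qed (use f_pdf X_indep Y_indep Y_uniform XY_indep T k in auto)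
  \<comment> \<open>Off a single null set the points are distinct for all n at once, so vertex sets
    and index sets may be interchanged along the whole sequence.\<close>
  have "AE \<omega> in M. \<forall>n. isolated_count (sector_digraph \<alpha> n (\<lambda>i. X i \<omega>) (\<lambda>i. Y i \<omega>) (r n)) T
      = card (S.iso_sets (r n) n \<omega>)"
    using S.AE_distinct_points
  proof eventually_elim
    case (elim \<omega>)
    then show ?case
      unfolding S.iso_sets_def by (intro allI isolated_count_eq_card_isolated_copies) blast
  qed
  moreover have "AE \<omega> in M. (\<lambda>n. real (card (S.iso_sets (r n) n \<omega>)) / (real n ^ k * r n ^ (2 * (k - 1))))
      \<longlonglongrightarrow> mu \<alpha> f T"
    using k f_cont r_pos r_lim nr2 ln_small by (rule S.iso_count_strong_law)
  ultimately show ?thesis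
    by eventually_elim simp
qed

end
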